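(* Let $\tilde{\mathcal G}=(\tilde V,\tilde E)$ be a finite, undirected, connected graph without self-loops, with reference vertex $\delta\in\tilde V$, $V=\tilde V\setminus\{\delta\}$, and positive symmetric edge weights $W$. Let $f:\mathbb{R}^2\to\mathbb{C}$ be a harmonic function and $\theta\in\mathbb{R}^{\tilde V}$. Assume that every coefficient of the Taylor expansion in the Grassmann variables $\xi,\eta$ of the superfunction $f(\langle\theta,x+z\rangle,\langle\theta,y\rangle)\,e^{\mathcal S}$ decays at least exponentially fast in $\|(x,y)\|$ at infinity. Then $$\mathbb{E}_{D\mu^W}\left[f(\langle\theta,x+z\rangle,\langle\theta,y\rangle)\right]=f(\langle\theta,1\rangle,0),$$ where $\langle\theta,1\rangle=\sum_{i\in\tilde V}\theta_i$.
   Context: Weights: $W_{ij}=W_{ji}>0$ for every undirected edge $(i\sim j)\in\tilde E$ and $W_{ij}=0$ if $i\not\sim j$. Sums over $(i\sim j)\in\tilde E$ run over undirected edges, each counted once. $\langle a,b\rangle=\sum_{i\in\tilde V}a_ib_i$. **Superfunctions.** Let $\xi_i,\eta_i$, $i\in V$, be independent Grassmann variables (generators of a Grassmann algebra, all mutually anticommuting). A superfunction is an element of the Grassmann algebra generated by the $\xi_i,\eta_i$ with coefficients that are (smooth, complex-valued) functions of $(x,y)=((x_i)_{i\in V},(y_i)_{i\in V})\in\mathbb{R}^V\times\mathbb{R}^V$. A smooth function evaluated at even superfunctions is defined by its (terminating) Taylor expansion in the nilpotent parts around the degree-zero parts; $f(\cdot,\cdot)$ above is understood in this sense. $\partial_{\xi_i},\partial_{\eta_i}$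 are the usual (left) Grassmann derivatives. At the reference vertex set $x_\delta=y_\delta=\xi_\delta=\eta_\delta=0$, and for $i\in\tilde V$ $$z_i=\sqrt{1+x_i^2+y_i^2+2\xi_i\eta_i}\qquad(\text{so } z_\delta=1).$$ **Action and superexpectation.** $$\mathcal S=-\sum_{(i\sim j)\in\tilde E}W_{ij}\bigl(z_iz_j-(1+x_ix_j+y_iy_j+\xi_i\eta_j-\eta_i\xi_j)\bigr).$$ (Edges $i\sim\delta$ contribute $-W_{i\delta}(z_i-1)$.) For a superfunction $F$, $$\mathbb{E}_{D\mu^W}[F]=\int_{\mathbb{R}^V\times\mathbb{R}^V}\Bigl(\prod_{i\in V}\frac{dx_i\,dy_i}{2\pi}\,\partial_{\xi_i}\partial_{\eta_i}\Bigr)\Bigl[\Bigl(\prod_{i\in V}\frac1{z_i}\Bigr)e^{\mathcal S}F\Bigr],$$ i.e. one applies all Grassmann derivatives to the superfunction in brackets and integrates the resulting function of $(x,y)$ against Lebesgue measure, whenever this integral exists. This is the cartesian-coordinate form of the $H^{2|2}$ model; it corresponds to horospherical coordinates $(u,s,\overline\psi,\psi)$ via $x_i=\sinh u_i-(\frac12s_i^2+\overline\psi_i\psi_i)e^{u_i}$, $y_i=s_ie^{u_i}$, $\xi_i=e^{u_i}\overline\psi_i$, $\eta_i=e^{u_i}\psi_i$, $z_i=\cosh u_i+(\frac12s_i^2+\overline\psi_i\psi_i)e^{u_i}$, in which $\mathcal S=-\sum_{(i\sim j)\in\tilde E}W_{ij}\bigl[\cosh(u_i-u_j)-1+[\frac12(s_i-s_j)^2+(\overline\psi_i-\overline\psi_j)(\psi_i-\psi_j)]e^{u_i+u_j}\bigr]$.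 *)

theory Defs
  imports "HOL-Analysis.Analysis"
begin

section \<open>Grassmann algebras\<close>

text \<open>
  An element of the Grassmann algebra over the generators \<open>'g\<close> is given by its coefficients: the
  coefficient at \<open>S\<close> belongs to the monomial that multiplies the generators of \<open>S\<close> in increasing
  order. The enumeration \<^const>\<open>to_nat\<close> of the finite type \<open>'g\<close> serves as this (arbitrary) order.
\<close>

typedef ('g, 'c) grassmann = "UNIV :: ('g::finite set \<Rightarrow> 'c) set"
  morphisms coeff Grassmann ..

lemmas coeff_Grassmann [simp] = Grassmann_inverse[OF UNIV_I]

lemma grassmann_eqI: "(\<And>S. coeff F S = coeff G S) \<Longrightarrow> F = G"
  by (simp add: coeff_inject[symmetric] fun_eq_iff)

definition inversions :: "'g::finite set \<Rightarrow> 'g set \<Rightarrow> nat" where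
  "inversions A B = card {(a, b). a \<in> A \<and> b \<in> B \<and> to_nat b < to_nat a}"

definition reorder_sign :: "'g::finite set \<Rightarrow> 'g set \<Rightarrow> 'c::comm_ring_1" where
  "reorder_sign A B = (-1) ^ inversions A B"

lemma inversions_Un_left:
  assumes "A \<inter> B = {}" shows "inversions (A \<union> B) C = inversions A C + inversions B C"
proof -
  have "{(a, c). a \<in> A \<union> B \<and> c \<in> C \<and> to_nat c < to_nat a} =
      {(a, c). a \<in> A \<and> c \<in> C \<and> to_nat c < to_nat a} \<union> {(a, c). a \<in> B \<and> c \<in> C \<and> to_nat c < to_nat a}"
    by auto
  then show ?thesis unfolding inversions_def
    using assms by (subst card_Un_disjoint[symmetric]) auto
qed

lemma inversions_Un_right:
  assumes "B \<inter> C = {}" shows "inversions A (B \<union> C) = inversions A B + inversions A C"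
proof -
  have "{(a, c). a \<in> A \<and> c \<in> B \<union> C \<and> to_nat c < to_nat a} =
      {(a, c). a \<in> A \<and> c \<in> B \<and> to_nat c < to_nat a} \<union> {(a, c). a \<in> A \<and> c \<in> C \<and> to_nat c < to_nat a}"
    by auto
  then show ?thesis unfolding inversions_def
    using assms by (subst card_Un_disjoint[symmetric]) auto
qed

lemma reorder_sign_Un_left:
  "A \<inter> B = {} \<Longrightarrow> reorder_sign (A \<union> B) C = reorder_sign A C * reorder_sign B C"
  by (simp add: reorder_sign_def inversions_Un_left power_add)

lemma reorder_sign_Un_right:
  "B \<inter> C = {} \<Longrightarrow> reorder_sign A (B \<union> C) = reorder_sign A B * reorder_sign A C"
  by (simp add: reorder_sign_def inversions_Un_right power_add)

lemma reorder_sign_empty [simp]: "reorder_sign {} B = 1" "reorder_sign A {} = 1"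
  by (simp_all add: reorder_sign_def inversions_def)

lemma reorder_sign_singletons:
  "reorder_sign {a} {b} = (if to_nat b < to_nat a then - 1 else 1)"
proof -
  have "{(a', b'). a' \<in> {a} \<and> b' \<in> {b} \<and> to_nat b' < to_nat a'} =
      (if to_nat b < to_nat a then {(a, b)} else {})"
    by auto
  then show ?thesis by (simp add: reorder_sign_def inversions_def)
qed

instantiation grassmann :: (finite, comm_ring_1) ring_1
begin

definition "0 = Grassmann (\<lambda>S. 0)"
definition "1 = Grassmann (\<lambda>S. if S = {} then 1 else 0)"
definition "F + G = Grassmann (\<lambda>S. coeff F S + coeff G S)"
definition "F - G = Grassmann (\<lambda>S. coeff F S - coeff G S)"
definition "- F = Grassmann (\<lambda>S. - coeff F S)"
definition "F * G = Grassmann (\<lambda>S.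
  \<Sum>A\<in>Pow S. reorder_sign A (S - A) * coeff F A * coeff G (S - A))"

instance
proof
  fix F G H :: "('a, 'b) grassmann"
  note defs = zero_grassmann_def one_grassmann_def plus_grassmann_def minus_grassmann_def
    uminus_grassmann_def times_grassmann_def
  show "F + G + H = F + (G + H)" "F + G = G + F" "0 + F = F" "- F + F = 0" "F - G = F + - G"
    by (simp_all add: defs add_ac coeff_inverse)
  show "(0::('a, 'b) grassmann) \<noteq> 1"
    by (auto simp: defs coeff_inject[symmetric] fun_eq_iff)
  show "(F + G) * H = F * H + G * H" "F * (G + H) = F * G + F * H"
    by (simp_all add: defs algebra_simps sum.distrib)
  show "1 * F = F"
  proof (rule grassmann_eqI)
    fix S
    have "coeff (1 * F) S = (\<Sum>A\<in>Pow S. if A = {} then coeff F S else 0)"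
      unfolding defs coeff_Grassmann by (rule sum.cong) auto
    then show "coeff (1 * F) S = coeff F S" by simp
  qed
  show "F * 1 = F"
  proof (rule grassmann_eqI)
    fix S
    have "coeff (F * 1) S = (\<Sum>A\<in>Pow S. if A = S then coeff F S else 0)"
      unfolding defs coeff_Grassmann by (rule sum.cong) auto
    then show "coeff (F * 1) S = coeff F S" by simp
  qed
  show "F * G * H = F * (G * H)"
  proof (rule grassmann_eqI)
    fix C
    let ?s = "reorder_sign :: 'a set \<Rightarrow> 'a set \<Rightarrow> 'b"
    have "coeff (F * G * H) C = (\<Sum>(D, A)\<in>Sigma (Pow C) Pow.
        ?s A (D - A) * ?s D (C - D) * (coeff F A * coeff G (D - A) * coeff H (C - D)))"
      by (simp add: defs sum_distrib_left sum_distrib_right sum.Sigma mult_ac)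
    also have "\<dots> = (\<Sum>(A, B)\<in>Sigma (Pow C) (\<lambda>A. Pow (C - A)).
        ?s A (C - A) * ?s B (C - A - B) * (coeff F A * coeff G B * coeff H (C - A - B)))"
    proof (rule sum.reindex_bij_witness[where
          j = "\<lambda>(D, A). (A, D - A)" and i = "\<lambda>(A, B). (A \<union> B, A)"])
      fix p assume "p \<in> Sigma (Pow C) Pow"
      then obtain D A where p: "p = (D, A)" "A \<subseteq> D" "D \<subseteq> C" by auto
      have D: "D = A \<union> (D - A)" and CA: "C - A = (D - A) \<union> (C - D)" using p by auto
      have "?s D (C - D) = ?s A (C - D) * ?s (D - A) (C - D)"
        by (subst D) (rule reorder_sign_Un_left, auto)
      moreover have "?s A (C - A) = ?s A (D - A) * ?s A (C - D)"
        by (subst CA) (rule reorder_sign_Un_right, auto)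
      moreover have "C - A - (D - A) = C - D" using p by auto
      ultimately show "(case case p of (D, A) \<Rightarrow> (A, D - A) of (A, B) \<Rightarrow>
          ?s A (C - A) * ?s B (C - A - B) * (coeff F A * coeff G B * coeff H (C - A - B))) =
        (case p of (D, A) \<Rightarrow>
          ?s A (D - A) * ?s D (C - D) * (coeff F A * coeff G (D - A) * coeff H (C - D)))"
        by (simp add: p mult_ac)
    qed auto
    also have "\<dots> = coeff (F * (G * H)) C"
      by (simp add: defs sum_distrib_left sum_distrib_right sum.Sigma mult_ac)
    finally show "coeff (F * G * H) C = coeff (F * (G * H)) C" .
  qed
qed

end

definition const :: "'c \<Rightarrow> ('g::finite, 'c::comm_ring_1) grassmann" where
  "const c = Grassmann (\<lambda>S. if S = {} then c else 0)"

definition gen :: "'g::finite \<Rightarrow> ('g, 'c::comm_ring_1) grassmann" where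
  "gen a = Grassmann (\<lambda>S. if S = {a} then 1 else 0)"

definition body :: "('g::finite, 'c) grassmann \<Rightarrow> 'c" where
  "body F = coeff F {}"

definition complexify :: "('g::finite, real) grassmann \<Rightarrow> ('g, complex) grassmann" where
  "complexify F = Grassmann (\<lambda>S. of_real (coeff F S))"

text \<open>
  Left derivative: \<open>a\<close> is moved to the front of each monomial, past the smaller generators, and
  deleted; the lemmas \<open>grassmann_deriv_one\<close> and \<open>grassmann_deriv_gen_times\<close> below characterize it.
\<close>

definition grassmann_deriv :: "'g::finite \<Rightarrow> ('g, 'c::comm_ring_1) grassmann \<Rightarrow> ('g, 'c) grassmann" where
  "grassmann_deriv a F = Grassmann (\<lambda>S. if a \<in> S then 0 else reorder_sign {a} S * coeff F (insert a S))"

lemma coeff_gen_times: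
  "coeff (gen a * F) S = (if a \<in> S then reorder_sign {a} (S - {a}) * coeff F (S - {a}) else 0)"
proof -
  have "coeff (gen a * F) S =
      (\<Sum>A\<in>Pow S. if A = {a} then reorder_sign {a} (S - {a}) * coeff F (S - {a}) else 0)"
    unfolding times_grassmann_def gen_def coeff_Grassmann by (rule sum.cong) auto
  then show ?thesis by simp
qed

lemma coeff_gen: "coeff (gen a) S = (if S = {a} then 1 else 0)"
  by (simp add: gen_def)

lemma reorder_sign_swap:
  "a \<noteq> b \<Longrightarrow> reorder_sign {a} {b} = - (reorder_sign {b} {a} :: 'c::comm_ring_1)"
  unfolding reorder_sign_singletons using linorder_neqE_nat by fastforce

lemma reorder_sign_insert:
  "b \<notin> S \<Longrightarrow> reorder_sign A (insert b S) = reorder_sign A {b} * reorder_sign A S"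
  using reorder_sign_Un_right[of "{b}" S A] by simp

lemma reorder_sign_square [simp]: "reorder_sign A B * reorder_sign A B = 1"
  by (simp add: reorder_sign_def flip: power_mult_distrib)

lemma reorder_sign_square_left [simp]: "reorder_sign A B * (reorder_sign A B * c) = c"
  by (simp flip: mult.assoc)

lemma gen_anticommute:
  "gen a * gen b = - (gen b * gen a :: ('g::finite, 'c::comm_ring_1) grassmann)"
proof (rule grassmann_eqI)
  fix S
  show "coeff (gen a * gen b :: ('g, 'c) grassmann) S = coeff (- (gen b * gen a)) S"
  proof (cases "a = b")
    case True
    then show ?thesis
      by (auto simp: uminus_grassmann_def coeff_gen_times coeff_gen)
  next
    case False
    then show ?thesis
      using reorder_sign_swap[of a b, where 'c='c]
      by (auto simp: uminus_grassmann_def coeff_gen_times coeff_gen insert_Diff_if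
          dest!: subset_singletonD)
  qed
qed

lemma gen_square: "gen a * gen a = 0"
  by (rule grassmann_eqI) (auto simp: coeff_gen_times coeff_gen zero_grassmann_def)

lemma grassmann_deriv_one: "grassmann_deriv a 1 = 0"
  by (rule grassmann_eqI) (simp add: grassmann_deriv_def one_grassmann_def zero_grassmann_def)

lemma grassmann_deriv_gen_times:
  "grassmann_deriv a (gen b * F) = (if a = b then F else 0) - gen b * grassmann_deriv a F"
proof (rule grassmann_eqI)
  fix S
  show "coeff (grassmann_deriv a (gen b * F)) S =
      coeff ((if a = b then F else 0) - gen b * grassmann_deriv a F) S"
  proof (cases "a = b")
    case True
    then show ?thesis
      by (auto simp: grassmann_deriv_def coeff_gen_times minus_grassmann_def insert_absorb)
  next
    case False
    show ?thesis
    proof (cases "b \<in> S \<and> a \<notin> S")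
      case True
      then obtain T where T: "S = insert b T" "b \<notin> T" "a \<notin> T" by (metis insertCI mk_disjoint_insert)
      have "insert a (insert b T) - {b} = insert a T" "insert b T - {b} = T"
        using T False by auto
      then show ?thesis
        using T False reorder_sign_swap[OF False, where 'c='b]
        by (simp add: grassmann_deriv_def coeff_gen_times minus_grassmann_def zero_grassmann_def
            reorder_sign_insert[of _ T] mult_ac)
    qed (use False in \<open>auto simp: grassmann_deriv_def coeff_gen_times minus_grassmann_def zero_grassmann_def\<close>)
  qed
qed

lemma grassmann_deriv_anticommute:
  "grassmann_deriv a (grassmann_deriv b F) = - grassmann_deriv b (grassmann_deriv a F)"
proof (rule grassmann_eqI)
  fix S
  show "coeff (grassmann_deriv a (grassmann_deriv b F)) S =
      coeff (- grassmann_deriv b (grassmann_deriv a F)) S"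
  proof (cases "a = b \<or> a \<in> S \<or> b \<in> S")
    case False
    then show ?thesis
      using reorder_sign_swap[of a b, where 'c='b]
      by (auto simp: grassmann_deriv_def uminus_grassmann_def reorder_sign_insert[of _ S] insert_commute mult_ac)
  qed (auto simp: grassmann_deriv_def uminus_grassmann_def)
qed

lemma grassmann_deriv_minus: "grassmann_deriv a (- F) = - grassmann_deriv a F"
  by (rule grassmann_eqI) (simp add: grassmann_deriv_def uminus_grassmann_def)

section \<open>Smooth functions of even superfunctions\<close>

text \<open>
  The nilpotent part \<open>A - const (body A)\<close> has vanishing powers beyond the number of generators,
  so the Taylor sums below are complete.
\<close>

definition taylor1 ::
  "(real \<Rightarrow> real) \<Rightarrow> ('g::finite, real) grassmann \<Rightarrow> ('g, real) grassmann" where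
  "taylor1 g A = (\<Sum>k\<le>CARD('g).
     const ((deriv ^^ k) g (body A) / fact k) * (A - const (body A)) ^ k)"

definition partial1 :: "(real \<times> real \<Rightarrow> complex) \<Rightarrow> real \<times> real \<Rightarrow> complex" where
  "partial1 f p = vector_derivative (\<lambda>t. f (t, snd p)) (at (fst p))"

definition partial2 :: "(real \<times> real \<Rightarrow> complex) \<Rightarrow> real \<times> real \<Rightarrow> complex" where
  "partial2 f p = vector_derivative (\<lambda>t. f (fst p, t)) (at (snd p))"

definition taylor2 :: "(real \<times> real \<Rightarrow> complex) \<Rightarrow>
    ('g::finite, real) grassmann \<Rightarrow> ('g, real) grassmann \<Rightarrow> ('g, complex) grassmann" where
  "taylor2 f A B = (\<Sum>k\<le>CARD('g). \<Sum>l\<le>CARD('g).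
     const ((partial1 ^^ k) ((partial2 ^^ l) f) (body A, body B) / (fact k * fact l)) *
     complexify ((A - const (body A)) ^ k * (B - const (body B)) ^ l))"

definition C1_plane :: "(real \<times> real \<Rightarrow> complex) \<Rightarrow> bool" where
  "C1_plane f \<longleftrightarrow> (\<forall>p. f differentiable (at p)) \<and>
     continuous_on UNIV (partial1 f) \<and> continuous_on UNIV (partial2 f)"

definition harmonic_plane :: "(real \<times> real \<Rightarrow> complex) \<Rightarrow> bool" where
  "harmonic_plane f \<longleftrightarrow> C1_plane f \<and> C1_plane (partial1 f) \<and> C1_plane (partial2 f) \<and>
     (\<forall>p. partial1 (partial1 f) p + partial2 (partial2 f) p = 0)"

section \<open>The supersymmetric hyperbolic sigma model\<close>

text \<open>
  The vertex type \<open>'v\<close> is the full vertex set, including the reference vertex \<open>\<delta>\<close>. The generators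
  are \<open>Inl i\<close> (for \<open>\<xi>\<^sub>i\<close>) and \<open>Inr i\<close> (for \<open>\<eta>\<^sub>i\<close>); those with \<open>i = \<delta>\<close> are
  present in the type but never occur, since \<open>\<xi>\<^sub>\<delta>\<close> and \<open>\<eta>\<^sub>\<delta>\<close> are set to zero.
  A superfunction assigns to the coordinates \<open>x, y\<close> an element of the Grassmann algebra. Only the
  values of \<open>x\<close> and \<open>y\<close> off \<open>\<delta>\<close> matter.
\<close>

type_synonym ('v, 'c) superfunction = "('v \<Rightarrow> real) \<Rightarrow> ('v \<Rightarrow> real) \<Rightarrow> ('v + 'v, 'c) grassmann"

definition coord :: "'v \<Rightarrow> ('v \<Rightarrow> real) \<Rightarrow> 'v \<Rightarrow> ('v::finite + 'v, real) grassmann" where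
  "coord \<delta> x i = (if i = \<delta> then 0 else const (x i))"

definition xi :: "'v \<Rightarrow> 'v \<Rightarrow> ('v::finite + 'v, real) grassmann" where
  "xi \<delta> i = (if i = \<delta> then 0 else gen (Inl i))"

definition eta :: "'v \<Rightarrow> 'v \<Rightarrow> ('v::finite + 'v, real) grassmann" where
  "eta \<delta> i = (if i = \<delta> then 0 else gen (Inr i))"

definition zcoord :: "'v::finite \<Rightarrow> 'v \<Rightarrow> ('v, real) superfunction" where
  "zcoord \<delta> i x y =
     taylor1 sqrt (1 + coord \<delta> x i ^ 2 + coord \<delta> y i ^ 2 + 2 * xi \<delta> i * eta \<delta> i)"

text \<open>
  \<open>E\<close> is a symmetric adjacency relation; ordering the endpoints selects each undirected edge once
  (the summand is symmetric in \<open>i\<close> and \<open>j\<close>).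
\<close>

definition action :: "'v::finite \<Rightarrow> ('v \<times> 'v) set \<Rightarrow> ('v \<Rightarrow> 'v \<Rightarrow> real) \<Rightarrow> ('v, real) superfunction"
  where "action \<delta> E W x y = - (\<Sum>(i, j)\<in>{(i, j) \<in> E. to_nat i < to_nat j}. const (W i j) *
     (zcoord \<delta> i x y * zcoord \<delta> j x y -
      (1 + coord \<delta> x i * coord \<delta> x j + coord \<delta> y i * coord \<delta> y j
         + xi \<delta> i * eta \<delta> j - eta \<delta> i * xi \<delta> j)))"

definition exp_action ::
  "'v::finite \<Rightarrow> ('v \<times> 'v) set \<Rightarrow> ('v \<Rightarrow> 'v \<Rightarrow> real) \<Rightarrow> ('v, complex) superfunction" where
  "exp_action \<delta> E W x y = complexify (taylor1 exp (action \<delta> E W x y))"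

text \<open>
  \<^const>\<open>prod\<close> is not available on the noncommutative ring \<^typ>\<open>('g, 'c) grassmann\<close>. The folds below
  do not depend on the order, by \<open>inverse_z_factors_commute\<close> and \<open>grassmann_deriv_pairs_commute\<close>.
\<close>

definition inverse_z_product :: "'v::finite \<Rightarrow> ('v, complex) superfunction" where
  "inverse_z_product \<delta> x y = complexify
     (Finite_Set.fold (\<lambda>i P. taylor1 inverse (zcoord \<delta> i x y) * P) 1 (UNIV - {\<delta>}))"

definition grassmann_derivs ::
  "'v::finite \<Rightarrow> ('v + 'v, 'c::comm_ring_1) grassmann \<Rightarrow> ('v + 'v, 'c) grassmann" where
  "grassmann_derivs \<delta> F =
     Finite_Set.fold (\<lambda>i G. grassmann_deriv (Inl i) (grassmann_deriv (Inr i) G)) F (UNIV - {\<delta>})"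

definition super_integrand :: "'v::finite \<Rightarrow> ('v \<times> 'v) set \<Rightarrow> ('v \<Rightarrow> 'v \<Rightarrow> real) \<Rightarrow>
    ('v, complex) superfunction \<Rightarrow> ('v \<Rightarrow> real) \<times> ('v \<Rightarrow> real) \<Rightarrow> complex" where
  "super_integrand \<delta> E W F = (\<lambda>(x, y).
     body (grassmann_derivs \<delta> (inverse_z_product \<delta> x y * exp_action \<delta> E W x y * F x y))
       / of_real ((2 * pi) ^ card (UNIV - {\<delta>})))"

definition coord_measure :: "'v::finite \<Rightarrow> (('v \<Rightarrow> real) \<times> ('v \<Rightarrow> real)) measure" where
  "coord_measure \<delta> = (\<Pi>\<^sub>M i\<in>UNIV - {\<delta>}. lborel) \<Otimes>\<^sub>M (\<Pi>\<^sub>M i\<in>UNIV - {\<delta>}. lborel)"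

definition super_integrable :: "'v::finite \<Rightarrow> ('v \<times> 'v) set \<Rightarrow> ('v \<Rightarrow> 'v \<Rightarrow> real) \<Rightarrow>
    ('v, complex) superfunction \<Rightarrow> bool" where
  "super_integrable \<delta> E W F \<longleftrightarrow> integrable (coord_measure \<delta>) (super_integrand \<delta> E W F)"

definition super_expectation :: "'v::finite \<Rightarrow> ('v \<times> 'v) set \<Rightarrow> ('v \<Rightarrow> 'v \<Rightarrow> real) \<Rightarrow>
    ('v, complex) superfunction \<Rightarrow> complex" where
  "super_expectation \<delta> E W F = (\<integral>p. super_integrand \<delta> E W F p \<partial>coord_measure \<delta>)"

definition theta_observable ::
  "'v::finite \<Rightarrow> (real \<times> real \<Rightarrow> complex) \<Rightarrow> ('v \<Rightarrow> real) \<Rightarrow> ('v, complex) superfunction" where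
  "theta_observable \<delta> f \<theta> x y = taylor2 f
     (\<Sum>i\<in>UNIV. const (\<theta> i) * (coord \<delta> x i + zcoord \<delta> i x y))
     (\<Sum>i\<in>UNIV. const (\<theta> i) * coord \<delta> y i)"

definition coord_norm :: "'v::finite \<Rightarrow> ('v \<Rightarrow> real) \<Rightarrow> ('v \<Rightarrow> real) \<Rightarrow> real" where
  "coord_norm \<delta> x y = sqrt (\<Sum>i\<in>UNIV - {\<delta>}. (x i)\<^sup>2 + (y i)\<^sup>2)"

definition exp_decaying :: "'v::finite \<Rightarrow> ('v, complex) superfunction \<Rightarrow> bool" where
  "exp_decaying \<delta> F \<longleftrightarrow> (\<forall>S. \<exists>c>0. \<exists>C R. \<forall>x y. coord_norm \<delta> x y \<ge> R \<longrightarrow>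
     cmod (coeff (F x y) S) \<le> C * exp (- c * coord_norm \<delta> x y))"

lemma grassmann_deriv_pairs_commute:
  "comp_fun_commute (\<lambda>(i::'v::finite) G. grassmann_deriv (Inl i) (grassmann_deriv (Inr i) G))"
proof
  fix i j :: 'v
  let ?d = "\<lambda>(i::'v) G. grassmann_deriv (Inl i) (grassmann_deriv (Inr i) G)"
  have "?d j (?d i G) = ?d i (?d j G)" for G :: "('v + 'v, 'a) grassmann"
  proof -
    have "?d j (?d i G) = grassmann_deriv (Inl i) (?d j (grassmann_deriv (Inr i) G))"
      by (simp add: grassmann_deriv_anticommute[of "Inr j" "Inl i"]
          grassmann_deriv_anticommute[of "Inl j" "Inl i"] grassmann_deriv_minus)
    also have "\<dots> = ?d i (?d j G)"
      by (simp add: grassmann_deriv_anticommute[of "Inr j" "Inr i"]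
          grassmann_deriv_anticommute[of "Inl j" "Inr i"] grassmann_deriv_minus)
    finally show ?thesis .
  qed
  then show "?d j \<circ> ?d i = ?d i \<circ> (?d j :: ('v + 'v, 'a) grassmann \<Rightarrow> _)"
    by (simp add: fun_eq_iff)
qed

definition commuting :: "'a::ring_1 \<Rightarrow> 'a \<Rightarrow> bool" where
  "commuting a b \<longleftrightarrow> a * b = b * a"

lemma commuting_sym: "commuting a b \<Longrightarrow> commuting b a"
  by (simp add: commuting_def)

lemma commuting_simps:
  "commuting a 1" "commuting a 0" "commuting a (numeral n)"
  unfolding commuting_def by (simp_all, metis mult_of_nat_commute of_nat_numeral)

lemma commuting_add: "commuting a b \<Longrightarrow> commuting a c \<Longrightarrow> commuting a (b + c)"
  by (simp add: commuting_def algebra_simps)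

lemma commuting_diff: "commuting a b \<Longrightarrow> commuting a c \<Longrightarrow> commuting a (b - c)"
  by (simp add: commuting_def algebra_simps)

lemma commuting_mult:
  assumes "commuting a b" "commuting a c" shows "commuting a (b * c)"
  using assms unfolding commuting_def by (metis mult.assoc)

lemma commuting_power: "commuting a b \<Longrightarrow> commuting a (b ^ n)"
  by (induction n) (simp_all add: commuting_simps commuting_mult)

lemma commuting_sum: "(\<And>i. i \<in> I \<Longrightarrow> commuting a (b i)) \<Longrightarrow> commuting a (sum b I)"
  by (induction I rule: infinite_finite_induct) (simp_all add: commuting_simps commuting_add)

lemma commuting_const: "commuting F (const c)"
proof -
  have "coeff (const c * F) S = c * coeff F S" for S
  proof -
    have "coeff (const c * F) S = (\<Sum>A\<in>Pow S. if A = {} then c * coeff F S else 0)"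
      unfolding times_grassmann_def const_def coeff_Grassmann by (rule sum.cong) auto
    then show ?thesis by simp
  qed
  moreover have "coeff (F * const c) S = c * coeff F S" for S
  proof -
    have "coeff (F * const c) S = (\<Sum>A\<in>Pow S. if A = S then c * coeff F S else 0)"
      unfolding times_grassmann_def const_def coeff_Grassmann by (rule sum.cong) auto
    then show ?thesis by simp
  qed
  ultimately show ?thesis unfolding commuting_def by (auto intro: grassmann_eqI)
qed

lemma commuting_taylor1: "commuting F A \<Longrightarrow> commuting F (taylor1 g A)"
  unfolding taylor1_def
  by (intro commuting_sum commuting_mult commuting_power commuting_diff commuting_const)

lemma commuting_xi_eta:
  fixes \<delta> i j :: "'v::finite"
  shows "commuting (xi \<delta> i * eta \<delta> i) (xi \<delta> j * eta \<delta> j)"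
proof -
  have "gen a * gen b * (gen c * gen d) = gen c * gen d * (gen a * (gen b :: ('v + 'v, real) grassmann))"
    for a b c d :: "'v + 'v"
  proof -
    have "gen a * gen b * (gen c * gen d) = gen a * (gen b * gen c) * (gen d :: ('v + 'v, real) grassmann)"
      by (simp only: mult.assoc)
    also have "\<dots> = - ((gen a * gen c) * (gen b * gen d))"
      by (simp add: gen_anticommute[of b c] mult.assoc)
    also have "\<dots> = - ((gen c * gen a) * (gen d * gen b))"
      by (simp add: gen_anticommute[of a c] gen_anticommute[of b d])
    also have "\<dots> = - (gen c * (gen a * gen d) * gen b)"
      by (simp only: mult.assoc)
    also have "\<dots> = gen c * gen d * (gen a * gen b)"
      by (simp add: gen_anticommute[of a d] mult.assoc)
    finally show ?thesis .
  qed
  then show ?thesis by (simp add: commuting_def xi_def eta_def)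
qed

lemma commuting_coord: "commuting F (coord \<delta> x i)"
  by (simp add: coord_def commuting_const commuting_simps)

lemma commuting_zcoord:
  assumes "commuting F (xi \<delta> i * eta \<delta> i)" shows "commuting F (zcoord \<delta> i x y)"
  unfolding zcoord_def mult.assoc
  by (intro commuting_taylor1 commuting_add commuting_power commuting_coord commuting_simps
      commuting_mult[OF commuting_simps(3)] assms)

lemma inverse_z_factors_commute:
  "comp_fun_commute (\<lambda>i P. taylor1 inverse (zcoord \<delta> i x y) * P)"
proof
  fix i j
  have "commuting (zcoord \<delta> i x y) (zcoord \<delta> j x y)"
    by (rule commuting_zcoord, rule commuting_sym, rule commuting_zcoord, rule commuting_xi_eta)
  then have "commuting (zcoord \<delta> i x y) (taylor1 inverse (zcoord \<delta> j x y))"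
    by (rule commuting_taylor1)
  then have "commuting (taylor1 inverse (zcoord \<delta> j x y)) (taylor1 inverse (zcoord \<delta> i x y))"
    by (rule commuting_taylor1[OF commuting_sym])
  then show "(*) (taylor1 inverse (zcoord \<delta> j x y)) \<circ> (*) (taylor1 inverse (zcoord \<delta> i x y)) =
      (*) (taylor1 inverse (zcoord \<delta> i x y)) \<circ> (*) (taylor1 inverse (zcoord \<delta> j x y))"
    by (auto simp: commuting_def fun_eq_iff simp flip: mult.assoc)
qed

end

theory Submission
  imports Defs "HOL-Complex_Analysis.Complex_Analysis" "HOL-Probability.Distributions"
begin

text \<open>
  The theorem is a supersymmetric localization, for supercharges that depend on a square root
  \<open>J = \<plusminus>\<i>\<close> of \<open>- 1\<close>:
  \<open>Q\<^sub>J = \<Sum>\<^sub>j \<xi>\<^sub>j (\<partial>\<^sub>x\<^sub>j + J \<partial>\<^sub>y\<^sub>j) + (x\<^sub>j + J y\<^sub>j) \<partial>\<^sub>\<eta>\<^sub>j\<close>,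
  the odd derivation with \<open>x\<^sub>j \<mapsto> \<xi>\<^sub>j\<close>, \<open>y\<^sub>j \<mapsto> J \<xi>\<^sub>j\<close>, \<open>\<xi>\<^sub>j \<mapsto> 0\<close>, \<open>\<eta>\<^sub>j \<mapsto> x\<^sub>j + J y\<^sub>j\<close>.
  It annihilates \<open>N\<^sub>i = x\<^sub>i\<^sup>2 + y\<^sub>i\<^sup>2 + 2 \<xi>\<^sub>i \<eta>\<^sub>i\<close>, hence \<open>z\<^sub>i\<close> and \<open>1 / z\<^sub>i\<close>, and the bilinear forms in the action,
  hence \<open>exp S\<close> (\<open>susy_closed_exp_action\<close>). Because of \<open>J\<^sup>2 = - 1\<close> it also annihilates
  \<open>\<langle>\<theta>, x + z\<rangle> + J \<langle>\<theta>, y\<rangle>\<close>, and therefore every entire function of this combination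
  (\<open>susy_closed_holomorphic_observable\<close>). A harmonic \<open>f\<close> is \<open>H(a + \<i> b) + K(a - \<i> b)\<close> with entire
  \<open>H\<close> and \<open>K\<close> (\<open>harmonic_decomposition\<close>), so the observable is the sum of one part that is closed for
  \<open>J = \<i>\<close> and one that is closed for \<open>J = - \<i>\<close>.

  The integral of \<open>Q\<^sub>J C\<close> vanishes for compactly supported \<open>C\<close> (\<open>integral_susy_exact\<close>), and
  \<open>N\<^sub>i \<psi>(N\<^sub>i)\<close> is the image under \<open>Q\<^sub>J\<close> of \<open>\<eta>\<^sub>i (x\<^sub>i - J y\<^sub>i) \<psi>(N\<^sub>i)\<close> (\<open>radial_primitive\<close>). Hence a closed, even and
  compactly supported \<open>B\<close> may be multiplied by \<open>exp (- t N\<^sub>i)\<close> for every vertex \<open>i \<noteq> \<delta>\<close> without changing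
  its integral. For \<open>t \<rightarrow> \<infinity>\<close> only the body of \<open>B\<close> at the origin survives, with the factor \<open>(2 \<pi>)\<^sup>n\<close> that
  the definition of the superexpectation divides by (\<open>localization\<close>).

  The hypothesis on decay concerns \<open>f\<close> and gives no direct control of \<open>H\<close> and \<open>K\<close> separately. The two
  parts are therefore localized in the presence of the cutoffs \<open>\<chi>(N\<^sub>i / R)\<close>, which are closed for both
  supercharges and equal to \<open>1\<close> at the origin. Their sum equals \<open>f(\<langle>\<theta>, 1\<rangle>, 0)\<close> for every \<open>R\<close>, and
  in it only \<open>f\<close> occurs, so that the limit \<open>R \<rightarrow> \<infinity>\<close> follows by dominated convergence.
\<close>

section \<open>The Grassmann algebra as a normed algebra\<close>

lemma coeff_plus [simp]: "coeff (F + G) S = coeff F S + coeff G S"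
  and coeff_minus [simp]: "coeff (F - G) S = coeff F S - coeff G S"
  and coeff_uminus [simp]: "coeff (- F) S = - coeff F S"
  and coeff_zero [simp]: "coeff 0 S = 0"
  by (simp_all add: plus_grassmann_def minus_grassmann_def uminus_grassmann_def zero_grassmann_def)

lemma coeff_one: "coeff 1 S = (if S = {} then 1 else 0)"
  by (simp add: one_grassmann_def)

lemma coeff_const: "coeff (const c) S = (if S = {} then c else 0)"
  by (simp add: const_def)

lemma coeff_times:
  "coeff (F * G) S = (\<Sum>A\<in>Pow S. reorder_sign A (S - A) * coeff F A * coeff G (S - A))"
  by (simp add: times_grassmann_def)

lemma coeff_sum [simp]: "coeff (sum F I) S = (\<Sum>i\<in>I. coeff (F i) S)"
  by (induction I rule: infinite_finite_induct) simp_all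

lemma coeff_const_times [simp]: "coeff (const c * F) S = c * coeff F S"
proof -
  have "coeff (const c * F) S = (\<Sum>A\<in>Pow S. if A = {} then c * coeff F S else 0)"
    unfolding coeff_times coeff_const by (rule sum.cong) auto
  then show ?thesis by simp
qed

lemma const_times_commute: "F * const c = const c * F"
  using commuting_const[of F c] by (simp add: commuting_def)

lemma const_add: "const (a + b) = const a + const b"
  and const_diff: "const (a - b) = const a - const b"
  and const_minus: "const (- a) = - const a"
  and const_mult: "const (a * b) = const a * const b"
  and const_0: "const 0 = 0"
  and const_1: "const 1 = 1"
  by (auto intro!: grassmann_eqI simp: coeff_const coeff_one)

lemma const_numeral: "const (numeral n) = numeral n"
proof -
  have "const (of_nat m) = of_nat m" for m
    by (induction m) (simp_all add: const_0 const_1 const_add)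
  from this[of "numeral n"] show ?thesis by simp
qed

lemma const_power: "const (a ^ n) = const a ^ n"
  by (induction n) (simp_all add: const_1 const_mult)

lemma norm_reorder_sign [simp]: "norm (reorder_sign A B :: 'c::real_normed_field) = 1"
  by (simp add: reorder_sign_def norm_power)

text \<open>
  The \<open>\<ell>\<^sup>1\<close> norm of the coefficients makes the Grassmann algebra a normed algebra, so that the
  calculus of the libraries applies to superfunctions without passing to coefficients.
\<close>

instantiation grassmann :: (finite, real_normed_field) real_normed_algebra_1
begin

definition "scaleR r F = Grassmann (\<lambda>S. scaleR r (coeff F S))"
definition "norm F = (\<Sum>S\<in>UNIV. norm (coeff F S))"
definition "dist F G = norm (F - G)" for F G :: "('a, 'b) grassmann"
definition "sgn F = scaleR (inverse (norm F)) F" for F :: "('a, 'b) grassmann"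
definition "uniformity =
  (INF e\<in>{0 <..}. principal {(F, G :: ('a, 'b) grassmann). dist F G < e})"
definition "open U \<longleftrightarrow>
  (\<forall>F\<in>U. eventually (\<lambda>(F', G). F' = F \<longrightarrow> G \<in> U) (uniformity :: (('a, 'b) grassmann \<times> _) filter))"

instance
proof
  fix F G H :: "('a, 'b) grassmann" and r s :: real and U :: "('a, 'b) grassmann set"
  note scale = scaleR_grassmann_def
  show "dist F G = norm (F - G)" "sgn F = scaleR (inverse (norm F)) F"
    "(uniformity :: (('a, 'b) grassmann \<times> _) filter) =
      (INF e\<in>{0 <..}. principal {(F, G). dist F G < e})"
    "open U = (\<forall>F\<in>U. \<forall>\<^sub>F (F', G) in uniformity. F' = F \<longrightarrow> G \<in> U)"
    by (rule dist_grassmann_def sgn_grassmann_def uniformity_grassmann_def open_grassmann_def)+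
  show "scaleR r (F + G) = scaleR r F + scaleR r G" "scaleR (r + s) F = scaleR r F + scaleR s F"
    "scaleR r (scaleR s F) = scaleR (r * s) F" "scaleR 1 F = F"
    by (rule grassmann_eqI, simp add: scale algebra_simps)+
  show "scaleR r F * G = scaleR r (F * G)" "F * scaleR r G = scaleR r (F * G)"
    by (rule grassmann_eqI, simp add: scale coeff_times scaleR_right.sum)+
  show "norm F = 0 \<longleftrightarrow> F = 0"
    by (auto simp: norm_grassmann_def sum_nonneg_eq_0_iff intro: grassmann_eqI)
  show "norm (F + G) \<le> norm F + norm G"
    by (auto simp: norm_grassmann_def norm_triangle_ineq simp flip: sum.distrib intro!: sum_mono)
  show "norm (scaleR r F) = \<bar>r\<bar> * norm F"
    by (simp add: norm_grassmann_def scale sum_distrib_left)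
  show "norm (1 :: ('a, 'b) grassmann) = 1"
    by (simp add: norm_grassmann_def coeff_one if_distrib[of norm] cong: if_cong)
  show "norm (F * G) \<le> norm F * norm G"
  proof -
    have "norm (F * G) \<le> (\<Sum>S\<in>UNIV. \<Sum>A\<in>Pow S. norm (coeff F A) * norm (coeff G (S - A)))"
      unfolding norm_grassmann_def coeff_times
      by (intro sum_mono order.trans[OF norm_sum]) (simp add: norm_mult)
    also have "\<dots> = (\<Sum>(S, A)\<in>Sigma UNIV Pow. norm (coeff F A) * norm (coeff G (S - A)))"
      by (simp add: sum.Sigma)
    also have "\<dots> = (\<Sum>(A, B)\<in>{(A, B). A \<inter> B = {}}. norm (coeff F A) * norm (coeff G B))"
      by (rule sum.reindex_bij_witness[where j = "\<lambda>(S, A). (A, S - A)" and i = "\<lambda>(A, B). (A \<union> B, A)"])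
        auto
    also have "\<dots> \<le> (\<Sum>(A, B)\<in>UNIV \<times> UNIV. norm (coeff F A) * norm (coeff G B))"
      by (rule sum_mono2) auto
    also have "\<dots> = norm F * norm G"
      by (simp add: norm_grassmann_def sum_product sum.cartesian_product)
    finally show ?thesis .
  qed
qed

end

lemma coeff_scaleR [simp]: "coeff (scaleR r F) S = scaleR r (coeff F S)"
  by (simp add: scaleR_grassmann_def)

lemma norm_coeff_le: "norm (coeff F S) \<le> norm F"
  unfolding norm_grassmann_def by (rule member_le_sum) auto

lemma bounded_linear_coeff: "bounded_linear (\<lambda>F. coeff F S)"
  by (rule bounded_linear_intro[where K = 1]) (simp_all add: norm_coeff_le)

lemma norm_const [simp]: "norm (const c :: ('g::finite, 'c::real_normed_field) grassmann) = norm c"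
  by (simp add: norm_grassmann_def coeff_const if_distrib[of norm] cong: if_cong)

lemma norm_gen [simp]: "norm (gen a :: ('g::finite, 'c::real_normed_field) grassmann) = 1"
  by (simp add: norm_grassmann_def coeff_gen if_distrib[of norm] cong: if_cong)

lemma bounded_linear_const:
  "bounded_linear (const :: 'c::real_normed_field \<Rightarrow> ('g::finite, 'c) grassmann)"
  by (rule bounded_linear_intro[where K = 1]) (auto intro!: grassmann_eqI simp: coeff_const)

lemmas continuous_on_const_grassmann [continuous_intros] =
  bounded_linear.continuous_on[OF bounded_linear_const]

lemma coeff_deriv:
  "coeff (grassmann_deriv a F) S = (if a \<in> S then 0 else reorder_sign {a} S * coeff F (insert a S))"
  by (simp add: grassmann_deriv_def)

lemma norm_grassmann_deriv_le:
  "norm (grassmann_deriv a F) \<le> norm (F :: ('g::finite, 'c::real_normed_field) grassmann)"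
proof -
  have "norm (grassmann_deriv a F) = (\<Sum>S\<in>{S. a \<notin> S}. norm (coeff F (insert a S)))"
    unfolding norm_grassmann_def coeff_deriv
    by (rule sum.mono_neutral_cong_right) (auto simp: norm_mult)
  also have "\<dots> = (\<Sum>S\<in>{S. a \<in> S}. norm (coeff F S))"
    by (rule sum.reindex_bij_witness[where i = "\<lambda>S. S - {a}" and j = "insert a"])
      (auto simp: insert_absorb)
  also have "\<dots> \<le> norm F"
    unfolding norm_grassmann_def by (rule sum_mono2) auto
  finally show ?thesis .
qed

lemma bounded_linear_grassmann_deriv:
  "bounded_linear (grassmann_deriv a ::
    ('g::finite, 'c::real_normed_field) grassmann \<Rightarrow> _)"
  by (rule bounded_linear_intro[where K = 1])
    (auto intro!: grassmann_eqI simp: coeff_deriv algebra_simps norm_grassmann_deriv_le)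

lemma coeff_complexify [simp]: "coeff (complexify F) S = of_real (coeff F S)"
  by (simp add: complexify_def)

lemma complexify_times: "complexify (F * G) = complexify F * complexify G"
  by (rule grassmann_eqI) (simp add: coeff_times reorder_sign_def)

lemma complexify_add: "complexify (F + G) = complexify F + complexify G"
  and complexify_diff: "complexify (F - G) = complexify F - complexify G"
  and complexify_minus: "complexify (- F) = - complexify F"
  and complexify_0: "complexify 0 = 0"
  and complexify_1: "complexify 1 = 1"
  and complexify_const: "complexify (const c) = const (of_real c)"
  and complexify_gen: "complexify (gen a) = gen a"
  and complexify_sum: "complexify (sum A I) = (\<Sum>i\<in>I. complexify (A i))"
  by (auto intro!: grassmann_eqI simp: coeff_const coeff_one coeff_gen)

lemma complexify_numeral: "complexify (numeral n) = numeral n"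
  by (metis complexify_const const_numeral of_real_numeral)

lemma complexify_power: "complexify (F ^ n) = complexify F ^ n"
  by (induction n) (simp_all add: complexify_1 complexify_times)

lemmas complexify_simps = complexify_times complexify_add complexify_diff complexify_minus
  complexify_0 complexify_1 complexify_const complexify_gen complexify_sum complexify_numeral
  complexify_power

section \<open>Parity and nilpotency\<close>

text \<open>
  Identities between additive operations need to be checked only for constants and for left
  multiplication by one generator, where all the signs are explicit.
\<close>

lemma grassmann_induct [case_names const add gen]:
  assumes const: "\<And>c. P (const c)"
    and add: "\<And>F G. P F \<Longrightarrow> P G \<Longrightarrow> P (F + G)"
    and gen: "\<And>a F. P F \<Longrightarrow> P (gen a * F)"
  shows "P (F :: ('g::finite, 'c::comm_ring_1) grassmann)"
proof -
  define monomial :: "'g set \<Rightarrow> 'c \<Rightarrow> ('g, 'c) grassmann"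
    where "monomial S c = Grassmann (\<lambda>T. if T = S then c else 0)" for S c
  have monomial: "P (monomial S c)" for S c
    using finite[of S]
  proof (induction S arbitrary: c rule: finite_induct)
    case empty
    have "monomial {} c = const c"
      by (rule grassmann_eqI) (simp add: monomial_def coeff_const)
    then show ?case using const by simp
  next
    case (insert a S)
    have "monomial (insert a S) c = gen a * monomial S (reorder_sign {a} S * c)"
      using insert.hyps by (intro grassmann_eqI) (auto simp: monomial_def coeff_gen_times)
    then show ?case using gen insert.IH by simp
  qed
  have "P (\<Sum>S\<in>\<S>. monomial S (coeff F S))" for \<S>
    using finite[of \<S>]
  proof (induction \<S> rule: finite_induct)
    case empty
    then show ?case using const[of 0] by (simp add: const_0)
  qed (simp add: add monomial)
  moreover have "F = (\<Sum>S\<in>UNIV. monomial S (coeff F S))"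
    by (rule grassmann_eqI) (simp add: monomial_def)
  ultimately show ?thesis by metis
qed

text \<open>
  The grading automorphism. It carries the signs of the graded Leibniz rule, for the Grassmann
  derivatives as well as for the supercharges.
\<close>

definition parity :: "('g::finite, 'c::comm_ring_1) grassmann \<Rightarrow> ('g, 'c) grassmann" where
  "parity F = Grassmann (\<lambda>S. (-1) ^ card S * coeff F S)"

lemma coeff_parity: "coeff (parity F) S = (-1) ^ card S * coeff F S"
  by (simp add: parity_def)

lemma parity_add: "parity (F + G) = parity F + parity G"
  and parity_diff: "parity (F - G) = parity F - parity G"
  and parity_minus: "parity (- F) = - parity F"
  and parity_const [simp]: "parity (const c) = const c"
  and parity_0 [simp]: "parity 0 = 0"
  and parity_1 [simp]: "parity 1 = 1"
  and parity_gen [simp]: "parity (gen a) = - gen a"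
  by (auto intro!: grassmann_eqI simp: coeff_parity coeff_const coeff_one coeff_gen algebra_simps)

lemma parity_gen_times: "parity (gen a * F) = - (gen a * parity F)"
proof (rule grassmann_eqI)
  fix S
  show "coeff (parity (gen a * F)) S = coeff (- (gen a * parity F)) S"
  proof (cases "a \<in> S")
    case True
    then obtain T where "S = insert a T" "a \<notin> T" by (metis mk_disjoint_insert)
    then show ?thesis by (simp add: coeff_parity coeff_gen_times mult_ac)
  qed (simp add: coeff_parity coeff_gen_times)
qed

lemma parity_times: "parity (F * G) = parity F * parity G"
proof (induction F rule: grassmann_induct)
  case (const c)
  then show ?case by (intro grassmann_eqI) (simp add: coeff_parity mult_ac)
next
  case (gen a F)
  then show ?case by (simp add: parity_gen_times mult.assoc)
qed (simp add: parity_add distrib_right)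

lemma gen_times_commute: "parity F * gen a = gen a * F"
proof (induction F rule: grassmann_induct)
  case (gen b F)
  have "parity (gen b * F) * gen a = - (gen b * (parity F * gen a))"
    by (simp only: parity_gen_times minus_mult_left[symmetric] mult.assoc)
  also have "\<dots> = - (gen b * gen a) * F"
    by (simp only: gen.IH minus_mult_left[symmetric] mult.assoc)
  also have "\<dots> = gen a * (gen b * F)"
    by (simp only: gen_anticommute[of a b, symmetric] mult.assoc)
  finally show ?case .
qed (simp_all add: const_times_commute parity_add distrib_left distrib_right)

lemma grassmann_deriv_add: "grassmann_deriv a (F + G) = grassmann_deriv a F + grassmann_deriv a G"
  and grassmann_deriv_const_times: "grassmann_deriv a (const c * F) = const c * grassmann_deriv a F"
  and grassmann_deriv_const: "grassmann_deriv a (const c) = 0"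
  and grassmann_deriv_0: "grassmann_deriv a 0 = 0"
  by (auto intro!: grassmann_eqI simp: coeff_deriv coeff_const algebra_simps)

lemma grassmann_deriv_gen: "grassmann_deriv a (gen b) = (if a = b then 1 else 0)"
  using grassmann_deriv_gen_times[of a b 1] by (simp add: grassmann_deriv_one)

lemma grassmann_deriv_times:
  "grassmann_deriv a (F * G) = grassmann_deriv a F * G + parity F * grassmann_deriv a G"
proof (induction F rule: grassmann_induct)
  case (gen b F)
  then show ?case
    by (simp add: mult.assoc grassmann_deriv_gen_times parity_gen_times algebra_simps)
qed (simp_all add: grassmann_deriv_const_times grassmann_deriv_const grassmann_deriv_add parity_add
    algebra_simps)

lemma grassmann_deriv_twice:
  "grassmann_deriv a (grassmann_deriv a F) = (0 :: ('g::finite, 'c::comm_ring_1) grassmann)"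
  by (rule grassmann_eqI) (simp add: coeff_deriv)

definition even_elt :: "('g::finite, 'c::comm_ring_1) grassmann \<Rightarrow> bool" where
  "even_elt F \<longleftrightarrow> parity F = F"

lemma even_elt_const [simp]: "even_elt (const c)"
  and even_elt_0 [simp]: "even_elt 0"
  and even_elt_1 [simp]: "even_elt 1"
  and even_elt_gens [simp]: "even_elt (gen a * gen b)"
  by (simp_all add: even_elt_def parity_times)

lemma even_elt_add: "even_elt F \<Longrightarrow> even_elt G \<Longrightarrow> even_elt (F + G)"
  and even_elt_diff: "even_elt F \<Longrightarrow> even_elt G \<Longrightarrow> even_elt (F - G)"
  and even_elt_minus: "even_elt F \<Longrightarrow> even_elt (- F)"
  and even_elt_times: "even_elt F \<Longrightarrow> even_elt G \<Longrightarrow> even_elt (F * G)"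
  by (simp_all add: even_elt_def parity_add parity_diff parity_minus parity_times)

lemma even_elt_power: "even_elt F \<Longrightarrow> even_elt (F ^ n)"
  by (induction n) (simp_all add: even_elt_times)

lemma even_elt_sum: "(\<And>i. i \<in> I \<Longrightarrow> even_elt (F i)) \<Longrightarrow> even_elt (sum F I)"
  by (induction I rule: infinite_finite_induct) (simp_all add: even_elt_add)

lemma even_elt_prod_list: "(\<And>F. F \<in> set Fs \<Longrightarrow> even_elt F) \<Longrightarrow> even_elt (prod_list Fs)"
  by (induction Fs) (simp_all add: even_elt_times)

lemmas even_elt_intros = even_elt_add even_elt_diff even_elt_minus even_elt_times even_elt_power
  even_elt_sum

lemma even_elt_commute:
  assumes "even_elt F" shows "F * G = G * F"
proof (induction G rule: grassmann_induct)
  case (gen a G)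
  have "F * gen a = gen a * F"
    using gen_times_commute[of F a] assms by (simp add: even_elt_def)
  then show ?case by (metis gen.IH mult.assoc)
qed (simp_all add: const_times_commute algebra_simps)

lemma even_elt_complexify: "even_elt F \<Longrightarrow> even_elt (complexify F)"
proof -
  have "parity (complexify F) = complexify (parity F)"
    by (rule grassmann_eqI) (simp add: coeff_parity)
  then show "even_elt F \<Longrightarrow> even_elt (complexify F)" by (simp add: even_elt_def)
qed

text \<open>
  The filtration by the powers of the ideal that the generators generate.
\<close>

definition degree_ge :: "nat \<Rightarrow> ('g::finite, 'c::comm_ring_1) grassmann \<Rightarrow> bool" where
  "degree_ge k F \<longleftrightarrow> (\<forall>S. card S < k \<longrightarrow> coeff F S = 0)"

lemma degree_ge_times:
  assumes F: "degree_ge k F" and G: "degree_ge l G" shows "degree_ge (k + l) (F * G)"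
  unfolding degree_ge_def
proof (intro allI impI)
  fix S :: "'a set" assume S: "card S < k + l"
  have "coeff F A = 0 \<or> coeff G (S - A) = 0" if "A \<subseteq> S" for A
  proof -
    have "card A + card (S - A) = card S"
      using that by (simp add: card_Diff_subset card_mono)
    then have "card A < k \<or> card (S - A) < l" using S by linarith
    then show ?thesis using F G unfolding degree_ge_def by blast
  qed
  then have "reorder_sign A (S - A) * coeff F A * coeff G (S - A) = 0" if "A \<in> Pow S" for A
    using that by (metis PowD mult_zero_left mult_zero_right)
  then show "coeff (F * G) S = 0"
    unfolding coeff_times by (intro sum.neutral ballI)
qed

lemma degree_ge_one_iff: "degree_ge (Suc 0) F \<longleftrightarrow> body F = 0"
  unfolding degree_ge_def body_def by (metis card_0_eq card.empty finite less_Suc0)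

lemma degree_ge_power: "body F = 0 \<Longrightarrow> degree_ge k (F ^ k)"
proof (induction k)
  case (Suc k)
  then show ?case using degree_ge_times[of "Suc 0" F k "F ^ k"] by (simp add: degree_ge_one_iff)
qed (simp add: degree_ge_def)

text \<open>
  A product of more factors without body than there are generators vanishes. The separate factor
  \<open>G\<close> is the form in which the remainder of a truncated Taylor sum appears below.
\<close>

lemma nilpotent_times_eq_0:
  fixes F G :: "('g::finite, 'c::comm_ring_1) grassmann"
  assumes "body F = 0" "body G = 0" shows "F ^ CARD('g) * G = 0"
proof (rule grassmann_eqI)
  fix S :: "'g set"
  have "degree_ge (CARD('g) + 1) (F ^ CARD('g) * G)"
    using assms by (intro degree_ge_times degree_ge_power) (simp_all add: degree_ge_one_iff)
  moreover have "card S < CARD('g) + 1" by (simp add: card_mono less_Suc_eq_le)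
  ultimately show "coeff (F ^ CARD('g) * G) S = coeff 0 S" by (simp add: degree_ge_def)
qed

lemma body_add [simp]: "body (F + G) = body F + body G"
  and body_diff [simp]: "body (F - G) = body F - body G"
  and body_minus [simp]: "body (- F) = - body F"
  and body_times [simp]: "body (F * G) = body F * body G"
  and body_const [simp]: "body (const c) = c"
  and body_0 [simp]: "body 0 = 0"
  and body_1 [simp]: "body 1 = 1"
  and body_gen [simp]: "body (gen a) = 0"
  by (simp_all add: body_def coeff_times coeff_const coeff_one coeff_gen)

lemma body_sum: "body (sum F I) = (\<Sum>i\<in>I. body (F i))"
  by (simp add: body_def)

lemma body_complexify [simp]: "body (complexify F) = of_real (body F)"
  by (simp add: body_def)

lemma body_power [simp]: "body (F ^ n) = body F ^ n"
  by (induction n) simp_all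

lemma body_prod_list: "body (prod_list Fs) = prod_list (map body Fs)"
  by (induction Fs) simp_all

section \<open>The Berezin integral\<close>

definition berezin :: "'v::finite \<Rightarrow> ('v + 'v, 'c::comm_ring_1) grassmann \<Rightarrow> 'c" where
  "berezin \<delta> F = body (grassmann_derivs \<delta> F)"

abbreviation deriv_pair :: "'v \<Rightarrow> ('v::finite + 'v, 'c::comm_ring_1) grassmann \<Rightarrow> ('v + 'v, 'c) grassmann"
  where "deriv_pair i F \<equiv> grassmann_deriv (Inl i) (grassmann_deriv (Inr i) F)"

text \<open>
  The Grassmann algebra is not commutative, so products over the vertices are taken along a fixed
  enumeration.
\<close>

definition others :: "'v::finite \<Rightarrow> 'v list" where
  "others \<delta> = (SOME vs. distinct vs \<and> set vs = UNIV - {\<delta>})"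

lemma distinct_others: "distinct (others \<delta>)" and set_others [simp]: "set (others \<delta>) = UNIV - {\<delta>}"
proof -
  have "\<exists>vs. distinct vs \<and> set vs = UNIV - {\<delta>}"
    by (metis finite finite_distinct_list)
  then have "distinct (others \<delta>) \<and> set (others \<delta>) = UNIV - {\<delta>}"
    unfolding others_def by (rule someI_ex)
  then show "distinct (others \<delta>)" "set (others \<delta>) = UNIV - {\<delta>}" by blast+
qed

lemma length_others: "length (others \<delta>) = card (UNIV - {\<delta>})"
  by (metis distinct_card distinct_others set_others)

lemma berezin_eq_fold:
  fixes F :: "('v::finite + 'v, 'c::comm_ring_1) grassmann"
  shows "berezin \<delta> F = body (fold deriv_pair (others \<delta>) F)"
proof -
  interpret comp_fun_commute_on UNIV "\<lambda>(i::'v) G :: ('v + 'v, 'c) grassmann. deriv_pair i G"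
    using grassmann_deriv_pairs_commute by (simp add: comp_fun_commute_def')
  show ?thesis
    using fold_set_fold_remdups[of "others \<delta>" F] distinct_others[of \<delta>]
    by (simp add: berezin_def grassmann_derivs_def distinct_remdups_id)
qed

lemma bounded_linear_body: "bounded_linear (body :: ('g::finite, 'c::real_normed_field) grassmann \<Rightarrow> 'c)"
  using bounded_linear_coeff unfolding body_def[abs_def] .

lemma bounded_linear_berezin:
  "bounded_linear (berezin \<delta> :: ('v::finite + 'v, 'c::real_normed_field) grassmann \<Rightarrow> 'c)"
proof -
  have "bounded_linear (fold deriv_pair vs :: ('v + 'v, 'c) grassmann \<Rightarrow> _)" for vs :: "'v list"
  proof (induction vs)
    case Nil
    show ?case by (simp add: id_def)
  next
    case (Cons v vs)
    show ?case
      using bounded_linear_compose[OF Cons bounded_linear_compose[OF bounded_linear_grassmann_deriv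
          bounded_linear_grassmann_deriv]]
      by (simp add: comp_def)
  qed
  from bounded_linear_compose[OF bounded_linear_body this] show ?thesis
    by (simp add: berezin_eq_fold[abs_def])
qed

lemma norm_berezin_le:
  "norm (berezin \<delta> F) \<le> norm (F :: ('v::finite + 'v, 'c::real_normed_field) grassmann)"
proof -
  have "norm (fold deriv_pair vs F) \<le> norm F" for vs
  proof (induction vs arbitrary: F)
    case (Cons v vs)
    show ?case
      using Cons[of "deriv_pair v F"] norm_grassmann_deriv_le[of "Inr v" F]
        norm_grassmann_deriv_le[of "Inl v" "grassmann_deriv (Inr v) F"] by simp
  qed simp
  then show ?thesis
    unfolding berezin_eq_fold body_def using norm_coeff_le order.trans by blast
qed

text \<open>
  The Berezin integral itself differentiates with respect to \<open>\<eta>\<^sub>j\<close>, and that derivative squares to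
  zero.
\<close>

lemma berezin_grassmann_deriv:
  fixes F :: "('v::finite + 'v, 'c::comm_ring_1) grassmann"
  assumes "j \<noteq> \<delta>" shows "berezin \<delta> (grassmann_deriv (Inr j) F) = 0"
proof -
  interpret comp_fun_commute_on UNIV "\<lambda>(i::'v) G :: ('v + 'v, 'c) grassmann. deriv_pair i G"
    using grassmann_deriv_pairs_commute by (simp add: comp_fun_commute_def')
  have "grassmann_derivs \<delta> (grassmann_deriv (Inr j) F) =
      Finite_Set.fold deriv_pair (deriv_pair j (grassmann_deriv (Inr j) F)) (UNIV - {\<delta>} - {j})"
    using assms fold_insert2[of j "UNIV - {\<delta>} - {j}" "grassmann_deriv (Inr j) F"]
    by (simp add: grassmann_derivs_def insert_absorb)
  also have "\<dots> = Finite_Set.fold deriv_pair 0 (UNIV - {\<delta>} - {j})"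
    by (simp add: grassmann_deriv_twice grassmann_deriv_0)
  also have "\<dots> = 0"
    by (rule finite_induct[OF finite]) (simp_all add: grassmann_deriv_0)
  finally show ?thesis by (simp add: berezin_def)
qed

lemma berezin_const_times: "berezin \<delta> (const c * F) = c * berezin \<delta> F"
proof -
  have "fold deriv_pair vs (const c * F) = const c * fold deriv_pair vs F" for vs
    by (induction vs arbitrary: F) (simp_all add: grassmann_deriv_const_times)
  then show ?thesis by (simp add: berezin_eq_fold)
qed

lemma berezin_add: "berezin \<delta> (F + G) = berezin \<delta> F + berezin \<delta> G"
proof -
  have "fold deriv_pair vs (F + G) = fold deriv_pair vs F + fold deriv_pair vs G" for vs
    by (induction vs arbitrary: F G) (simp_all add: grassmann_deriv_add)
  then show ?thesis by (simp add: berezin_eq_fold)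
qed

text \<open>
  Every vertex contributes the sign of \<open>\<partial>\<^sub>\<xi> \<partial>\<^sub>\<eta> (\<xi> \<eta>) = - 1\<close>, and only the body of \<open>F\<close>
  survives multiplication by the top monomial.
\<close>

lemma berezin_top:
  fixes F :: "('v::finite + 'v, 'c::comm_ring_1) grassmann"
  shows "berezin \<delta> (F * prod_list (map (\<lambda>i. gen (Inl i) * gen (Inr i)) (others \<delta>))) =
    (- 1) ^ card (UNIV - {\<delta>}) * body F"
proof -
  let ?m = "\<lambda>i. gen (Inl i) * gen (Inr i) :: ('v + 'v, 'c) grassmann"
  have other: "grassmann_deriv a (F * prod_list (map ?m vs)) =
      grassmann_deriv a F * prod_list (map ?m vs)"
    if "a \<notin> Inl ` set vs \<union> Inr ` set vs" for vs a and F :: "('v + 'v, 'c) grassmann"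
  proof -
    have "grassmann_deriv a (prod_list (map ?m vs)) = 0"
      using that
      by (induction vs) (auto simp: mult.assoc grassmann_deriv_one grassmann_deriv_gen_times)
    then show ?thesis by (simp add: grassmann_deriv_times)
  qed
  have "body (fold deriv_pair vs (F * prod_list (map ?m vs))) = (- 1) ^ length vs * body F"
    if "distinct vs" for vs F
    using that
  proof (induction vs arbitrary: F)
    case (Cons i vs)
    have "deriv_pair i (F * ?m i * prod_list (map ?m vs)) =
        deriv_pair i (F * ?m i) * prod_list (map ?m vs)"
      using Cons.prems by (subst other, force, subst other, auto)
    moreover have "body (deriv_pair i (F * ?m i)) = - body F"
      by (simp add: even_elt_commute[of "?m i" F, symmetric] mult.assoc grassmann_deriv_gen_times
          grassmann_deriv_add grassmann_deriv_minus)
    ultimately show ?case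
      using Cons by (simp flip: mult.assoc)
  qed simp
  from this[OF distinct_others] show ?thesis
    by (simp add: berezin_eq_fold length_others)
qed

section \<open>The supercharges\<close>

definition continuous_super :: "(('v \<Rightarrow> real) \<Rightarrow> ('v \<Rightarrow> real) \<Rightarrow> 'b::topological_space) \<Rightarrow> bool" where
  "continuous_super F \<longleftrightarrow> continuous_on UNIV (\<lambda>p. F (fst p) (snd p))"

text \<open>
  Differentiability along the coordinate lines with jointly continuous partial derivatives is all that
  integration by parts requires. The coordinates at \<open>\<delta>\<close> are not variables of the model.
\<close>

definition has_partials :: "'v \<Rightarrow> (('v \<Rightarrow> real) \<Rightarrow> ('v \<Rightarrow> real) \<Rightarrow> 'b::real_normed_vector) \<Rightarrow>
    ('v \<Rightarrow> ('v \<Rightarrow> real) \<Rightarrow> ('v \<Rightarrow> real) \<Rightarrow> 'b) \<Rightarrow> ('v \<Rightarrow> ('v \<Rightarrow> real) \<Rightarrow> ('v \<Rightarrow> real) \<Rightarrow> 'b) \<Rightarrow> bool" where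
  "has_partials \<delta> F DX DY \<longleftrightarrow> continuous_super F \<and>
     (\<forall>j. j \<noteq> \<delta> \<longrightarrow> continuous_super (DX j) \<and> continuous_super (DY j) \<and>
       (\<forall>x y. ((\<lambda>t. F (x(j := t)) y) has_vector_derivative DX j x y) (at (x j)) \<and>
              ((\<lambda>t. F x (y(j := t))) has_vector_derivative DY j x y) (at (y j))))"

text \<open>
  The assertion that \<open>F\<close> is continuously differentiable and \<open>G = Q\<^sub>J F\<close>, where
  \<open>Q\<^sub>J = \<Sum>\<^sub>j \<xi>\<^sub>j (\<partial>\<^sub>x\<^sub>j + J \<partial>\<^sub>y\<^sub>j) + (x\<^sub>j + J y\<^sub>j) \<partial>\<^sub>\<eta>\<^sub>j\<close>
  is the supercharge with parameter \<open>J\<close>. As a relation it combines smoothness and value, so that both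
  are carried through sums and products at once. Superfunctions with \<open>Q\<^sub>J F = 0\<close> are called closed.
\<close>

definition susy :: "'v::finite \<Rightarrow> complex \<Rightarrow> ('v, complex) superfunction \<Rightarrow>
    ('v, complex) superfunction \<Rightarrow> bool" where
  "susy \<delta> J F G \<longleftrightarrow> (\<exists>DX DY. has_partials \<delta> F DX DY \<and>
     (\<forall>x y. G x y = (\<Sum>j\<in>UNIV - {\<delta>}. gen (Inl j) * (DX j x y + const J * DY j x y) +
        const (of_real (x j) + J * of_real (y j)) * grassmann_deriv (Inr j) (F x y))))"

lemma continuous_super_const: "continuous_super (\<lambda>x y. c)"
  by (simp add: continuous_super_def)

lemma continuous_super_coordinate:
  "continuous_super (\<lambda>x y. x i)" "continuous_super (\<lambda>x y. y i)"
  unfolding continuous_super_def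
  by (auto intro: continuous_on_compose2[OF continuous_on_product_coordinates[of i]
        continuous_on_fst[OF continuous_on_id]] continuous_on_compose2[OF
        continuous_on_product_coordinates[of i] continuous_on_snd[OF continuous_on_id]])

lemma continuous_super_add:
  fixes F G :: "('v \<Rightarrow> real) \<Rightarrow> ('v \<Rightarrow> real) \<Rightarrow> 'b::real_normed_vector"
  shows "continuous_super F \<Longrightarrow> continuous_super G \<Longrightarrow> continuous_super (\<lambda>x y. F x y + G x y)"
  unfolding continuous_super_def by (intro continuous_intros)

lemma continuous_super_mult:
  fixes F G :: "('v \<Rightarrow> real) \<Rightarrow> ('v \<Rightarrow> real) \<Rightarrow> 'b::real_normed_algebra"
  shows "continuous_super F \<Longrightarrow> continuous_super G \<Longrightarrow> continuous_super (\<lambda>x y. F x y * G x y)"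
  unfolding continuous_super_def by (intro continuous_intros)

lemma continuous_super_compose:
  assumes "continuous_super F" "continuous_on S h" "\<And>x y. F x y \<in> S"
  shows "continuous_super (\<lambda>x y. h (F x y))"
  using assms unfolding continuous_super_def by (auto intro: continuous_on_compose2)

lemma continuous_super_bounded_linear:
  "bounded_linear h \<Longrightarrow> continuous_super F \<Longrightarrow> continuous_super (\<lambda>x y. h (F x y))"
  unfolding continuous_super_def by (rule bounded_linear.continuous_on)

lemma const_of_nat: "const (of_nat m) = of_nat m"
  by (induction m) (simp_all add: const_0 const_1 const_add)

lemma has_partials_bounded_linear:
  assumes "bounded_linear h" "has_partials \<delta> F DX DY"
  shows "has_partials \<delta> (\<lambda>x y. h (F x y)) (\<lambda>j x y. h (DX j x y)) (\<lambda>j x y. h (DY j x y))"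
  using assms(2) unfolding has_partials_def
  by (simp add: continuous_super_bounded_linear[OF assms(1)]
      bounded_linear.has_vector_derivative[OF assms(1)])

lemma susy_cong:
  assumes "susy \<delta> J F G" "\<And>x y. F x y = F' x y" "\<And>x y. G x y = G' x y"
  shows "susy \<delta> J F' G'"
proof -
  have "F' = F" "G' = G" using assms(2,3) by (auto simp: fun_eq_iff)
  then show ?thesis using assms(1) by simp
qed

lemma susy_add:
  assumes "susy \<delta> J F F'" "susy \<delta> J G G'"
  shows "susy \<delta> J (\<lambda>x y. F x y + G x y) (\<lambda>x y. F' x y + G' x y)"
proof -
  obtain FX FY GX GY where F: "has_partials \<delta> F FX FY"
      "\<And>x y. F' x y = (\<Sum>j\<in>UNIV - {\<delta>}. gen (Inl j) * (FX j x y + const J * FY j x y) +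
        const (of_real (x j) + J * of_real (y j)) * grassmann_deriv (Inr j) (F x y))"
    and G: "has_partials \<delta> G GX GY"
      "\<And>x y. G' x y = (\<Sum>j\<in>UNIV - {\<delta>}. gen (Inl j) * (GX j x y + const J * GY j x y) +
        const (of_real (x j) + J * of_real (y j)) * grassmann_deriv (Inr j) (G x y))"
    using assms unfolding susy_def by blast
  have "has_partials \<delta> (\<lambda>x y. F x y + G x y) (\<lambda>j x y. FX j x y + GX j x y) (\<lambda>j x y. FY j x y + GY j x y)"
    using F(1) G(1) unfolding has_partials_def
    by (auto intro!: continuous_super_add has_vector_derivative_add)
  moreover have "F' x y + G' x y = (\<Sum>j\<in>UNIV - {\<delta>}.
      gen (Inl j) * (FX j x y + GX j x y + const J * (FY j x y + GY j x y)) +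
      const (of_real (x j) + J * of_real (y j)) * grassmann_deriv (Inr j) (F x y + G x y))" for x y
    unfolding F(2) G(2) by (simp add: grassmann_deriv_add distrib_left add_ac flip: sum.distrib)
  ultimately show ?thesis unfolding susy_def by blast
qed

text \<open>
  The supercharge is an odd derivation: the generator \<open>\<xi>\<^sub>j\<close> in front of the partial derivatives picks up
  the parity of \<open>F\<close> when it is moved past \<open>F\<close>, exactly as the derivative \<open>\<partial>\<^sub>\<eta>\<^sub>j\<close> does.
\<close>

lemma susy_mult:
  assumes "susy \<delta> J F F'" "susy \<delta> J G G'"
  shows "susy \<delta> J (\<lambda>x y. F x y * G x y) (\<lambda>x y. F' x y * G x y + parity (F x y) * G' x y)"
proof -
  obtain FX FY GX GY where F: "has_partials \<delta> F FX FY"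
      "\<And>x y. F' x y = (\<Sum>j\<in>UNIV - {\<delta>}. gen (Inl j) * (FX j x y + const J * FY j x y) +
        const (of_real (x j) + J * of_real (y j)) * grassmann_deriv (Inr j) (F x y))"
    and G: "has_partials \<delta> G GX GY"
      "\<And>x y. G' x y = (\<Sum>j\<in>UNIV - {\<delta>}. gen (Inl j) * (GX j x y + const J * GY j x y) +
        const (of_real (x j) + J * of_real (y j)) * grassmann_deriv (Inr j) (G x y))"
    using assms unfolding susy_def by blast
  have F1: "continuous_super F" "\<And>j. j \<noteq> \<delta> \<Longrightarrow> continuous_super (FX j)"
      "\<And>j. j \<noteq> \<delta> \<Longrightarrow> continuous_super (FY j)"
      "\<And>j x y. j \<noteq> \<delta> \<Longrightarrow> ((\<lambda>t. F (x(j := t)) y) has_vector_derivative FX j x y) (at (x j))"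
      "\<And>j x y. j \<noteq> \<delta> \<Longrightarrow> ((\<lambda>t. F x (y(j := t))) has_vector_derivative FY j x y) (at (y j))"
    using F(1) unfolding has_partials_def by blast+
  have G1: "continuous_super G" "\<And>j. j \<noteq> \<delta> \<Longrightarrow> continuous_super (GX j)"
      "\<And>j. j \<noteq> \<delta> \<Longrightarrow> continuous_super (GY j)"
      "\<And>j x y. j \<noteq> \<delta> \<Longrightarrow> ((\<lambda>t. G (x(j := t)) y) has_vector_derivative GX j x y) (at (x j))"
      "\<And>j x y. j \<noteq> \<delta> \<Longrightarrow> ((\<lambda>t. G x (y(j := t))) has_vector_derivative GY j x y) (at (y j))"
    using G(1) unfolding has_partials_def by blast+
  have "((\<lambda>t. F (x(j := t)) y * G (x(j := t)) y) has_vector_derivative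
      F x y * GX j x y + FX j x y * G x y) (at (x j))" if "j \<noteq> \<delta>" for j x y
    using has_vector_derivative_mult[OF F1(4)[OF that, of x y] G1(4)[OF that, of x y]] by simp
  moreover have "((\<lambda>t. F x (y(j := t)) * G x (y(j := t))) has_vector_derivative
      F x y * GY j x y + FY j x y * G x y) (at (y j))" if "j \<noteq> \<delta>" for j x y
    using has_vector_derivative_mult[OF F1(5)[OF that, of x y] G1(5)[OF that, of x y]] by simp
  ultimately have "has_partials \<delta> (\<lambda>x y. F x y * G x y)
      (\<lambda>j x y. F x y * GX j x y + FX j x y * G x y) (\<lambda>j x y. F x y * GY j x y + FY j x y * G x y)"
    using F1(1-3) G1(1-3) unfolding has_partials_def
    by (auto intro!: continuous_super_add continuous_super_mult)
  moreover have "F' x y * G x y + parity (F x y) * G' x y = (\<Sum>j\<in>UNIV - {\<delta>}.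
      gen (Inl j) * (F x y * GX j x y + FX j x y * G x y + const J * (F x y * GY j x y + FY j x y * G x y)) +
      const (of_real (x j) + J * of_real (y j)) * grassmann_deriv (Inr j) (F x y * G x y))" for x y
    unfolding F(2) G(2) sum_distrib_left sum_distrib_right sum.distrib[symmetric]
  proof (rule sum.cong[OF refl])
    fix j
    let ?c = "const (complex_of_real (x j) + J * complex_of_real (y j)) :: ('a + 'a, complex) grassmann"
    let ?f = "F x y" and ?g = "G x y" and ?J = "const J :: ('a + 'a, complex) grassmann"
    have 1: "parity ?f * (gen (Inl j) * H) = gen (Inl j) * (?f * H)" for H
      by (simp only: gen_times_commute mult.assoc[symmetric])
    have 2: "parity ?f * (?c * H) = ?c * (parity ?f * H)" "?f * (?J * H) = ?J * (?f * H)" for H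
      by (simp_all only: const_times_commute[of "parity ?f"] const_times_commute[of ?f] mult.assoc[symmetric])
    show "(gen (Inl j) * (FX j x y + ?J * FY j x y) + ?c * grassmann_deriv (Inr j) ?f) * ?g +
        parity ?f * (gen (Inl j) * (GX j x y + ?J * GY j x y) + ?c * grassmann_deriv (Inr j) ?g) =
      gen (Inl j) * (?f * GX j x y + FX j x y * ?g + ?J * (?f * GY j x y + FY j x y * ?g)) +
      ?c * grassmann_deriv (Inr j) (?f * ?g)"
      by (simp add: grassmann_deriv_times distrib_left distrib_right mult.assoc 1 2 add_ac)
  qed
  ultimately show ?thesis unfolding susy_def by blast
qed

lemma susy_fixed:
  "susy \<delta> J (\<lambda>x y. F) (\<lambda>x y. \<Sum>j\<in>UNIV - {\<delta>}.
     const (of_real (x j) + J * of_real (y j)) * grassmann_deriv (Inr j) F)"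
  unfolding susy_def has_partials_def
  by (rule exI[of _ "\<lambda>j x y. 0"], rule exI[of _ "\<lambda>j x y. 0"]) (simp add: continuous_super_const)

lemma susy_fixed_const: "susy \<delta> J (\<lambda>x y. const c) (\<lambda>x y. 0)"
  using susy_fixed[of \<delta> J "const c"] by (simp add: grassmann_deriv_const)

lemma susy_const_mult:
  assumes "susy \<delta> J F F'" shows "susy \<delta> J (\<lambda>x y. const c * F x y) (\<lambda>x y. const c * F' x y)"
  using susy_mult[OF susy_fixed_const[of \<delta> J c] assms] by simp

lemma susy_uminus:
  assumes "susy \<delta> J F F'" shows "susy \<delta> J (\<lambda>x y. - F x y) (\<lambda>x y. - F' x y)"
  using susy_const_mult[OF assms, of "- 1"] by (simp add: const_minus const_1)

lemma susy_diff:
  assumes "susy \<delta> J F F'" "susy \<delta> J G G'"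
  shows "susy \<delta> J (\<lambda>x y. F x y - G x y) (\<lambda>x y. F' x y - G' x y)"
  using susy_add[OF assms(1) susy_uminus[OF assms(2)]] by simp

lemma susy_sum:
  assumes "\<And>i. i \<in> I \<Longrightarrow> susy \<delta> J (F i) (F' i)"
  shows "susy \<delta> J (\<lambda>x y. \<Sum>i\<in>I. F i x y) (\<lambda>x y. \<Sum>i\<in>I. F' i x y)"
  using assms
proof (induction I rule: infinite_finite_induct)
  case (insert i I)
  then show ?case using susy_add[of \<delta> J "F i" "F' i"] by simp
qed (use susy_fixed_const[of \<delta> J 0] in \<open>simp_all add: const_0\<close>)

lemma susy_closed_mult:
  assumes "susy \<delta> J F (\<lambda>x y. 0)" "susy \<delta> J G (\<lambda>x y. 0)"
  shows "susy \<delta> J (\<lambda>x y. F x y * G x y) (\<lambda>x y. 0)"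
  using susy_mult[OF assms] by simp

lemma susy_closed_prod_list:
  assumes "\<And>i. i \<in> set is \<Longrightarrow> susy \<delta> J (F i) (\<lambda>x y. 0)"
  shows "susy \<delta> J (\<lambda>x y. prod_list (map (\<lambda>i. F i x y) is)) (\<lambda>x y. 0)"
  using assms
proof (induction "is")
  case Nil
  show ?case using susy_fixed_const[of \<delta> J 1] by (simp add: const_1)
next
  case (Cons i "is")
  then show ?case using susy_closed_mult[of \<delta> J "F i"] by simp
qed

lemma susy_scalar:
  assumes "has_partials \<delta> c cx cy"
  shows "susy \<delta> J (\<lambda>x y. const (c x y))
    (\<lambda>x y. \<Sum>j\<in>UNIV - {\<delta>}. gen (Inl j) * const (cx j x y + J * cy j x y))"
  unfolding susy_def
proof (intro exI conjI allI)
  show "has_partials \<delta> (\<lambda>x y. const (c x y)) (\<lambda>j x y. const (cx j x y)) (\<lambda>j x y. const (cy j x y))"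
    by (rule has_partials_bounded_linear[OF bounded_linear_const assms])
qed (simp add: const_add const_mult grassmann_deriv_const)

text \<open>
  The chain rule for scalar superfunctions. It governs the coefficients of Taylor sums, which are
  functions of bodies.
\<close>

lemma susy_entire:
  assumes u: "susy \<delta> J (\<lambda>x y. const (u x y)) \<omega>" and H: "H holomorphic_on UNIV"
  shows "susy \<delta> J (\<lambda>x y. const (H (u x y))) (\<lambda>x y. const (deriv H (u x y)) * \<omega> x y)"
proof -
  obtain DX DY where D: "has_partials \<delta> (\<lambda>x y. const (u x y)) DX DY" and
      \<omega>: "\<And>x y. \<omega> x y = (\<Sum>j\<in>UNIV - {\<delta>}. gen (Inl j) * (DX j x y + const J * DY j x y))"
    using u unfolding susy_def by (auto simp: grassmann_deriv_const)
  \<comment> \<open>The coefficients of \<open>const\<close> off the body vanish identically, hence so do their derivatives.\<close>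
  have D_const: "DX j x y = const (body (DX j x y))" "DY j x y = const (body (DY j x y))"
    if "j \<noteq> \<delta>" for j x y
  proof -
    have "coeff (DX j x y) S = 0 \<and> coeff (DY j x y) S = 0" if "S \<noteq> {}" for S
    proof
      have "((\<lambda>t. 0) has_vector_derivative coeff (DX j x y) S) (at (x j))"
        using bounded_linear.has_vector_derivative[OF bounded_linear_coeff[of S],
            of "\<lambda>t. const (u (x(j := t)) y)" "DX j x y"] D \<open>j \<noteq> \<delta>\<close> \<open>S \<noteq> {}\<close>
        by (simp add: has_partials_def coeff_const)
      then show "coeff (DX j x y) S = 0"
        using vector_derivative_unique_at has_vector_derivative_const by blast
      have "((\<lambda>t. 0) has_vector_derivative coeff (DY j x y) S) (at (y j))"
        using bounded_linear.has_vector_derivative[OF bounded_linear_coeff[of S],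
            of "\<lambda>t. const (u x (y(j := t)))" "DY j x y"] D \<open>j \<noteq> \<delta>\<close> \<open>S \<noteq> {}\<close>
        by (simp add: has_partials_def coeff_const)
      then show "coeff (DY j x y) S = 0"
        using vector_derivative_unique_at has_vector_derivative_const by blast
    qed
    then show "DX j x y = const (body (DX j x y))" "DY j x y = const (body (DY j x y))"
      by (auto intro!: grassmann_eqI simp: coeff_const body_def)
  qed
  have D1: "continuous_super u" "\<And>j. j \<noteq> \<delta> \<Longrightarrow> continuous_super (\<lambda>x y. body (DX j x y))"
      "\<And>j. j \<noteq> \<delta> \<Longrightarrow> continuous_super (\<lambda>x y. body (DY j x y))"
      "\<And>j x y. j \<noteq> \<delta> \<Longrightarrow> ((\<lambda>t. u (x(j := t)) y) has_vector_derivative body (DX j x y)) (at (x j))"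
      "\<And>j x y. j \<noteq> \<delta> \<Longrightarrow> ((\<lambda>t. u x (y(j := t))) has_vector_derivative body (DY j x y)) (at (y j))"
    using has_partials_bounded_linear[OF bounded_linear_body D] unfolding has_partials_def by simp_all
  have H': "(H has_field_derivative deriv H z) (at z)" for z
    using H holomorphic_derivI[of H UNIV z UNIV] by simp
  have cont: "continuous_on UNIV H" "continuous_on UNIV (deriv H)"
    using H holomorphic_on_imp_continuous_on holomorphic_deriv[of H UNIV] by auto
  have "has_partials \<delta> (\<lambda>x y. H (u x y)) (\<lambda>j x y. body (DX j x y) * deriv H (u x y))
      (\<lambda>j x y. body (DY j x y) * deriv H (u x y))"
    unfolding has_partials_def
  proof (intro conjI allI impI)
    fix j x y assume j: "j \<noteq> \<delta>"
    show "((\<lambda>t. H (u (x(j := t)) y)) has_vector_derivative body (DX j x y) * deriv H (u x y)) (at (x j))"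
      using field_vector_diff_chain_at[OF D1(4)[OF j, of x y], of H "deriv H (u x y)"] H'
      by (simp add: comp_def)
    show "((\<lambda>t. H (u x (y(j := t)))) has_vector_derivative body (DY j x y) * deriv H (u x y)) (at (y j))"
      using field_vector_diff_chain_at[OF D1(5)[OF j, of x y], of H "deriv H (u x y)"] H'
      by (simp add: comp_def)
  qed (use D1(1-3) cont in \<open>auto intro!: continuous_super_mult intro: continuous_super_compose[where S = UNIV]\<close>)
  from susy_scalar[OF this, of J] show ?thesis
  proof (rule susy_cong)
    fix x y
    have "const (deriv H (u x y)) * \<omega> x y = (\<Sum>j\<in>UNIV - {\<delta>}. const (deriv H (u x y)) *
        (gen (Inl j) * const (body (DX j x y) + J * body (DY j x y))))"
      unfolding \<omega> sum_distrib_left using D_const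
      by (intro sum.cong) (auto simp: const_add const_mult)
    also have "\<dots> = (\<Sum>j\<in>UNIV - {\<delta>}. gen (Inl j) *
        const (body (DX j x y) * deriv H (u x y) + J * (body (DY j x y) * deriv H (u x y))))"
      by (intro sum.cong grassmann_eqI) (auto simp: const_times_commute algebra_simps)
    finally show "\<dots> = const (deriv H (u x y)) * \<omega> x y" by (rule sym)
  qed simp
qed

lemma susy_body:
  assumes "susy \<delta> J F G"
  obtains \<omega> where "susy \<delta> J (\<lambda>x y. const (body (F x y))) \<omega>" "\<And>x y. body (\<omega> x y) = 0"
proof -
  obtain DX DY where D: "has_partials \<delta> F DX DY"
    using assms unfolding susy_def by auto
  from has_partials_bounded_linear[OF bounded_linear_body D]
  have "has_partials \<delta> (\<lambda>x y. body (F x y)) (\<lambda>j x y. body (DX j x y)) (\<lambda>j x y. body (DY j x y))" .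
  from that[OF susy_scalar[OF this]] show ?thesis by (simp add: body_sum)
qed

lemma susy_power:
  assumes n: "susy \<delta> J n n'" and even: "\<And>x y. even_elt (n x y)"
  shows "susy \<delta> J (\<lambda>x y. n x y ^ k) (\<lambda>x y. of_nat k * (n x y ^ (k - 1) * n' x y))"
proof (induction k)
  case 0
  show ?case using susy_fixed_const[of \<delta> J 1] by (simp add: const_1)
next
  case (Suc k)
  show ?case
  proof (rule susy_cong[OF susy_mult[OF n Suc]])
    fix x y
    have "parity (n x y) = n x y" using even by (simp add: even_elt_def)
    moreover have "n' x y * n x y ^ k = n x y ^ k * n' x y"
      using even_elt_commute[OF even_elt_power[OF even]] by metis
    moreover have "n x y * (of_nat k * (n x y ^ (k - 1) * n' x y)) = of_nat k * (n x y ^ k * n' x y)"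
    proof (cases k)
      case (Suc m)
      have "n x y * (of_nat k * (n x y ^ m * n' x y)) = of_nat k * (n x y * (n x y ^ m * n' x y))"
        by (simp only: mult_of_nat_commute[of k "n x y", symmetric] mult.assoc[symmetric])
      then show ?thesis by (simp add: Suc mult.assoc)
    qed simp
    ultimately show "n' x y * n x y ^ k + parity (n x y) * (of_nat k * (n x y ^ (k - 1) * n' x y)) =
        of_nat (Suc k) * (n x y ^ (Suc k - 1) * n' x y)"
      by (simp add: distrib_right)
  qed simp
qed

text \<open>
  The Taylor sum of \<open>H\<close> at the body \<open>u\<close> with increment \<open>n\<close> is closed as soon as \<open>u + n\<close> is.
  The supercharge turns the \<open>k\<close>-th coefficient into \<open>k + 1\<close> times the next one and lowers the powers
  of \<open>n\<close>. As it maps \<open>n\<close> to the opposite of the image of \<open>u\<close>, these contributions telescope, and the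
  last one vanishes by nilpotency.
\<close>

lemma susy_closed_taylor:
  fixes \<delta> :: "'v::finite" and n \<omega> :: "('v, complex) superfunction"
  assumes u: "susy \<delta> J (\<lambda>x y. const (u x y)) \<omega>" "\<And>x y. body (\<omega> x y) = 0"
    and H: "H holomorphic_on UNIV"
    and n: "susy \<delta> J n (\<lambda>x y. - \<omega> x y)" "\<And>x y. even_elt (n x y)" "\<And>x y. body (n x y) = 0"
  shows "susy \<delta> J (\<lambda>x y. \<Sum>k\<le>CARD('v + 'v). const ((deriv ^^ k) H (u x y) / fact k) * n x y ^ k)
    (\<lambda>x y. 0)"
proof -
  let ?N = "CARD('v + 'v)"
  define C where "C k x y = (deriv ^^ k) H (u x y) / fact k" for k x y
  define a where "a k x y = of_nat k * (const (C k x y) * (n x y ^ (k - 1) * \<omega> x y))" for k x y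
  have C: "susy \<delta> J (\<lambda>x y. const (C k x y)) (\<lambda>x y. of_nat (Suc k) * (const (C (Suc k) x y) * \<omega> x y))" for k
  proof -
    have "(deriv ^^ k) H holomorphic_on UNIV" using H by (rule holomorphic_higher_deriv) simp
    from susy_const_mult[OF susy_entire[OF u(1) this], of "1 / fact k"] show ?thesis
    proof (rule susy_cong)
      fix x y
      have "of_nat (Suc k) * (const (C (Suc k) x y) * \<omega> x y) =
          const (of_nat (Suc k) * C (Suc k) x y) * \<omega> x y"
        by (simp only: const_of_nat const_mult mult.assoc)
      also have "of_nat (Suc k) * C (Suc k) x y = 1 / fact k * deriv ((deriv ^^ k) H) (u x y)"
        by (simp add: C_def del: of_nat_Suc)
      finally show "const (1 / fact k) * (const (deriv ((deriv ^^ k) H) (u x y)) * \<omega> x y) =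
          of_nat (Suc k) * (const (C (Suc k) x y) * \<omega> x y)"
        by (simp only: const_mult mult.assoc)
    qed (simp add: C_def flip: const_mult)
  qed
  have "susy \<delta> J (\<lambda>x y. const (C k x y) * n x y ^ k) (\<lambda>x y. a (Suc k) x y - a k x y)" for k
  proof (rule susy_cong[OF susy_mult[OF C susy_power[OF n(1,2)]]])
    fix x y
    have "\<omega> x y * n x y ^ k = n x y ^ k * \<omega> x y"
      using even_elt_commute[OF even_elt_power[OF n(2)]] by metis
    moreover have "const (C k x y) * (of_nat k * (n x y ^ (k - 1) * \<omega> x y)) = a k x y"
      unfolding a_def by (metis mult.assoc mult_of_nat_commute)
    ultimately show "of_nat (Suc k) * (const (C (Suc k) x y) * \<omega> x y) * n x y ^ k +
        parity (const (C k x y)) * (of_nat k * (n x y ^ (k - 1) * - \<omega> x y)) = a (Suc k) x y - a k x y"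
      by (simp add: a_def mult.assoc)
  qed simp
  then have "susy \<delta> J (\<lambda>x y. \<Sum>k\<in>{..?N}. const (C k x y) * n x y ^ k)
      (\<lambda>x y. \<Sum>k\<in>{..?N}. a (Suc k) x y - a k x y)"
    by (rule susy_sum)
  then show ?thesis
  proof (rule susy_cong)
    fix x y
    have "(\<Sum>k\<le>?N. a (Suc k) x y - a k x y) = a (Suc ?N) x y - a 0 x y"
      using sum_lessThan_telescope[of "\<lambda>k. a k x y" "Suc ?N"] by (simp only: lessThan_Suc_atMost)
    also have "\<dots> = 0"
      using nilpotent_times_eq_0[OF n(3) u(2), of x y] by (simp add: a_def)
    finally show "(\<Sum>k\<le>?N. a (Suc k) x y - a k x y) = 0" .
  qed (simp add: C_def)
qed

section \<open>The closed superfunctions of the model\<close>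

lemma taylor1_square_zero:
  fixes n :: "('g::finite, real) grassmann"
  assumes "n * n = 0" "body n = 0"
  shows "taylor1 g (const a + n) = const (g a) + const (deriv g a) * n"
proof -
  have "n ^ k = 0" if k: "k \<ge> 2" for k
  proof -
    have "n ^ (2 + m) = 0" for m
      by (simp only: power_add power2_eq_square assms(1) mult_zero_left)
    then show ?thesis using le_Suc_ex[OF k] by auto
  qed
  moreover have "1 \<le> CARD('g)" by (simp add: Suc_leI)
  ultimately have "(\<Sum>k\<le>CARD('g). const ((deriv ^^ k) g a / fact k) * n ^ k) =
      (\<Sum>k\<in>{0, 1}. const ((deriv ^^ k) g a / fact k) * n ^ k)"
    by (intro sum.mono_neutral_right) auto
  then show ?thesis using assms(2) by (simp add: taylor1_def)
qed

text \<open>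
  The body of \<open>N\<^sub>i = x\<^sub>i\<^sup>2 + y\<^sub>i\<^sup>2 + 2 \<xi>\<^sub>i \<eta>\<^sub>i\<close>. The value at \<open>\<delta>\<close> makes the formulas for \<open>z\<^sub>i\<close> uniform in \<open>i\<close>.
\<close>

definition radius2 :: "'v \<Rightarrow> 'v \<Rightarrow> ('v \<Rightarrow> real) \<Rightarrow> ('v \<Rightarrow> real) \<Rightarrow> real" where
  "radius2 \<delta> i x y = (if i = \<delta> then 0 else (x i)\<^sup>2 + (y i)\<^sup>2)"

lemma radius2_nonneg [simp]: "radius2 \<delta> i x y \<ge> 0"
  by (simp add: radius2_def)

definition fermions :: "'v \<Rightarrow> 'v \<Rightarrow> ('v::finite + 'v, 'c::comm_ring_1) grassmann" where
  "fermions \<delta> i = (if i = \<delta> then 0 else gen (Inl i) * gen (Inr i))"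

lemma even_fermions [simp]: "even_elt (fermions \<delta> i)"
  and body_fermions [simp]: "body (fermions \<delta> i) = 0"
  by (simp_all add: fermions_def)

lemma gen_fermions: "gen (Inl i) * fermions \<delta> i = 0" "fermions \<delta> i * gen (Inr i) = 0"
  "gen (Inr i) * fermions \<delta> i = 0"
proof -
  show 1: "gen (Inl i) * fermions \<delta> i = 0" "fermions \<delta> i * gen (Inr i) = 0"
    by (simp_all add: fermions_def gen_square mult.assoc) (simp add: gen_square flip: mult.assoc)
  then show "gen (Inr i) * fermions \<delta> i = 0"
    using even_elt_commute[OF even_fermions] by metis
qed

lemma fermions_square: "fermions \<delta> i * fermions \<delta> i = (0 :: ('v::finite + 'v, 'c::comm_ring_1) grassmann)"
proof -
  have "fermions \<delta> i * (fermions \<delta> i :: ('v + 'v, 'c) grassmann) = (if i = \<delta> then 0 else gen (Inl i) * (gen (Inr i) * fermions \<delta> i))"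
    by (simp add: fermions_def mult.assoc)
  then show ?thesis by (simp add: gen_fermions)
qed

lemma const_fermions_square: "const c * fermions \<delta> i * (const c * fermions \<delta> i) = 0"
proof -
  have "fermions \<delta> i * (const c * fermions \<delta> i) = const c * (fermions \<delta> i * fermions \<delta> i)"
    by (metis const_times_commute mult.assoc)
  then show ?thesis by (simp add: mult.assoc fermions_square)
qed

lemma xi_eta_eq_fermions: "xi \<delta> i * eta \<delta> i = fermions \<delta> i"
  by (simp add: xi_def eta_def fermions_def)

lemma complexify_fermions: "complexify (fermions \<delta> i) = fermions \<delta> i"
  by (simp add: fermions_def complexify_simps)

lemma zcoord_eq: "zcoord \<delta> i x y =
    const (sqrt (1 + radius2 \<delta> i x y)) + const (1 / sqrt (1 + radius2 \<delta> i x y)) * fermions \<delta> i"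
proof -
  let ?s = "radius2 \<delta> i x y"
  have "1 + coord \<delta> x i ^ 2 + coord \<delta> y i ^ 2 + 2 * xi \<delta> i * eta \<delta> i = const (1 + ?s) + const 2 * fermions \<delta> i"
    by (simp add: radius2_def coord_def const_add const_power const_1 const_0 const_numeral mult.assoc
        xi_eta_eq_fermions)
  moreover have "deriv sqrt (1 + ?s) * 2 = 1 / sqrt (1 + ?s)"
    using DERIV_imp_deriv[OF DERIV_real_sqrt[of "1 + ?s"]]
    by (simp add: add_pos_nonneg inverse_eq_divide)
  ultimately show ?thesis
    unfolding zcoord_def
    by (simp add: taylor1_square_zero const_fermions_square) (simp flip: mult.assoc const_mult)
qed

lemma taylor1_inverse_zcoord: "taylor1 inverse (zcoord \<delta> i x y) =
    const (1 / sqrt (1 + radius2 \<delta> i x y)) - const (1 / sqrt (1 + radius2 \<delta> i x y) ^ 3) * fermions \<delta> i"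
proof -
  let ?s = "sqrt (1 + radius2 \<delta> i x y)" and ?m = "fermions \<delta> i :: ('a + 'a, real) grassmann"
  have s: "?s > 0" by (simp add: add_pos_nonneg)
  have "taylor1 inverse (zcoord \<delta> i x y) =
      const (inverse ?s) + const (deriv inverse ?s) * (const (1 / ?s) * ?m)"
    unfolding zcoord_eq by (subst taylor1_square_zero) (simp_all add: const_fermions_square)
  moreover have "deriv inverse ?s * (1 / ?s) = - (1 / ?s ^ 3)"
    using s DERIV_imp_deriv[OF DERIV_inverse[of ?s]]
    by (simp add: power2_eq_square power3_eq_cube field_simps)
  ultimately show ?thesis
    by (simp add: inverse_eq_divide const_minus flip: mult.assoc const_mult)
qed

text \<open>
  The superfunction \<open>g(N\<^sub>i)\<close> when \<open>g'\<close> is the derivative of \<open>g\<close>: since \<open>(\<xi>\<^sub>i \<eta>\<^sub>i)\<^sup>2 = 0\<close>, its Taylor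
  expansion stops after the linear term. The factors \<open>z\<^sub>i\<close> and \<open>1/z\<^sub>i\<close>, the Gaussians and the cutoffs
  all have this form.
\<close>

definition radial_super :: "'v \<Rightarrow> (real \<Rightarrow> real) \<Rightarrow> (real \<Rightarrow> real) \<Rightarrow> 'v \<Rightarrow>
    ('v::finite, complex) superfunction" where
  "radial_super \<delta> g g' i x y = const (of_real (g (radius2 \<delta> i x y))) +
     const (of_real (2 * g' (radius2 \<delta> i x y))) * fermions \<delta> i"

lemma even_radial_super [simp]: "even_elt (radial_super \<delta> g g' i x y)"
  by (simp add: radial_super_def even_elt_intros)

lemma complexify_zcoord: "complexify (zcoord \<delta> i x y) =
    radial_super \<delta> (\<lambda>s. sqrt (1 + s)) (\<lambda>s. 1 / (2 * sqrt (1 + s))) i x y"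
  by (simp add: zcoord_eq radial_super_def complexify_simps complexify_fermions)

lemma complexify_inverse_zcoord: "complexify (taylor1 inverse (zcoord \<delta> i x y)) =
    radial_super \<delta> (\<lambda>s. 1 / sqrt (1 + s)) (\<lambda>s. - 1 / (2 * sqrt (1 + s) ^ 3)) i x y"
  by (simp add: taylor1_inverse_zcoord radial_super_def complexify_simps complexify_fermions const_minus)

lemma susy_xi: "susy \<delta> J (\<lambda>x y. complexify (xi \<delta> i)) (\<lambda>x y. 0)"
  by (rule susy_cong[OF susy_fixed], simp, cases "i = \<delta>")
    (simp_all add: xi_def complexify_simps grassmann_deriv_gen grassmann_deriv_0)

lemma susy_eta: "susy \<delta> J (\<lambda>x y. complexify (eta \<delta> i))
    (\<lambda>x y. complexify (coord \<delta> x i) + const J * complexify (coord \<delta> y i))"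
proof (rule susy_cong[OF susy_fixed])
  fix x y :: "'a \<Rightarrow> real"
  have "(\<Sum>j\<in>UNIV - {\<delta>}. const (complex_of_real (x j) + J * complex_of_real (y j)) *
      grassmann_deriv (Inr j) (complexify (eta \<delta> i))) = (\<Sum>j\<in>UNIV - {\<delta>}.
        if j = i then const (of_real (x i)) + const J * const (of_real (y i)) else 0)"
    by (rule sum.cong) (auto simp: eta_def complexify_simps grassmann_deriv_gen grassmann_deriv_0
        const_add const_mult)
  then show "(\<Sum>j\<in>UNIV - {\<delta>}. const (complex_of_real (x j) + J * complex_of_real (y j)) *
      grassmann_deriv (Inr j) (complexify (eta \<delta> i))) =
      complexify (coord \<delta> x i) + const J * complexify (coord \<delta> y i)"
    by (simp add: coord_def complexify_simps)
qed simp

lemma susy_coord: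
  "susy \<delta> J (\<lambda>x y. complexify (coord \<delta> x i)) (\<lambda>x y. complexify (xi \<delta> i))"
  "susy \<delta> J (\<lambda>x y. complexify (coord \<delta> y i)) (\<lambda>x y. const J * complexify (xi \<delta> i))"
proof -
  have "susy \<delta> J (\<lambda>x y. complexify (coord \<delta> x i)) (\<lambda>x y. complexify (xi \<delta> i)) \<and>
    susy \<delta> J (\<lambda>x y. complexify (coord \<delta> y i)) (\<lambda>x y. const J * complexify (xi \<delta> i))"
  proof (cases "i = \<delta>")
    case True
    then show ?thesis
      using susy_fixed_const[of \<delta> J 0] by (simp add: coord_def xi_def complexify_simps const_0)
  next
    case False
    let ?e = "\<lambda>j (x::'a \<Rightarrow> real) (y::'a \<Rightarrow> real). if j = i then 1 else 0 :: complex"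
    have coord: "((\<lambda>t. complex_of_real ((x(j := t)) i)) has_vector_derivative (if j = i then 1 else 0)) (at s)"
      for x :: "'a \<Rightarrow> real" and j and s :: real
    proof -
      have "(of_real has_vector_derivative complex_of_real 1) (at s)"
        by (rule has_vector_derivative_of_real) simp
      then show ?thesis by simp
    qed
    have cont: "continuous_super (\<lambda>x y. complex_of_real (x i))"
      "continuous_super (\<lambda>x y. complex_of_real (y i))"
      by (auto intro!: continuous_super_bounded_linear[OF bounded_linear_of_real]
          continuous_super_coordinate)
    have partials: "has_partials \<delta> (\<lambda>x y. complex_of_real (x i)) ?e (\<lambda>j x y. 0)"
      "has_partials \<delta> (\<lambda>x y. complex_of_real (y i)) (\<lambda>j x y. 0) ?e"
      unfolding has_partials_def
      by (intro conjI allI impI cont coord continuous_super_const has_vector_derivative_const)+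
    have sum: "(\<Sum>j\<in>UNIV - {\<delta>}. gen (Inl j) * const (c * (if j = i then 1 else 0))) =
        const c * (gen (Inl i) :: ('a + 'a, complex) grassmann)" for c
    proof -
      have "(\<Sum>j\<in>UNIV - {\<delta>}. gen (Inl j) * const (c * (if j = i then 1 else 0))) =
          (\<Sum>j\<in>UNIV - {\<delta>}. if j = i then const c * (gen (Inl i) :: ('a + 'a, complex) grassmann) else 0)"
        by (rule sum.cong) (auto simp: const_0 const_times_commute[of "gen _"])
      then show ?thesis using False by simp
    qed
    have "susy \<delta> J (\<lambda>x y. complexify (coord \<delta> x i)) (\<lambda>x y. complexify (xi \<delta> i))"
      by (rule susy_cong[OF susy_scalar[OF partials(1)]])
        (use False sum[of 1] in \<open>simp_all add: coord_def xi_def complexify_simps const_1\<close>)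
    moreover have "susy \<delta> J (\<lambda>x y. complexify (coord \<delta> y i)) (\<lambda>x y. const J * complexify (xi \<delta> i))"
      by (rule susy_cong[OF susy_scalar[OF partials(2)]])
        (use False sum[of J] in \<open>simp_all add: coord_def xi_def complexify_simps const_1\<close>)
    ultimately show ?thesis by simp
  qed
  then show "susy \<delta> J (\<lambda>x y. complexify (coord \<delta> x i)) (\<lambda>x y. complexify (xi \<delta> i))"
    "susy \<delta> J (\<lambda>x y. complexify (coord \<delta> y i)) (\<lambda>x y. const J * complexify (xi \<delta> i))"
    by simp_all
qed

lemma susy_radius2:
  assumes h: "\<And>s. s \<ge> 0 \<Longrightarrow> (h has_real_derivative h' s) (at s)" and h': "continuous_on {0..} h'"
  shows "susy \<delta> J (\<lambda>x y. const (of_real (h (radius2 \<delta> i x y))))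
    (\<lambda>x y. const (of_real (2 * h' (radius2 \<delta> i x y))) *
      ((complexify (coord \<delta> x i) + const J * complexify (coord \<delta> y i)) * complexify (xi \<delta> i)))"
proof -
  let ?r = "radius2 \<delta> i"
  let ?DX = "\<lambda>j x y. of_real (if j = i then h' (?r x y) * (2 * x i) else 0) :: complex"
  let ?DY = "\<lambda>j x y. of_real (if j = i then h' (?r x y) * (2 * y i) else 0) :: complex"
  have r: "continuous_super ?r"
    unfolding radius2_def[abs_def] power2_eq_square
    by (cases "i = \<delta>") (auto intro!: continuous_super_add continuous_super_mult
        continuous_super_coordinate continuous_super_const)
  have "continuous_on {0..} h"
    using h by (intro continuous_at_imp_continuous_on ballI) (auto intro: DERIV_isCont)
  then have hr: "continuous_super (\<lambda>x y. h (?r x y))" "continuous_super (\<lambda>x y. h' (?r x y))"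
    using r h' by (auto intro: continuous_super_compose[where S = "{0..}"])
  have h_chain: "((\<lambda>t. h (g t)) has_vector_derivative h' (g t) * g') (at t)"
    if "(g has_real_derivative g') (at t)" "g t \<ge> 0" for g g' t
    using DERIV_chain2[OF h that(1)] that(2) by (simp add: has_real_derivative_iff_has_vector_derivative)
  have "((\<lambda>t. h (?r (x(j := t)) y)) has_vector_derivative (if j = i then h' (?r x y) * (2 * x i) else 0))
      (at (x j))" if "j \<noteq> \<delta>" for j x y
  proof (cases "j = i")
    case True
    with that have "((\<lambda>t. ?r (x(j := t)) y) has_real_derivative 2 * x i) (at (x j))"
      by (auto simp: radius2_def intro!: derivative_eq_intros)
    from h_chain[OF this] True show ?thesis by simp
  next
    case False
    then show ?thesis by (cases "i = \<delta>") (simp_all add: radius2_def)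
  qed
  moreover have "((\<lambda>t. h (?r x (y(j := t)))) has_vector_derivative (if j = i then h' (?r x y) * (2 * y i) else 0))
      (at (y j))" if "j \<noteq> \<delta>" for j x y
  proof (cases "j = i")
    case True
    with that have "((\<lambda>t. ?r x (y(j := t))) has_real_derivative 2 * y i) (at (y j))"
      by (auto simp: radius2_def intro!: derivative_eq_intros)
    from h_chain[OF this] True show ?thesis by simp
  next
    case False
    then show ?thesis by (cases "i = \<delta>") (simp_all add: radius2_def)
  qed
  moreover have "continuous_super (\<lambda>x y. if j = i then h' (?r x y) * (2 * x i) else 0)"
    "continuous_super (\<lambda>x y. if j = i then h' (?r x y) * (2 * y i) else 0)" for j
    using hr(2) by (cases "j = i"; auto intro!: continuous_super_mult continuous_super_coordinate
        continuous_super_const)+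
  ultimately have "has_partials \<delta> (\<lambda>x y. h (?r x y)) (\<lambda>j x y. if j = i then h' (?r x y) * (2 * x i) else 0)
      (\<lambda>j x y. if j = i then h' (?r x y) * (2 * y i) else 0)"
    using hr(1) unfolding has_partials_def by blast
  from susy_scalar[OF has_partials_bounded_linear[OF bounded_linear_of_real this], of J]
  show ?thesis
  proof (rule susy_cong)
    fix x y
    let ?c = "of_real (2 * h' (?r x y)) * (of_real (x i) + J * of_real (y i)) :: complex"
    have "(\<Sum>j\<in>UNIV - {\<delta>}. gen (Inl j) * const (?DX j x y + J * ?DY j x y)) =
        (\<Sum>j\<in>UNIV - {\<delta>}. if j = i then const ?c * gen (Inl i) else 0)"
      by (rule sum.cong) (auto simp: const_0 const_times_commute[of "gen _"] algebra_simps)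
    then show "(\<Sum>j\<in>UNIV - {\<delta>}. gen (Inl j) * const (?DX j x y + J * ?DY j x y)) =
        const (of_real (2 * h' (?r x y))) *
        ((complexify (coord \<delta> x i) + const J * complexify (coord \<delta> y i)) * complexify (xi \<delta> i))"
      by (auto simp: xi_def coord_def complexify_simps mult.assoc const_add const_mult)
  qed simp
qed

lemma parity_xi: "parity (complexify (xi \<delta> i)) = - complexify (xi \<delta> i)"
  and parity_coord: "parity (complexify (coord \<delta> x i)) = complexify (coord \<delta> x i)"
  by (simp_all add: xi_def coord_def complexify_simps)

lemma susy_fermions: "susy \<delta> J (\<lambda>x y. fermions \<delta> i)
    (\<lambda>x y. - (complexify (xi \<delta> i) * (complexify (coord \<delta> x i) + const J * complexify (coord \<delta> y i))))"
  by (rule susy_cong[OF susy_mult[OF susy_xi[of \<delta> J i] susy_eta[of \<delta> J i]]])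
    (simp_all add: parity_xi xi_eta_eq_fermions complexify_fermions flip: complexify_times)

lemma even_coord [simp]: "even_elt (coord \<delta> x i)"
  by (simp add: coord_def)

lemma xi_fermions: "complexify (xi \<delta> i) * fermions \<delta> i = 0"
  by (simp add: xi_def complexify_simps gen_fermions)

text \<open>
  The supercharge sends \<open>x\<^sub>i\<^sup>2 + y\<^sub>i\<^sup>2\<close> to \<open>2 (x\<^sub>i + J y\<^sub>i) \<xi>\<^sub>i\<close> and \<open>2 \<xi>\<^sub>i \<eta>\<^sub>i\<close> to the opposite, so it annihilates
  \<open>N\<^sub>i\<close>; the second derivative of \<open>g\<close> appears only next to \<open>\<xi>\<^sub>i \<xi>\<^sub>i \<eta>\<^sub>i = 0\<close>.
\<close>

lemma susy_closed_radial:
  assumes g: "\<And>s. s \<ge> 0 \<Longrightarrow> (g has_real_derivative g' s) (at s)"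
    and g': "\<And>s. s \<ge> 0 \<Longrightarrow> (g' has_real_derivative g'' s) (at s)"
    and g'': "continuous_on {0..} g''"
  shows "susy \<delta> J (radial_super \<delta> g g' i) (\<lambda>x y. 0)"
proof -
  have "continuous_on {0..} g'"
    using g' by (intro continuous_at_imp_continuous_on ballI) (auto intro: DERIV_isCont)
  note g1 = susy_radius2[OF g this, of \<delta> J i]
  have "((\<lambda>s. 2 * g' s) has_real_derivative 2 * g'' s) (at s)" if "s \<ge> 0" for s
    using g'[OF that] by (rule DERIV_cmult)
  note g2 = susy_radius2[OF this continuous_on_mult_left[OF g''], of \<delta> J i]
  from susy_add[OF g1 susy_mult[OF g2 susy_fermions[of \<delta> J i]]] show ?thesis
  proof (rule susy_cong)
    fix x y
    let ?w = "complexify (coord \<delta> x i) + const J * complexify (coord \<delta> y i)"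
    let ?c = "const (complex_of_real (2 * g' (radius2 \<delta> i x y))) :: ('a + 'a, complex) grassmann"
    let ?d = "const (complex_of_real (2 * (2 * g'' (radius2 \<delta> i x y)))) :: ('a + 'a, complex) grassmann"
    have "even_elt ?w" by (intro even_elt_intros even_elt_complexify) simp_all
    then have "?w * complexify (xi \<delta> i) = complexify (xi \<delta> i) * ?w" by (rule even_elt_commute)
    moreover have "?d * (?w * complexify (xi \<delta> i)) * fermions \<delta> i = 0"
      by (simp add: mult.assoc xi_fermions)
    ultimately show "?c * (?w * complexify (xi \<delta> i)) + (?d * (?w * complexify (xi \<delta> i)) * fermions \<delta> i +
        parity ?c * - (complexify (xi \<delta> i) * ?w)) = 0"
      by simp
  qed (simp_all add: radial_super_def)
qed

lemma const_imaginary_unit_twice: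
  assumes "J * J = - 1" shows "const J * (const J * F) = - F"
proof -
  have "const J * (const J * F) = const (J * J) * F" by (simp only: const_mult mult.assoc)
  then show ?thesis by (simp add: assms const_minus const_1)
qed

text \<open>
  Every smooth function of \<open>N\<^sub>i\<close> that vanishes at \<open>0\<close> is exact. The primitive of \<open>N\<^sub>i \<psi>(N\<^sub>i)\<close> is
  \<open>\<eta>\<^sub>i (x\<^sub>i - J y\<^sub>i) \<psi>(N\<^sub>i)\<close>, because \<open>J\<^sup>2 = - 1\<close> gives
  \<open>Q\<^sub>J (\<eta>\<^sub>i (x\<^sub>i - J y\<^sub>i)) = (x\<^sub>i + J y\<^sub>i) (x\<^sub>i - J y\<^sub>i) - 2 \<eta>\<^sub>i \<xi>\<^sub>i = N\<^sub>i\<close>.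
  Next to \<open>\<eta>\<^sub>i\<close> the nilpotent part of \<open>\<psi>(N\<^sub>i)\<close> drops out.
\<close>

lemma radial_primitive:
  assumes J: "J * J = - 1"
    and \<psi>: "\<And>s. s \<ge> 0 \<Longrightarrow> (\<psi> has_real_derivative \<psi>' s) (at s)" and \<psi>': "continuous_on {0..} \<psi>'"
  shows "susy \<delta> J
    (\<lambda>x y. (complexify (coord \<delta> x i) - const J * complexify (coord \<delta> y i)) *
      (const (of_real (\<psi> (radius2 \<delta> i x y))) * complexify (eta \<delta> i)))
    (radial_super \<delta> (\<lambda>s. s * \<psi> s) (\<lambda>s. \<psi> s + s * \<psi>' s) i)"
proof (rule susy_cong[OF susy_mult[OF susy_diff[OF susy_coord(1) susy_const_mult[OF susy_coord(2)]]
      susy_mult[OF susy_radius2[OF \<psi> \<psi>'] susy_eta]]])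
  fix x y :: "'a \<Rightarrow> real"
  let ?C = "const :: complex \<Rightarrow> ('a + 'a, complex) grassmann"
  let ?xi = "complexify (xi \<delta> i)" and ?eta = "complexify (eta \<delta> i)"
  let ?X = "complexify (coord \<delta> x i)" and ?Y = "complexify (coord \<delta> y i)"
  define r where "r = radius2 \<delta> i x y"
  define a b where "a = (if i = \<delta> then 0 else complex_of_real (x i))"
    and "b = (if i = \<delta> then 0 else complex_of_real (y i))"
  have X: "?X = ?C a" and Y: "?Y = ?C b"
    by (simp_all add: a_def b_def coord_def complexify_simps const_0)
  have m: "?xi * ?eta = fermions \<delta> i"
    by (simp add: xi_eta_eq_fermions complexify_fermions flip: complexify_times)
  have "(a - J * b) * (a + J * b) = a * a - J * J * (b * b)" by (simp add: algebra_simps)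
  then have ab: "(a - J * b) * (a + J * b) = of_real r"
    unfolding J by (simp add: a_def b_def r_def radius2_def power2_eq_square)
  have 1: "?xi - ?C J * (?C J * ?xi) = ?C 2 * ?xi"
    by (simp add: const_imaginary_unit_twice[OF J] const_numeral mult_2)
  have 2: "?xi * (?C c * F) = ?C c * (?xi * F)" for c F
    by (metis const_times_commute mult.assoc)
  have t1: "(?xi - ?C J * (?C J * ?xi)) * (?C (of_real (\<psi> r)) * ?eta) = ?C (of_real (2 * \<psi> r)) * fermions \<delta> i"
    unfolding 1 by (simp add: mult.assoc 2 m const_mult const_numeral)
  have t2: "?C (a - J * b) * (?C (of_real (2 * \<psi>' r)) * (?C (a + J * b) * ?xi) * ?eta) =
      ?C (of_real r * of_real (2 * \<psi>' r)) * fermions \<delta> i"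
    unfolding ab[symmetric] by (intro grassmann_eqI) (simp add: mult.assoc m)
  have t3: "?C (a - J * b) * (?C (of_real (\<psi> r)) * ?C (a + J * b)) = ?C (of_real r * of_real (\<psi> r))"
    unfolding ab[symmetric] by (intro grassmann_eqI) (simp add: coeff_const)
  have diff: "?C a - ?C J * ?C b = ?C (a - J * b)" and sum: "?C a + ?C J * ?C b = ?C (a + J * b)"
    by (simp_all add: const_diff const_add const_mult)
  have coefficient: "complex_of_real (2 * (\<psi> r + r * \<psi>' r)) =
      of_real (2 * \<psi> r) + of_real r * of_real (2 * \<psi>' r)"
    by (simp add: algebra_simps)
  show "(?xi - ?C J * (?C J * ?xi)) * (?C (of_real (\<psi> (radius2 \<delta> i x y))) * ?eta) +
      parity (?X - ?C J * ?Y) *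
        (?C (of_real (2 * \<psi>' (radius2 \<delta> i x y))) * ((?X + ?C J * ?Y) * ?xi) * ?eta +
         parity (?C (of_real (\<psi> (radius2 \<delta> i x y)))) * (?X + ?C J * ?Y)) =
      radial_super \<delta> (\<lambda>s. s * \<psi> s) (\<lambda>s. \<psi> s + s * \<psi>' s) i x y"
    unfolding radial_super_def r_def[symmetric] coefficient
    unfolding X Y diff sum parity_const t1
      distrib_left t2 t3 of_real_mult[of r "\<psi> r"]
    by (simp only: const_add distrib_right add_ac)
qed auto

lemma susy_closed_zcoord: "susy \<delta> J (\<lambda>x y. complexify (zcoord \<delta> i x y)) (\<lambda>x y. 0)"
proof -
  have "((\<lambda>s. sqrt (1 + s)) has_real_derivative 1 / (2 * sqrt (1 + s))) (at s)"
    "((\<lambda>s. 1 / (2 * sqrt (1 + s))) has_real_derivative - 1 / (4 * sqrt (1 + s) ^ 3)) (at s)"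
    if "s \<ge> 0" for s
    using that by (auto intro!: derivative_eq_intros simp: power3_eq_cube field_simps)
  moreover have "continuous_on {0..} (\<lambda>s. - 1 / (4 * sqrt (1 + s) ^ 3))"
    by (auto intro!: continuous_intros)
  ultimately show ?thesis
    unfolding complexify_zcoord by (rule susy_closed_radial)
qed

lemma susy_closed_inverse_zcoord:
  "susy \<delta> J (\<lambda>x y. complexify (taylor1 inverse (zcoord \<delta> i x y))) (\<lambda>x y. 0)"
proof -
  have 1: "((\<lambda>s. 1 / sqrt (1 + s)) has_real_derivative - 1 / (2 * sqrt (1 + s) ^ 3)) (at s)"
    if "s \<ge> 0" for s
    using that by (auto intro!: derivative_eq_intros simp: power3_eq_cube field_simps)
  moreover have "((\<lambda>s. - 1 / (2 * sqrt (1 + s) ^ 3)) has_real_derivative 3 / (4 * sqrt (1 + s) ^ 5)) (at s)"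
    if "s \<ge> 0" for s
  proof -
    have "((\<lambda>s. - (1 / 2) * (1 / sqrt (1 + s)) ^ 3) has_real_derivative
        - (1 / 2) * (of_nat 3 * (- 1 / (2 * sqrt (1 + s) ^ 3) * (1 / sqrt (1 + s)) ^ (3 - Suc 0)))) (at s)"
      by (intro DERIV_cmult DERIV_power 1 that)
    moreover have "- (1 / 2) * (of_nat 3 * (- 1 / (2 * sqrt (1 + s) ^ 3) * (1 / sqrt (1 + s)) ^ (3 - Suc 0))) =
        3 / (4 * sqrt (1 + s) ^ 5)"
      using that by (simp add: power_divide eval_nat_numeral)
    ultimately show ?thesis by (simp add: power_divide)
  qed
  moreover have "continuous_on {0..} (\<lambda>s. 3 / (4 * sqrt (1 + s) ^ 5))"
    by (auto intro!: continuous_intros)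
  ultimately show ?thesis
    unfolding complexify_inverse_zcoord by (rule susy_closed_radial)
qed

lemma even_zcoord [simp]: "even_elt (zcoord \<delta> i x y)"
  by (simp add: zcoord_eq even_elt_intros)

text \<open>
  The bilinear form of an edge is the polarization of \<open>N\<close>, hence it is annihilated for every \<open>J\<close>:
  the terms \<open>\<xi>\<^sub>i x\<^sub>j\<close> and \<open>J \<xi>\<^sub>i y\<^sub>j\<close> cancel against the image of \<open>\<xi>\<^sub>i \<eta>\<^sub>j\<close>, and those with \<open>i\<close> and
  \<open>j\<close> exchanged against the image of \<open>\<eta>\<^sub>i \<xi>\<^sub>j\<close>.
\<close>

lemma susy_closed_action: "susy \<delta> J (\<lambda>x y. complexify (action \<delta> E W x y)) (\<lambda>x y. 0)"
proof -
  let ?z = "\<lambda>i x y. complexify (zcoord \<delta> i x y)" and ?X = "\<lambda>i x. complexify (coord \<delta> x i)"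
    and ?xi = "\<lambda>i. complexify (xi \<delta> i)" and ?eta = "\<lambda>i. complexify (eta \<delta> i)"
  let ?edge = "\<lambda>i j x y. ?z i x y * ?z j x y -
    (1 + ?X i x * ?X j x + ?X i y * ?X j y + ?xi i * ?eta j - ?eta i * ?xi j)"
  have edge: "susy \<delta> J (\<lambda>x y. ?edge i j x y) (\<lambda>x y. 0)" for i j
  proof -
    note one = susy_fixed_const[of \<delta> J 1]
    have "susy \<delta> J (\<lambda>x y. ?z i x y * ?z j x y -
        (const 1 + ?X i x * ?X j x + ?X i y * ?X j y + ?xi i * ?eta j - ?eta i * ?xi j))
      (\<lambda>x y. 0 - (0 + (?xi i * ?X j x + parity (?X i x) * ?xi j) +
        (const J * ?xi i * ?X j y + parity (?X i y) * (const J * ?xi j)) +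
        (0 * ?eta j + parity (?xi i) * (?X j x + const J * ?X j y)) -
        ((?X i x + const J * ?X i y) * ?xi j + parity (?eta i) * 0)))"
      by (intro susy_diff susy_add susy_mult one susy_coord susy_xi susy_eta
          susy_closed_mult susy_closed_zcoord)
    then show ?thesis
    proof (rule susy_cong)
      fix x y
      have comm: "?X i x * F = F * ?X i x" "?xi j * (const J * F) = const J * (?xi j * F)"
        "?X i y * (const J * F) = const J * (?X i y * F)" "?xi i * (const J * F) = const J * (?xi i * F)" for F
        by (metis even_elt_commute even_elt_complexify even_coord const_times_commute mult.assoc)+
      show "0 - (0 + (?xi i * ?X j x + parity (?X i x) * ?xi j) +
        (const J * ?xi i * ?X j y + parity (?X i y) * (const J * ?xi j)) +
        (0 * ?eta j + parity (?xi i) * (?X j x + const J * ?X j y)) -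
        ((?X i x + const J * ?X i y) * ?xi j + parity (?eta i) * 0)) = 0"
        by (simp add: parity_coord parity_xi distrib_left distrib_right mult.assoc comm(3,4))
    qed (simp add: const_1)
  qed
  have "susy \<delta> J (\<lambda>x y. - (\<Sum>e\<in>{(i, j) \<in> E. to_nat i < to_nat j}.
      const (of_real (W (fst e) (snd e))) * ?edge (fst e) (snd e) x y))
    (\<lambda>x y. - (\<Sum>e\<in>{(i, j) \<in> E. to_nat i < to_nat j}. const (of_real (W (fst e) (snd e))) * 0))"
    by (intro susy_uminus susy_sum susy_const_mult edge)
  then show ?thesis
    by (rule susy_cong) (simp_all add: action_def complexify_simps case_prod_unfold)
qed

lemma even_action: "even_elt (action \<delta> E W x y)"
proof -
  have "parity (xi \<delta> i) = - xi \<delta> i" "parity (eta \<delta> i) = - eta \<delta> i" for i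
    by (simp_all add: xi_def eta_def)
  moreover have "parity (coord \<delta> x i) = coord \<delta> x i" "parity (zcoord \<delta> i x y) = zcoord \<delta> i x y" for i x y
    using even_coord even_zcoord unfolding even_elt_def by blast+
  ultimately have edge: "even_elt (const w * (zcoord \<delta> i x y * zcoord \<delta> j x y -
      (1 + coord \<delta> x i * coord \<delta> x j + coord \<delta> y i * coord \<delta> y j
         + xi \<delta> i * eta \<delta> j - eta \<delta> i * xi \<delta> j)))" for w i j
    by (simp add: even_elt_def parity_times parity_add parity_diff)
  show ?thesis
    unfolding action_def case_prod_unfold by (intro even_elt_minus even_elt_sum edge)
qed

definition soul :: "('g::finite, real) grassmann \<Rightarrow> ('g, complex) grassmann" where
  "soul A = complexify (A - const (body A))"

lemma soul_eq: "soul A = complexify A - const (of_real (body A))"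
  by (simp add: soul_def complexify_simps)

lemma even_soul: "even_elt A \<Longrightarrow> even_elt (soul A)"
  by (simp add: soul_def even_elt_complexify even_elt_diff)

lemma body_soul [simp]: "body (soul A) = 0"
  by (simp add: soul_def)

lemma higher_deriv_exp: "(deriv ^^ k) exp = (exp :: 'b \<Rightarrow> 'b::{banach, real_normed_field})"
proof -
  have "deriv exp = (exp :: 'b \<Rightarrow> 'b)"
    by (rule ext, rule DERIV_imp_deriv) (rule DERIV_exp)
  then show ?thesis by (induction k) simp_all
qed

lemma exp_action_eq: "exp_action \<delta> E W x y = (\<Sum>k\<le>CARD('v + 'v).
    const ((deriv ^^ k) exp (of_real (body (action \<delta> E W x y))) / fact k) *
      soul (action \<delta> E W x y) ^ k)" for \<delta> :: "'v::finite"
  by (simp add: exp_action_def taylor1_def complexify_simps soul_eq exp_of_real higher_deriv_exp)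

lemma susy_closed_exp_action: "susy \<delta> J (exp_action \<delta> E W) (\<lambda>x y. 0)"
proof -
  let ?S = "action \<delta> E W"
  obtain \<omega> where \<omega>: "susy \<delta> J (\<lambda>x y. const (body (complexify (?S x y)))) \<omega>" "\<And>x y. body (\<omega> x y) = 0"
    using susy_body[OF susy_closed_action[of \<delta> J E W]] by blast
  have "susy \<delta> J (\<lambda>x y. soul (?S x y)) (\<lambda>x y. - \<omega> x y)"
    by (rule susy_cong[OF susy_diff[OF susy_closed_action \<omega>(1)]]) (simp_all add: soul_eq)
  from susy_closed_taylor[OF \<omega> _ this, of exp] show ?thesis
    by (simp add: exp_action_eq[abs_def] holomorphic_on_exp even_soul even_action)
qed

lemma even_taylor_sum: "even_elt n \<Longrightarrow> even_elt (\<Sum>k\<le>N. const (c k) * n ^ k)"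
  by (intro even_elt_intros) simp_all

lemma even_exp_action: "even_elt (exp_action \<delta> E W x y)"
  by (simp add: exp_action_eq even_taylor_sum even_soul even_action)

definition theta_xz :: "'v::finite \<Rightarrow> ('v \<Rightarrow> real) \<Rightarrow> ('v, real) superfunction" where
  "theta_xz \<delta> \<theta> x y = (\<Sum>i\<in>UNIV. const (\<theta> i) * (coord \<delta> x i + zcoord \<delta> i x y))"

definition theta_y :: "'v::finite \<Rightarrow> ('v \<Rightarrow> real) \<Rightarrow> ('v \<Rightarrow> real) \<Rightarrow> real" where
  "theta_y \<delta> \<theta> y = (\<Sum>i\<in>UNIV - {\<delta>}. \<theta> i * y i)"

lemma even_theta_xz: "even_elt (theta_xz \<delta> \<theta> x y)"
  unfolding theta_xz_def by (intro even_elt_intros) simp_all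

lemma const_theta_y: "(\<Sum>i\<in>UNIV. const (\<theta> i) * coord \<delta> y i) = const (theta_y \<delta> \<theta> y)"
proof -
  have const_sum: "const (sum g I) = (\<Sum>i\<in>I. const (g i))" for g :: "'a \<Rightarrow> real" and I
    by (induction I rule: infinite_finite_induct) (simp_all add: const_0 const_add)
  have "(\<Sum>i\<in>UNIV. const (\<theta> i) * coord \<delta> y i) = (\<Sum>i\<in>UNIV - {\<delta>}. const (\<theta> i) * coord \<delta> y i)"
    by (rule sum.mono_neutral_right) (auto simp: coord_def)
  also have "\<dots> = const (theta_y \<delta> \<theta> y)"
    unfolding theta_y_def const_sum by (rule sum.cong) (auto simp: coord_def const_mult)
  finally show ?thesis .
qed

text \<open>
  The Taylor expansion of \<open>H(\<langle>\<theta>, x + z\<rangle> + J \<langle>\<theta>, y\<rangle>)\<close>, in which only \<open>\<langle>\<theta>, x + z\<rangle>\<close> has a nilpotent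
  part.
\<close>

definition holomorphic_observable :: "'v::finite \<Rightarrow> complex \<Rightarrow> (complex \<Rightarrow> complex) \<Rightarrow> ('v \<Rightarrow> real) \<Rightarrow>
    ('v, complex) superfunction" where
  "holomorphic_observable \<delta> J H \<theta> x y = (\<Sum>k\<le>CARD('v + 'v).
     const ((deriv ^^ k) H (of_real (body (theta_xz \<delta> \<theta> x y)) + J * of_real (theta_y \<delta> \<theta> y)) / fact k) *
       soul (theta_xz \<delta> \<theta> x y) ^ k)"

text \<open>
  The supercharge sends \<open>\<langle>\<theta>, x + z\<rangle>\<close> to \<open>\<Sum>\<^sub>i \<theta>\<^sub>i \<xi>\<^sub>i\<close> and \<open>\<langle>\<theta>, y\<rangle>\<close> to \<open>J\<close> times the same element, so it
  annihilates \<open>\<langle>\<theta>, x + z\<rangle> + J \<langle>\<theta>, y\<rangle>\<close> precisely because \<open>J\<^sup>2 = - 1\<close>.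
\<close>

lemma susy_closed_holomorphic_observable:
  assumes J: "J * J = - 1" and H: "H holomorphic_on UNIV"
  shows "susy \<delta> J (holomorphic_observable \<delta> J H \<theta>) (\<lambda>x y. 0)"
proof -
  let ?A = "\<lambda>x y. theta_xz \<delta> \<theta> x y"
  let ?\<Theta> = "\<Sum>i\<in>UNIV. const (of_real (\<theta> i)) * complexify (xi \<delta> i)"
  have A: "susy \<delta> J (\<lambda>x y. complexify (?A x y)) (\<lambda>x y. ?\<Theta>)"
  proof -
    have "susy \<delta> J (\<lambda>x y. \<Sum>i\<in>UNIV. const (of_real (\<theta> i)) *
        (complexify (coord \<delta> x i) + complexify (zcoord \<delta> i x y)))
      (\<lambda>x y. \<Sum>i\<in>UNIV. const (of_real (\<theta> i)) * (complexify (xi \<delta> i) + 0))"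
      by (intro susy_sum susy_const_mult susy_add susy_coord susy_closed_zcoord)
    then show ?thesis by (rule susy_cong) (simp_all add: theta_xz_def complexify_simps)
  qed
  have B: "susy \<delta> J (\<lambda>x y. const (of_real (theta_y \<delta> \<theta> y))) (\<lambda>x y. const J * ?\<Theta>)"
  proof -
    have "susy \<delta> J (\<lambda>x y. \<Sum>i\<in>UNIV. const (of_real (\<theta> i)) * complexify (coord \<delta> y i))
      (\<lambda>x y. \<Sum>i\<in>UNIV. const (of_real (\<theta> i)) * (const J * complexify (xi \<delta> i)))"
      by (intro susy_sum susy_const_mult susy_coord)
    then show ?thesis
    proof (rule susy_cong)
      fix x y :: "'a \<Rightarrow> real"
      show "(\<Sum>i\<in>UNIV. const (complex_of_real (\<theta> i)) * complexify (coord \<delta> y i)) =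
          const (of_real (theta_y \<delta> \<theta> y))"
        using arg_cong[OF const_theta_y[of \<theta> \<delta> y], of complexify] by (simp add: complexify_simps)
      show "(\<Sum>i\<in>UNIV. const (complex_of_real (\<theta> i)) * (const J * complexify (xi \<delta> i))) = const J * ?\<Theta>"
        unfolding sum_distrib_left
        by (intro sum.cong refl grassmann_eqI) simp
    qed
  qed
  obtain \<omega> where \<omega>: "susy \<delta> J (\<lambda>x y. const (body (complexify (?A x y)))) \<omega>" "\<And>x y. body (\<omega> x y) = 0"
    using susy_body[OF A] by blast
  note JJ = const_imaginary_unit_twice[OF J]
  have u: "susy \<delta> J (\<lambda>x y. const (of_real (body (?A x y)) + J * of_real (theta_y \<delta> \<theta> y)))
      (\<lambda>x y. \<omega> x y - ?\<Theta>)"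
    by (rule susy_cong[OF susy_add[OF \<omega>(1) susy_const_mult[OF B, of J]]])
      (simp_all add: const_add const_mult JJ)
  have n: "susy \<delta> J (\<lambda>x y. soul (?A x y)) (\<lambda>x y. - (\<omega> x y - ?\<Theta>))"
    by (rule susy_cong[OF susy_diff[OF A \<omega>(1)]]) (simp_all add: soul_eq)
  have "body (\<omega> x y - ?\<Theta>) = 0" for x y
    using \<omega>(2) by (simp add: body_sum xi_def if_distrib[of complexify] complexify_simps)
      (auto intro!: sum.neutral)
  from susy_closed_taylor[OF u this H n] show ?thesis
    by (simp add: holomorphic_observable_def[abs_def] even_soul even_theta_xz)
qed

lemma even_holomorphic_observable: "even_elt (holomorphic_observable \<delta> J H \<theta> x y)"
  by (simp add: holomorphic_observable_def even_taylor_sum even_soul even_theta_xz)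

lemma theta_observable_eq:
  fixes \<delta> :: "'v::finite"
  assumes "\<And>k a b. (partial1 ^^ k) f (a, b) =
    (deriv ^^ k) H (of_real a + \<i> * of_real b) + (deriv ^^ k) K (of_real a + - \<i> * of_real b)"
  shows "theta_observable \<delta> f \<theta> x y =
    holomorphic_observable \<delta> \<i> H \<theta> x y + holomorphic_observable \<delta> (- \<i>) K \<theta> x y"
proof -
  let ?A = "theta_xz \<delta> \<theta> x y" and ?b = "theta_y \<delta> \<theta> y"
  have "theta_observable \<delta> f \<theta> x y = (\<Sum>k\<le>CARD('v + 'v). \<Sum>l\<le>CARD('v + 'v).
      if l = 0 then const ((partial1 ^^ k) f (body ?A, ?b) / fact k) * soul ?A ^ k else 0)"
    unfolding theta_observable_def const_theta_y theta_xz_def[symmetric] taylor2_def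
    by (intro sum.cong) (auto simp: complexify_simps soul_eq power_0_left)
  also have "\<dots> = (\<Sum>k\<le>CARD('v + 'v). const ((partial1 ^^ k) f (body ?A, ?b) / fact k) * soul ?A ^ k)"
    by simp
  also have "\<dots> = holomorphic_observable \<delta> \<i> H \<theta> x y + holomorphic_observable \<delta> (- \<i>) K \<theta> x y"
    unfolding holomorphic_observable_def assms
    by (simp add: add_divide_distrib const_add distrib_right sum.distrib)
  finally show ?thesis .
qed

lemma inverse_z_product_eq: "inverse_z_product \<delta> x y =
    prod_list (map (\<lambda>i. complexify (taylor1 inverse (zcoord \<delta> i x y))) (others \<delta>))"
proof -
  interpret comp_fun_commute "\<lambda>i P. taylor1 inverse (zcoord \<delta> i x y) * P"
    by (rule inverse_z_factors_commute)
  have "Finite_Set.fold (\<lambda>i P. taylor1 inverse (zcoord \<delta> i x y) * P) 1 (set vs) =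
      prod_list (map (\<lambda>i. taylor1 inverse (zcoord \<delta> i x y)) vs)" if "distinct vs" for vs
    using that by (induction vs) simp_all
  moreover have "complexify (prod_list Fs) = prod_list (map complexify Fs)" for Fs :: "('a + 'a, real) grassmann list"
    by (induction Fs) (simp_all add: complexify_simps)
  ultimately show ?thesis
    using distinct_others[of \<delta>] by (simp add: inverse_z_product_def comp_def flip: set_others)
qed

lemma susy_closed_inverse_z_product: "susy \<delta> J (inverse_z_product \<delta>) (\<lambda>x y. 0)"
  unfolding inverse_z_product_eq[abs_def]
  by (intro susy_closed_prod_list susy_closed_inverse_zcoord)

lemma even_inverse_z_product: "even_elt (inverse_z_product \<delta> x y)"
  unfolding inverse_z_product_eq by (rule even_elt_prod_list) (auto simp: complexify_inverse_zcoord)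

lemma norm_fermions_le: "norm (fermions \<delta> i :: ('v::finite + 'v, 'c::real_normed_field) grassmann) \<le> 1"
  using norm_mult_ineq[of "gen (Inl i) :: ('v + 'v, 'c) grassmann" "gen (Inr i)"]
  by (simp add: fermions_def)

lemma norm_radial_super_le: "norm (radial_super \<delta> g g' i x y) \<le>
    \<bar>g (radius2 \<delta> i x y)\<bar> + 2 * \<bar>g' (radius2 \<delta> i x y)\<bar>"
proof -
  have "norm (const (complex_of_real (2 * g' (radius2 \<delta> i x y))) * fermions \<delta> i) \<le>
      2 * \<bar>g' (radius2 \<delta> i x y)\<bar> * 1"
    by (rule norm_mult_ineq[THEN order.trans], rule mult_mono) (simp_all add: norm_fermions_le norm_mult)
  then show ?thesis
    unfolding radial_super_def by (intro norm_triangle_ineq[THEN order.trans] add_mono) simp_all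
qed

lemma norm_prod_list_le:
  assumes "\<And>i. i \<in> set is \<Longrightarrow> norm (F i) \<le> C"
  shows "norm (prod_list (map F is) :: 'b::real_normed_algebra_1) \<le> C ^ length is"
  using assms
proof (induction "is")
  case (Cons i "is")
  then have "0 \<le> C" using norm_ge_zero order.trans list.set_intros(1) by meson
  have "norm (F i * prod_list (map F is)) \<le> norm (F i) * norm (prod_list (map F is))"
    by (rule norm_mult_ineq)
  also have "\<dots> \<le> C * C ^ length is" using Cons \<open>0 \<le> C\<close> by (intro mult_mono) auto
  finally show ?case by simp
qed simp

lemma norm_inverse_z_product_le: "norm (inverse_z_product \<delta> x y) \<le> 2 ^ card (UNIV - {\<delta>})"
  unfolding inverse_z_product_eq length_others[symmetric]
proof (rule norm_prod_list_le)
  fix i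
  define s where "s = sqrt (1 + radius2 \<delta> i x y)"
  have s: "s \<ge> 1" by (simp add: s_def)
  have "norm (complexify (taylor1 inverse (zcoord \<delta> i x y))) \<le> \<bar>1 / s\<bar> + 2 * \<bar>- 1 / (2 * s ^ 3)\<bar>"
    unfolding complexify_inverse_zcoord s_def by (rule norm_radial_super_le)
  also have "\<dots> \<le> 1 + 1"
    using s by (intro add_mono) (auto simp: abs_mult field_simps)
  finally show "norm (complexify (taylor1 inverse (zcoord \<delta> i x y))) \<le> 2" by simp
qed

section \<open>Integration over the coordinates\<close>

abbreviation coord_factor :: "'v::finite \<Rightarrow> ('v \<Rightarrow> real) measure" where
  "coord_factor \<delta> \<equiv> PiM (UNIV - {\<delta>}) (\<lambda>_. lborel)"

lemma product_sigma_finite_lborel: "product_sigma_finite (\<lambda>_. lborel :: real measure)"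
  by (simp add: product_sigma_finite_def lborel.sigma_finite_measure_axioms)

lemma sigma_finite_coord_factor: "sigma_finite_measure (coord_factor \<delta>)"
proof -
  interpret product_sigma_finite "\<lambda>_::'a. lborel :: real measure" by (rule product_sigma_finite_lborel)
  show ?thesis by (rule sigma_finite) simp
qed

lemma pair_sigma_finite_coord: "pair_sigma_finite (coord_factor \<delta>) (coord_factor \<delta>)"
  by (simp add: pair_sigma_finite_def sigma_finite_coord_factor)

lemma space_coord_factor: "space (coord_factor \<delta>) = PiE (UNIV - {\<delta>}) (\<lambda>_. UNIV)"
  by (simp add: space_PiM)

lemma space_coord_measure: "space (coord_measure \<delta>) = space (coord_factor \<delta>) \<times> space (coord_factor \<delta>)"
  by (simp add: coord_measure_def space_pair_measure)

lemma coord_factor_at: "x \<in> space (coord_factor \<delta>) \<Longrightarrow> x \<delta> = undefined"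
  by (simp add: space_coord_factor PiE_def extensional_def)

text \<open>
  In the product space the coordinate at \<open>\<delta>\<close> is the constant \<open>undefined\<close>; with this value, points of
  the product space are evaluated by functions on the whole product.
\<close>

lemma measurable_coord_factor: "(\<lambda>x. x) \<in> borel_measurable (coord_factor \<delta>)"
proof (rule measurable_coordinatewise_then_product)
  fix i
  show "(\<lambda>x. x i) \<in> borel_measurable (coord_factor \<delta>)"
  proof (cases "i = \<delta>")
    case True
    then show ?thesis
      by (subst measurable_cong[of _ _ "\<lambda>_. undefined"]) (simp_all add: coord_factor_at)
  next
    case False
    then have "(\<lambda>x. x i) \<in> measurable (coord_factor \<delta>) lborel"
      by (intro measurable_component_singleton) simp
    then show ?thesis by simp
  qed
qed

lemma measurable_super:
  fixes h :: "('v::finite \<Rightarrow> real) \<Rightarrow> ('v \<Rightarrow> real) \<Rightarrow> 'b::topological_space"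
  assumes "continuous_super h"
  shows "(\<lambda>p. h (fst p) (snd p)) \<in> borel_measurable (coord_measure \<delta>)"
proof -
  have "(\<lambda>p. (fst p, snd p)) \<in> measurable (coord_measure \<delta>)
      (borel \<Otimes>\<^sub>M borel :: (('v \<Rightarrow> real) \<times> ('v \<Rightarrow> real)) measure)"
    unfolding coord_measure_def
    by (intro measurable_Pair measurable_compose[OF measurable_fst measurable_coord_factor]
        measurable_compose[OF measurable_snd measurable_coord_factor])
  then have "(\<lambda>p. p) \<in> borel_measurable (coord_measure \<delta>)"
    by (simp add: borel_prod)
  moreover have "(\<lambda>p. h (fst p) (snd p)) \<in> borel_measurable borel"
    using assms unfolding continuous_super_def by (rule borel_measurable_continuous_onI)
  ultimately show ?thesis by (rule measurable_compose)
qed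

lemma bounded_on_box:
  fixes h :: "('v::finite \<Rightarrow> real) \<Rightarrow> ('v \<Rightarrow> real) \<Rightarrow> 'b::real_normed_vector"
  assumes "continuous_super h"
  obtains C where "C \<ge> 0" "\<And>x y. x \<in> space (coord_factor \<delta>) \<Longrightarrow> y \<in> space (coord_factor \<delta>) \<Longrightarrow>
    (\<And>i. i \<noteq> \<delta> \<Longrightarrow> \<bar>x i\<bar> \<le> L \<and> \<bar>y i\<bar> \<le> L) \<Longrightarrow> norm (h x y) \<le> C"
proof -
  \<comment> \<open>The coordinate at \<open>\<delta>\<close> has the value \<open>undefined\<close>, which the compact box has to contain.\<close>
  define M where "M = max L \<bar>undefined\<bar>"
  define K where "K = (PiE UNIV (\<lambda>_. {- M..M}) :: ('v \<Rightarrow> real) set)"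
  have "compactin (product_topology (\<lambda>_. euclidean) UNIV) K"
    by (simp add: K_def compactin_PiE)
  then have "compact K" by (simp add: euclidean_product_topology)
  then have "compact ((\<lambda>p. h (fst p) (snd p)) ` (K \<times> K))"
    using assms unfolding continuous_super_def
    by (intro compact_continuous_image compact_Times) (auto intro: continuous_on_subset)
  then have "bounded ((\<lambda>p. h (fst p) (snd p)) ` (K \<times> K))" by (rule compact_imp_bounded)
  then obtain C where C: "\<And>v. v \<in> (\<lambda>p. h (fst p) (snd p)) ` (K \<times> K) \<Longrightarrow> norm v \<le> C"
    unfolding bounded_iff by blast
  have K: "x \<in> K" if "x \<in> space (coord_factor \<delta>)" "\<And>i. i \<noteq> \<delta> \<Longrightarrow> \<bar>x i\<bar> \<le> L" for x
  proof -
    have "\<bar>x i\<bar> \<le> M" for i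
      using that(2)[of i] coord_factor_at[OF that(1)] by (cases "i = \<delta>") (auto simp: M_def)
    then have "- M \<le> x i \<and> x i \<le> M" for i by (simp add: abs_le_iff minus_le_iff)
    then show ?thesis by (simp add: K_def PiE_iff)
  qed
  show ?thesis
  proof (rule that[of "max C 0"])
    fix x y assume xy: "x \<in> space (coord_factor \<delta>)" "y \<in> space (coord_factor \<delta>)"
      "\<And>i. i \<noteq> \<delta> \<Longrightarrow> \<bar>x i\<bar> \<le> L \<and> \<bar>y i\<bar> \<le> L"
    have "x \<in> K" "y \<in> K" using K xy by blast+
    then have "norm (h x y) \<le> C" by (intro C image_eqI[of _ _ "(x, y)"]) simp_all
    then show "norm (h x y) \<le> max C 0" by simp
  qed simp
qed

definition supported_in :: "'v \<Rightarrow> real \<Rightarrow> (('v \<Rightarrow> real) \<Rightarrow> ('v \<Rightarrow> real) \<Rightarrow> 'b::zero) \<Rightarrow> bool" where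
  "supported_in \<delta> L h \<longleftrightarrow> (\<forall>x y. (\<exists>i. i \<noteq> \<delta> \<and> (L < \<bar>x i\<bar> \<or> L < \<bar>y i\<bar>)) \<longrightarrow> h x y = 0)"

lemma supported_in_mult_right:
  fixes h :: "('v \<Rightarrow> real) \<Rightarrow> ('v \<Rightarrow> real) \<Rightarrow> 'b::mult_zero"
  shows "supported_in \<delta> L h \<Longrightarrow> supported_in \<delta> L (\<lambda>x y. h x y * k x y)"
  by (auto simp: supported_in_def)

lemma bounded_supported:
  fixes h :: "('v::finite \<Rightarrow> real) \<Rightarrow> ('v \<Rightarrow> real) \<Rightarrow> 'b::real_normed_vector"
  assumes "continuous_super h" "supported_in \<delta> L h"
  obtains C where "C \<ge> 0" "\<And>x y. x \<in> space (coord_factor \<delta>) \<Longrightarrow> y \<in> space (coord_factor \<delta>) \<Longrightarrow>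
    norm (h x y) \<le> C"
proof -
  obtain C where C: "C \<ge> 0" "\<And>x y. x \<in> space (coord_factor \<delta>) \<Longrightarrow> y \<in> space (coord_factor \<delta>) \<Longrightarrow>
      (\<And>i. i \<noteq> \<delta> \<Longrightarrow> \<bar>x i\<bar> \<le> L \<and> \<bar>y i\<bar> \<le> L) \<Longrightarrow> norm (h x y) \<le> C"
    using bounded_on_box[OF assms(1)] by blast
  show ?thesis
  proof (rule that[OF C(1)])
    fix x y assume "x \<in> space (coord_factor \<delta>)" "y \<in> space (coord_factor \<delta>)"
    then show "norm (h x y) \<le> C"
      using C assms(2) unfolding supported_in_def by (metis norm_zero not_le)
  qed
qed

lemma integrable_supported:
  fixes h :: "('v::finite \<Rightarrow> real) \<Rightarrow> ('v \<Rightarrow> real) \<Rightarrow> 'b::{banach, second_countable_topology}"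
  assumes h: "continuous_super h" "supported_in \<delta> L h"
  shows "integrable (coord_measure \<delta>) (\<lambda>p. h (fst p) (snd p))"
proof -
  interpret product_sigma_finite "\<lambda>_::'v. lborel :: real measure" by (rule product_sigma_finite_lborel)
  interpret pair_sigma_finite "coord_factor \<delta>" "coord_factor \<delta>" by (rule pair_sigma_finite_coord)
  obtain C where C: "C \<ge> 0" "\<And>x y. x \<in> space (coord_factor \<delta>) \<Longrightarrow> y \<in> space (coord_factor \<delta>) \<Longrightarrow>
      norm (h x y) \<le> C"
    using bounded_supported[OF h] by blast
  define B where "B = (PiE (UNIV - {\<delta>}) (\<lambda>_. {- L..L}) :: ('v \<Rightarrow> real) set)"
  have B: "B \<in> sets (coord_factor \<delta>)" unfolding B_def by (intro sets_PiM_I_finite) auto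
  have "emeasure (coord_factor \<delta>) B = (\<Prod>i\<in>UNIV - {\<delta>}. emeasure lborel {- L..L})"
    unfolding B_def by (intro emeasure_PiM) auto
  also have "\<dots> < \<infinity>"
    by (simp only: infinity_ennreal_def less_top[symmetric] ennreal_prod_eq_top)
      (simp add: emeasure_lborel_Icc_eq)
  finally have "emeasure (coord_measure \<delta>) (B \<times> B) < \<infinity>"
    using B by (simp add: coord_measure_def ennreal_mult_less_top
        sigma_finite_measure.emeasure_pair_measure_Times[OF sigma_finite_coord_factor])
  moreover have BB: "B \<times> B \<in> sets (coord_measure \<delta>)"
    using B by (simp add: coord_measure_def)
  ultimately have "integrable (coord_measure \<delta>) (\<lambda>p. C * indicator (B \<times> B) p :: real)"
    by (intro integrable_mult_right) (simp add: integrable_indicator_iff)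
  then show ?thesis
  proof (rule Bochner_Integration.integrable_bound)
    show "AE p in coord_measure \<delta>. norm (h (fst p) (snd p)) \<le> norm (C * indicator (B \<times> B) p :: real)"
    proof (rule AE_I2)
      fix p assume p: "p \<in> space (coord_measure \<delta>)"
      show "norm (h (fst p) (snd p)) \<le> norm (C * indicator (B \<times> B) p :: real)"
      proof (cases "p \<in> B \<times> B")
        case True
        then show ?thesis using p C by (cases p) (auto simp: space_coord_measure)
      next
        case False
        obtain x y where xy: "p = (x, y)" by (cases p)
        have "\<exists>i. i \<noteq> \<delta> \<and> (L < \<bar>x i\<bar> \<or> L < \<bar>y i\<bar>)"
        proof (rule ccontr)
          assume "\<not> ?thesis"
          then have le: "\<bar>x i\<bar> \<le> L" "\<bar>y i\<bar> \<le> L" if "i \<noteq> \<delta>" for i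
            using that not_less by blast+
          have "- L \<le> x i \<and> x i \<le> L" "- L \<le> y i \<and> y i \<le> L" if "i \<noteq> \<delta>" for i
            using le[OF that] by linarith+
          then have "x \<in> B" "y \<in> B"
            using p by (simp_all add: B_def xy space_coord_measure space_coord_factor PiE_iff)
          then show False using False by (simp add: xy)
        qed
        then have "h x y = 0" using h(2) by (simp add: supported_in_def)
        then show ?thesis by (simp add: xy)
      qed
    qed
  qed (rule measurable_super[OF h(1)])
qed

lemma line_integral_eq_0:
  fixes F F' :: "real \<Rightarrow> complex"
  assumes F: "\<And>t. (F has_vector_derivative F' t) (at t)" and F': "continuous_on UNIV F'"
    and L: "\<And>t. L < \<bar>t\<bar> \<Longrightarrow> F t = 0"
  shows "(\<integral>t. F' t \<partial>lborel) = 0"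
proof -
  define M where "M = max L 0 + 1"
  have "F' t = 0" if "L < \<bar>t\<bar>" for t
  proof -
    have "open {t::real. L < \<bar>t\<bar>}" by (intro open_Collect_less continuous_intros)
    then have "((\<lambda>t. 0) has_vector_derivative F' t) (at t)"
      using has_vector_derivative_transform_within_open[OF F[of t], of "{t. L < \<bar>t\<bar>}" "\<lambda>t. 0"] L that
      by simp
    then show ?thesis using vector_derivative_unique_at has_vector_derivative_const by blast
  qed
  then have "(\<integral>t. F' t \<partial>lborel) = (\<integral>t. indicator {- M..M} t *\<^sub>R F' t \<partial>lborel)"
    by (intro Bochner_Integration.integral_cong refl) (auto simp: indicator_def M_def)
  also have "\<dots> = F M - F (- M)"
  proof (rule integral_FTC_atLeastAtMost)
    show "continuous_on {- M..M} F'" using F' continuous_on_subset by blast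
  qed (auto simp: M_def intro: has_vector_derivative_at_within F)
  also have "\<dots> = 0" by (simp add: L M_def)
  finally show ?thesis .
qed

lemma continuous_super_update:
  fixes h :: "('v \<Rightarrow> real) \<Rightarrow> ('v \<Rightarrow> real) \<Rightarrow> 'b::topological_space"
  assumes "continuous_super h"
  shows "continuous_on UNIV (\<lambda>t. h (x(j := t)) y)" "continuous_on UNIV (\<lambda>t. h x (y(j := t)))"
proof -
  have update: "continuous_on UNIV (\<lambda>t. x(j := t :: real))" for x :: "'v \<Rightarrow> real"
  proof (rule continuous_on_coordinatewise_then_product)
    show "continuous_on UNIV (\<lambda>t. (x(j := t)) i)" for i by (cases "i = j") auto
  qed
  show "continuous_on UNIV (\<lambda>t. h (x(j := t)) y)" "continuous_on UNIV (\<lambda>t. h x (y(j := t)))"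
    using continuous_on_compose2[OF assms[unfolded continuous_super_def], of UNIV "\<lambda>t. (x(j := t), y)"]
      continuous_on_compose2[OF assms[unfolded continuous_super_def], of UNIV "\<lambda>t. (x, y(j := t))"]
    by (simp_all add: continuous_on_Pair update)
qed

lemma supported_in_partials:
  fixes g :: "('v \<Rightarrow> real) \<Rightarrow> ('v \<Rightarrow> real) \<Rightarrow> complex"
  assumes D: "has_partials \<delta> g gx gy" and supp: "supported_in \<delta> L g" and j: "j \<noteq> \<delta>"
  shows "supported_in \<delta> L (gx j)" "supported_in \<delta> L (gy j)"
proof -
  have unique: "d = 0" if "((\<lambda>t. k t) has_vector_derivative d) (at s)" "open S" "s \<in> S"
    "\<And>t. t \<in> S \<Longrightarrow> k t = 0" for k :: "real \<Rightarrow> complex" and d s S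
  proof -
    have "((\<lambda>t. 0) has_vector_derivative d) (at s)"
      using has_vector_derivative_transform_within_open[OF that(1-3), of "\<lambda>t. 0"] that(4) by simp
    then show ?thesis using vector_derivative_unique_at has_vector_derivative_const by blast
  qed
  have zero: "g x y = 0" if "i \<noteq> \<delta>" "L < \<bar>x i\<bar> \<or> L < \<bar>y i\<bar>" for x y i
    using supp that unfolding supported_in_def by blast
  have "gx j x y = 0 \<and> gy j x y = 0" if i: "i \<noteq> \<delta>" "L < \<bar>x i\<bar> \<or> L < \<bar>y i\<bar>" for x y i
  proof
    have ray: "open {t::real. L < \<bar>t\<bar>}" by (intro open_Collect_less continuous_intros)
    have dx: "((\<lambda>t. g (x(j := t)) y) has_vector_derivative gx j x y) (at (x j))"
      and dy: "((\<lambda>t. g x (y(j := t))) has_vector_derivative gy j x y) (at (y j))"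
      using D j by (simp_all add: has_partials_def)
    show "gx j x y = 0"
    proof (cases "i = j \<and> L < \<bar>x i\<bar>")
      case True
      then show ?thesis
        using j by (intro unique[OF dx ray]) (auto intro: zero[of j])
    next
      case False
      then show ?thesis
        using i by (intro unique[OF dx open_UNIV] zero[of i]) auto
    qed
    show "gy j x y = 0"
    proof (cases "i = j \<and> L < \<bar>y i\<bar>")
      case True
      then show ?thesis
        using j by (intro unique[OF dy ray]) (auto intro: zero[of j])
    next
      case False
      then show ?thesis
        using i by (intro unique[OF dy open_UNIV] zero[of i]) auto
    qed
  qed
  then show "supported_in \<delta> L (gx j)" "supported_in \<delta> L (gy j)"
    by (auto simp: supported_in_def)
qed

lemma integral_partial_eq_0:
  fixes g :: "('v::finite \<Rightarrow> real) \<Rightarrow> ('v \<Rightarrow> real) \<Rightarrow> complex"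
  assumes D: "has_partials \<delta> g gx gy" and supp: "supported_in \<delta> L g" and j: "j \<noteq> \<delta>"
  shows "(\<integral>p. gx j (fst p) (snd p) \<partial>coord_measure \<delta>) = 0"
    and "(\<integral>p. gy j (fst p) (snd p) \<partial>coord_measure \<delta>) = 0"
proof -
  interpret product_sigma_finite "\<lambda>_::'v. lborel :: real measure" by (rule product_sigma_finite_lborel)
  interpret pair_sigma_finite "coord_factor \<delta>" "coord_factor \<delta>" by (rule pair_sigma_finite_coord)
  have zero: "g x y = 0" if "i \<noteq> \<delta>" "L < \<bar>x i\<bar> \<or> L < \<bar>y i\<bar>" for x y i
    using supp that unfolding supported_in_def by blast
  have cont: "continuous_super (gx j)" "continuous_super (gy j)"
    using D j by (simp_all add: has_partials_def)
  have factor: "(\<integral>x. k x \<partial>coord_factor \<delta>) = 0"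
    if "\<And>x. (\<integral>t. k (x(j := t)) \<partial>lborel) = 0" for k :: "('v \<Rightarrow> real) \<Rightarrow> complex"
  proof (cases "integrable (coord_factor \<delta>) k")
    case True
    have ins: "insert j (UNIV - {\<delta>} - {j}) = UNIV - {\<delta>}" using j by auto
    show ?thesis
      using product_integral_insert[of "UNIV - {\<delta>} - {j}" j k, unfolded ins] True
      by (simp add: that)
  qed (rule not_integrable_integral_eq)
  have "(\<integral>t. gx j (x(j := t)) y \<partial>lborel) = 0" for x y
  proof (rule line_integral_eq_0)
    show "((\<lambda>t. g (x(j := t)) y) has_vector_derivative gx j (x(j := t)) y) (at t)" for t
    proof -
      have "((\<lambda>s. g (x(j := t, j := s)) y) has_vector_derivative gx j (x(j := t)) y) (at ((x(j := t)) j))"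
        using D j unfolding has_partials_def by blast
      then show ?thesis by simp
    qed
    show "g (x(j := t)) y = 0" if "L < \<bar>t\<bar>" for t
      using zero[of j "x(j := t)" y] j that by simp
  qed (rule continuous_super_update[OF cont(1)])
  then have "(\<integral>x. gx j x y \<partial>coord_factor \<delta>) = 0" for y
    by (intro factor) simp
  then show "(\<integral>p. gx j (fst p) (snd p) \<partial>coord_measure \<delta>) = 0"
    using integral_snd[of "gx j"] integrable_supported[OF cont(1) supported_in_partials(1)[OF D supp j]]
    by (simp add: coord_measure_def case_prod_unfold)
  have "(\<integral>t. gy j x (y(j := t)) \<partial>lborel) = 0" for x y
  proof (rule line_integral_eq_0)
    show "((\<lambda>t. g x (y(j := t))) has_vector_derivative gy j x (y(j := t))) (at t)" for t
    proof -
      have "((\<lambda>s. g x (y(j := t, j := s))) has_vector_derivative gy j x (y(j := t))) (at ((y(j := t)) j))"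
        using D j unfolding has_partials_def by blast
      then show ?thesis by simp
    qed
    show "g x (y(j := t)) = 0" if "L < \<bar>t\<bar>" for t
      using zero[of j x "y(j := t)"] j that by simp
  qed (rule continuous_super_update[OF cont(2)])
  then have "(\<integral>y. gy j x y \<partial>coord_factor \<delta>) = 0" for x
    by (intro factor) simp
  then show "(\<integral>p. gy j (fst p) (snd p) \<partial>coord_measure \<delta>) = 0"
    using integral_fst[of "gy j"] integrable_supported[OF cont(2) supported_in_partials(2)[OF D supp j]]
    by (simp add: coord_measure_def case_prod_unfold)
qed

lemma berezin_sum: "berezin \<delta> (sum F I) = (\<Sum>i\<in>I. berezin \<delta> (F i))"
proof (induction I rule: infinite_finite_induct)
  case empty
  show ?case using berezin_const_times[of \<delta> 0] by (simp add: const_0)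
next
  case (infinite I)
  then show ?case using berezin_const_times[of \<delta> 0] by (simp add: const_0)
qed (simp add: berezin_add)

text \<open>
  Stokes' theorem for the supercharge: after multiplication by \<open>\<xi>\<^sub>j\<close> and Berezin integration, the partial
  derivatives are derivatives of compactly supported functions, and a Grassmann derivative has no top
  coefficient.
\<close>

lemma integral_susy_exact:
  fixes \<delta> :: "'v::finite"
  assumes C: "susy \<delta> J C G" and supp: "supported_in \<delta> L C"
  shows "(\<integral>p. berezin \<delta> (G (fst p) (snd p)) \<partial>coord_measure \<delta>) = 0"
proof -
  obtain DX DY where D: "has_partials \<delta> C DX DY"
    and G: "\<And>x y. G x y = (\<Sum>j\<in>UNIV - {\<delta>}. gen (Inl j) * (DX j x y + const J * DY j x y) +
        const (of_real (x j) + J * of_real (y j)) * grassmann_deriv (Inr j) (C x y))"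
    using C unfolding susy_def by blast
  let ?T = "\<lambda>j F. berezin \<delta> (gen (Inl j) * F) :: complex"
  have T: "bounded_linear (?T j)" for j
    by (rule bounded_linear_compose[OF bounded_linear_berezin bounded_linear_mult_right])
  have D': "has_partials \<delta> (\<lambda>x y. ?T j (C x y)) (\<lambda>k x y. ?T j (DX k x y)) (\<lambda>k x y. ?T j (DY k x y))" for j
    by (rule has_partials_bounded_linear[OF T D])
  have supp': "supported_in \<delta> L (\<lambda>x y. ?T j (C x y))" for j
    using supp linear_0[OF bounded_linear.linear[OF T[of j]]] by (auto simp: supported_in_def)
  have "berezin \<delta> (G x y) = (\<Sum>j\<in>UNIV - {\<delta>}. ?T j (DX j x y) + J * ?T j (DY j x y))" for x y
  proof -
    have "gen (Inl j) * (DX j x y + const J * DY j x y) =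
        gen (Inl j) * DX j x y + const J * (gen (Inl j) * DY j x y)" for j
      by (simp only: distrib_left mult.assoc[symmetric] const_times_commute[of "gen _"])
    then show ?thesis
      unfolding G berezin_sum
      by (intro sum.cong) (auto simp: berezin_add berezin_const_times berezin_grassmann_deriv)
  qed
  moreover have "integrable (coord_measure \<delta>) (\<lambda>p. ?T j (DX j (fst p) (snd p)))"
    "integrable (coord_measure \<delta>) (\<lambda>p. ?T j (DY j (fst p) (snd p)))" if "j \<noteq> \<delta>" for j
    using D'[of j] that supported_in_partials[OF D' supp' that]
    by (auto simp: has_partials_def intro!: integrable_supported)
  ultimately show ?thesis
    using integral_partial_eq_0[OF D' supp'] by simp
qed

section \<open>Localization\<close>

text \<open>
  The quotient \<open>(1 - exp (- t s)) / s\<close> as an everywhere convergent power series, which makes it smooth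
  at \<open>0\<close> without a case distinction.
\<close>

lemma gaussian_primitive:
  fixes t :: real
  obtains \<psi> \<psi>' where "\<And>s. (\<psi> has_real_derivative \<psi>' s) (at s)" "continuous_on UNIV \<psi>'"
    "\<And>s. s * \<psi> s = 1 - exp (- t * s)"
proof -
  define c where "c k = - ((- t) ^ Suc k / fact (Suc k))" for k
  have summable: "summable (\<lambda>k. c k * s ^ k)" for s
  proof (rule summable_comparison_test')
    show "summable (\<lambda>k. \<bar>t\<bar> * (\<bar>t * s\<bar> ^ k /\<^sub>R fact k))"
      by (intro summable_mult summable_exp_generic)
    fix k :: nat
    have "(fact k :: real) \<le> fact (Suc k)" by (rule fact_mono) simp
    then have "\<bar>t\<bar> * \<bar>t * s\<bar> ^ k / fact (Suc k) \<le> \<bar>t\<bar> * \<bar>t * s\<bar> ^ k / fact k"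
      by (intro divide_left_mono) (simp_all del: fact_Suc)
    then show "norm (c k * s ^ k) \<le> \<bar>t\<bar> * (\<bar>t * s\<bar> ^ k /\<^sub>R fact k)"
      by (simp add: c_def abs_mult power_abs power_mult_distrib field_simps del: fact_Suc)
  qed
  have deriv: "((\<lambda>s. \<Sum>k. c k * s ^ k) has_real_derivative (\<Sum>k. diffs c k * s ^ k)) (at s)" for s
    by (rule termdiffs_strong_converges_everywhere[OF summable])
  have "((\<lambda>s. \<Sum>k. diffs c k * s ^ k) has_real_derivative (\<Sum>k. diffs (diffs c) k * s ^ k)) (at s)" for s
    by (rule termdiffs_strong_converges_everywhere[OF termdiff_converges_all[OF summable]])
  then have "continuous_on UNIV (\<lambda>s. \<Sum>k. diffs c k * s ^ k)"
    by (intro continuous_at_imp_continuous_on ballI) (auto intro: DERIV_isCont)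
  moreover have "s * (\<Sum>k. c k * s ^ k) = 1 - exp (- t * s)" for s
  proof -
    have "(\<lambda>k. (- t * s) ^ k /\<^sub>R fact k) sums exp (- t * s)" by (rule exp_converges)
    then have "(\<lambda>k. (- t * s) ^ Suc k /\<^sub>R fact (Suc k)) sums (exp (- t * s) - 1)"
      by (subst sums_Suc_iff) simp
    then have s1: "(\<lambda>k. - ((- t * s) ^ Suc k /\<^sub>R fact (Suc k))) sums (1 - exp (- t * s))"
      using sums_minus by fastforce
    have e: "- ((- t * s) ^ Suc k /\<^sub>R fact (Suc k)) = s * (c k * s ^ k)" for k
    proof -
      have "(- t * s) ^ Suc k = (- t) ^ Suc k * s ^ Suc k" by (simp only: power_mult_distrib)
      then show ?thesis by (simp only: c_def) (simp add: field_simps del: fact_Suc)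
    qed
    have s2: "(\<lambda>k. s * (c k * s ^ k)) sums (s * (\<Sum>k. c k * s ^ k))"
      by (intro sums_mult summable_sums summable)
    show ?thesis by (rule sums_unique2[OF s2 s1[unfolded e]])
  qed
  ultimately show ?thesis by (rule that[OF deriv])
qed

abbreviation gaussian_super :: "'v::finite \<Rightarrow> real \<Rightarrow> 'v \<Rightarrow> ('v, complex) superfunction" where
  "gaussian_super \<delta> t \<equiv> radial_super \<delta> (\<lambda>s. exp (- t * s)) (\<lambda>s. - t * exp (- t * s))"

lemma susy_closed_gaussian: "susy \<delta> J (gaussian_super \<delta> t i) (\<lambda>x y. 0)"
  by (rule susy_closed_radial[where g'' = "\<lambda>s. t * t * exp (- t * s)"])
    (auto intro!: derivative_eq_intros continuous_intros)

lemma susy_continuous: "susy \<delta> J F G \<Longrightarrow> continuous_super F"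
  unfolding susy_def has_partials_def by blast

lemma continuous_berezin: "continuous_super F \<Longrightarrow> continuous_super (\<lambda>x y. berezin \<delta> (F x y))"
  for F :: "('v::finite, complex) superfunction"
  by (rule continuous_super_bounded_linear[OF bounded_linear_berezin])

lemma berezin_0 [simp]: "berezin \<delta> 0 = (0 :: 'c::comm_ring_1)"
  using berezin_const_times[of \<delta> "0 :: 'c" 0] by (simp add: const_0)

lemma berezin_diff: "berezin \<delta> (F - G) = berezin \<delta> F - berezin \<delta> G"
  using berezin_add[of \<delta> "F - G" G] by simp

lemma integrable_berezin:
  assumes "continuous_super B" "supported_in \<delta> L B"
  shows "integrable (coord_measure \<delta>) (\<lambda>p. berezin \<delta> (B (fst p) (snd p)) :: complex)"
  by (rule integrable_supported[of "\<lambda>x y. berezin \<delta> (B x y)" _ L])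
    (use assms in \<open>auto simp: supported_in_def intro: continuous_berezin\<close>)

text \<open>
  The function \<open>1 - exp (- t N\<^sub>i)\<close> vanishes at \<open>N\<^sub>i = 0\<close>, hence it is exact, and so is its product with the
  closed superfunction \<open>B\<close>.
\<close>

lemma integral_times_gaussian:
  assumes J: "J * J = - 1" and B: "susy \<delta> J B (\<lambda>x y. 0)" "\<And>x y. even_elt (B x y)" "supported_in \<delta> L B"
  shows "(\<integral>p. berezin \<delta> (B (fst p) (snd p) * gaussian_super \<delta> t i (fst p) (snd p)) \<partial>coord_measure \<delta>) =
    (\<integral>p. berezin \<delta> (B (fst p) (snd p)) \<partial>coord_measure \<delta>)"
proof -
  obtain \<psi> \<psi>' where \<psi>: "\<And>s. (\<psi> has_real_derivative \<psi>' s) (at s)" "continuous_on UNIV \<psi>'"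
    "\<And>s. s * \<psi> s = 1 - exp (- t * s)"
    using gaussian_primitive by blast
  have "\<psi> s + s * \<psi>' s = t * exp (- t * s)" for s
  proof (rule DERIV_unique)
    show "((\<lambda>s. s * \<psi> s) has_real_derivative \<psi> s + s * \<psi>' s) (at s)"
      using DERIV_mult[OF DERIV_ident \<psi>(1)[of s]] by (simp add: add_ac mult_ac)
    show "((\<lambda>s. s * \<psi> s) has_real_derivative t * exp (- t * s)) (at s)"
      unfolding \<psi>(3) by (auto intro!: derivative_eq_intros)
  qed
  then have N: "radial_super \<delta> (\<lambda>s. s * \<psi> s) (\<lambda>s. \<psi> s + s * \<psi>' s) i x y = 1 - gaussian_super \<delta> t i x y" for x y
    by (simp add: radial_super_def \<psi>(3) const_diff const_1 const_minus)
  define V where "V x y = (complexify (coord \<delta> x i) - const J * complexify (coord \<delta> y i)) *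
      (const (of_real (\<psi> (radius2 \<delta> i x y))) * complexify (eta \<delta> i))" for x y
  have "susy \<delta> J V (radial_super \<delta> (\<lambda>s. s * \<psi> s) (\<lambda>s. \<psi> s + s * \<psi>' s) i)"
    unfolding V_def[abs_def] using \<psi>(1,2) J
    by (intro radial_primitive) (auto intro: continuous_on_subset)
  from susy_mult[OF B(1) this] have "susy \<delta> J (\<lambda>x y. B x y * V x y)
      (\<lambda>x y. B x y - B x y * gaussian_super \<delta> t i x y)"
    by (rule susy_cong) (use B(2) in \<open>simp_all add: N even_elt_def right_diff_distrib\<close>)
  from integral_susy_exact[OF this supported_in_mult_right[OF B(3)]]
  have "(\<integral>p. berezin \<delta> (B (fst p) (snd p)) -
      berezin \<delta> (B (fst p) (snd p) * gaussian_super \<delta> t i (fst p) (snd p)) \<partial>coord_measure \<delta>) = 0"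
    by (simp add: berezin_diff)
  moreover have "integrable (coord_measure \<delta>) (\<lambda>p. berezin \<delta> (B (fst p) (snd p)))"
    by (rule integrable_berezin[OF susy_continuous[OF B(1)] B(3)])
  moreover have "integrable (coord_measure \<delta>)
      (\<lambda>p. berezin \<delta> (B (fst p) (snd p) * gaussian_super \<delta> t i (fst p) (snd p)))"
    by (rule integrable_berezin[OF continuous_super_mult[OF susy_continuous[OF B(1)]
          susy_continuous[OF susy_closed_gaussian]] supported_in_mult_right[OF B(3)]])
  ultimately show ?thesis by simp
qed

lemma integral_times_gaussians:
  assumes J: "J * J = - 1" and B: "susy \<delta> J B (\<lambda>x y. 0)" "\<And>x y. even_elt (B x y)" "supported_in \<delta> L B"
  shows "(\<integral>p. berezin \<delta> (B (fst p) (snd p) *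
      prod_list (map (\<lambda>i. gaussian_super \<delta> t i (fst p) (snd p)) is)) \<partial>coord_measure \<delta>) =
    (\<integral>p. berezin \<delta> (B (fst p) (snd p)) \<partial>coord_measure \<delta>)"
  using B
proof (induction "is" arbitrary: B)
  case (Cons i "is")
  have "susy \<delta> J (\<lambda>x y. B x y * gaussian_super \<delta> t i x y) (\<lambda>x y. 0)"
    by (intro susy_closed_mult Cons.prems susy_closed_gaussian)
  from Cons.IH[OF this] integral_times_gaussian[OF J Cons.prems, of t i] Cons.prems
  show ?case by (simp add: mult.assoc even_elt_times supported_in_mult_right)
qed simp

lemma integrable_product:
  fixes f g :: "'a \<Rightarrow> real"
  assumes M: "pair_sigma_finite M N" and f: "integrable M f" and g: "integrable N g"
  shows "integrable (M \<Otimes>\<^sub>M N) (\<lambda>p. f (fst p) * g (snd p))"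
    and "(\<integral>p. f (fst p) * g (snd p) \<partial>(M \<Otimes>\<^sub>M N)) = (\<integral>x. f x \<partial>M) * (\<integral>y. g y \<partial>N)"
proof -
  interpret pair_sigma_finite M N by (rule M)
  note [measurable] = borel_measurable_integrable[OF f] borel_measurable_integrable[OF g]
  have "integrable (M \<Otimes>\<^sub>M N) (\<lambda>(x, y). f x * g y)"
  proof (rule Fubini_integrable)
    show "integrable M (\<lambda>x. \<integral>y. norm (case (x, y) of (x, y) \<Rightarrow> f x * g y) \<partial>N)"
      using f by (simp add: abs_mult)
  qed (use g in auto)
  then show "integrable (M \<Otimes>\<^sub>M N) (\<lambda>p. f (fst p) * g (snd p))"
    by (simp add: case_prod_unfold)
  from integral_fst[OF \<open>integrable (M \<Otimes>\<^sub>M N) (\<lambda>(x, y). f x * g y)\<close>]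
  show "(\<integral>p. f (fst p) * g (snd p) \<partial>(M \<Otimes>\<^sub>M N)) = (\<integral>x. f x \<partial>M) * (\<integral>y. g y \<partial>N)"
    by (simp add: case_prod_unfold)
qed

lemma coord_product:
  fixes f :: "real \<Rightarrow> real"
  assumes "integrable lborel f"
  shows "integrable (coord_measure \<delta>) (\<lambda>p. \<Prod>i\<in>UNIV - {\<delta>}. f (fst p i) * f (snd p i))"
    and "(\<integral>p. (\<Prod>i\<in>UNIV - {\<delta>}. f (fst p i) * f (snd p i)) \<partial>coord_measure \<delta>) =
      ((\<integral>t. f t \<partial>lborel)\<^sup>2) ^ card (UNIV - {\<delta>})"
proof -
  interpret product_sigma_finite "\<lambda>_::'a. lborel :: real measure" by (rule product_sigma_finite_lborel)
  have 1: "integrable (coord_factor \<delta>) (\<lambda>x. \<Prod>i\<in>UNIV - {\<delta>}. f (x i))"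
    using assms by (intro product_integrable_prod) auto
  have 2: "(\<integral>x. (\<Prod>i\<in>UNIV - {\<delta>}. f (x i)) \<partial>coord_factor \<delta>) = (\<integral>t. f t \<partial>lborel) ^ card (UNIV - {\<delta>})"
    using assms by (subst product_integral_prod) (auto simp del: card_Diff_insert)
  show "integrable (coord_measure \<delta>) (\<lambda>p. \<Prod>i\<in>UNIV - {\<delta>}. f (fst p i) * f (snd p i))"
    using integrable_product(1)[OF pair_sigma_finite_coord 1 1]
    by (simp add: coord_measure_def prod.distrib)
  show "(\<integral>p. (\<Prod>i\<in>UNIV - {\<delta>}. f (fst p i) * f (snd p i)) \<partial>coord_measure \<delta>) =
      ((\<integral>t. f t \<partial>lborel)\<^sup>2) ^ card (UNIV - {\<delta>})"
    using integrable_product(2)[OF pair_sigma_finite_coord 1 1]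
    unfolding coord_measure_def prod.distrib 2 by (simp only: power2_eq_square power_mult_distrib)
qed

definition total_radius2 :: "'v::finite \<Rightarrow> ('v \<Rightarrow> real) \<Rightarrow> ('v \<Rightarrow> real) \<Rightarrow> real" where
  "total_radius2 \<delta> x y = (\<Sum>i\<in>UNIV - {\<delta>}. (x i)\<^sup>2 + (y i)\<^sup>2)"

text \<open>
  The Gaussian probability density in the \<open>2n\<close> real coordinates with variance \<open>1 / (2 t)\<close>, where \<open>n\<close>
  is the number of vertices other than \<open>\<delta>\<close>.
\<close>

definition heat_kernel :: "'v::finite \<Rightarrow> real \<Rightarrow> ('v \<Rightarrow> real) \<Rightarrow> ('v \<Rightarrow> real) \<Rightarrow> real" where
  "heat_kernel \<delta> t x y = (t / pi) ^ card (UNIV - {\<delta>}) * exp (- t * total_radius2 \<delta> x y)"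

lemma heat_kernel_eq_prod:
  assumes "t > 0"
  shows "heat_kernel \<delta> t x y = (\<Prod>i\<in>UNIV - {\<delta>}.
    normal_density 0 (1 / sqrt (2 * t)) (x i) * normal_density 0 (1 / sqrt (2 * t)) (y i))"
proof -
  have "normal_density 0 (1 / sqrt (2 * t)) a = sqrt (t / pi) * exp (- t * a\<^sup>2)" for a
    using assms by (simp add: normal_density_def power_divide real_sqrt_divide field_simps)
  moreover have "sqrt (t / pi) * exp (- t * a\<^sup>2) * (sqrt (t / pi) * exp (- t * b\<^sup>2)) =
      t / pi * exp (- t * (a\<^sup>2 + b\<^sup>2))" for a b
  proof -
    have "sqrt (t / pi) * exp (- t * a\<^sup>2) * (sqrt (t / pi) * exp (- t * b\<^sup>2)) =
        (sqrt (t / pi) * sqrt (t / pi)) * (exp (- t * a\<^sup>2) * exp (- t * b\<^sup>2))"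
      by (simp only: ac_simps)
    also have "\<dots> = t / pi * exp (- t * (a\<^sup>2 + b\<^sup>2))"
      using assms by (simp only: exp_add[symmetric] distrib_left[symmetric]) simp
    finally show ?thesis .
  qed
  ultimately have "normal_density 0 (1 / sqrt (2 * t)) a * normal_density 0 (1 / sqrt (2 * t)) b =
      t / pi * exp (- t * (a\<^sup>2 + b\<^sup>2))" for a b
    by simp
  then have "(\<Prod>i\<in>UNIV - {\<delta>}.
      normal_density 0 (1 / sqrt (2 * t)) (x i) * normal_density 0 (1 / sqrt (2 * t)) (y i)) =
      (\<Prod>i\<in>UNIV - {\<delta>}. t / pi * exp (- t * ((x i)\<^sup>2 + (y i)\<^sup>2)))"
    by simp
  also have "\<dots> = (t / pi) ^ card (UNIV - {\<delta>}) * exp (\<Sum>i\<in>UNIV - {\<delta>}. - t * ((x i)\<^sup>2 + (y i)\<^sup>2))"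
    by (simp only: prod.distrib prod_constant exp_sum[OF finite])
  also have "\<dots> = heat_kernel \<delta> t x y"
    by (simp only: heat_kernel_def total_radius2_def sum_distrib_left)
  finally show ?thesis by (rule sym)
qed

lemma heat_kernel_integral:
  assumes "t > 0"
  shows "integrable (coord_measure \<delta>) (\<lambda>p. heat_kernel \<delta> t (fst p) (snd p))"
    and "(\<integral>p. heat_kernel \<delta> t (fst p) (snd p) \<partial>coord_measure \<delta>) = 1"
proof -
  have "integrable lborel (normal_density 0 (1 / sqrt (2 * t)))"
    "(\<integral>s. normal_density 0 (1 / sqrt (2 * t)) s \<partial>lborel) = 1"
    using assms by simp_all
  then show "integrable (coord_measure \<delta>) (\<lambda>p. heat_kernel \<delta> t (fst p) (snd p))"
    "(\<integral>p. heat_kernel \<delta> t (fst p) (snd p) \<partial>coord_measure \<delta>) = 1"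
    unfolding heat_kernel_eq_prod[OF assms]
    using coord_product[of "normal_density 0 (1 / sqrt (2 * t))" \<delta>] by simp_all
qed

lemma heat_kernel_nonneg: "t > 0 \<Longrightarrow> heat_kernel \<delta> t x y \<ge> 0"
  by (simp add: heat_kernel_def)

text \<open>
  The point of the product space with vanishing coordinates; its value at \<open>\<delta>\<close> is \<open>undefined\<close>.
\<close>

definition origin :: "'v::finite \<Rightarrow> 'v \<Rightarrow> real" where
  "origin \<delta> = restrict (\<lambda>_. 0) (UNIV - {\<delta>})"

text \<open>
  The function space carries only the product topology, so the radius \<open>\<eta>\<close> comes from a sequential
  argument: points with \<open>total_radius2\<close> tending to \<open>0\<close> converge coordinatewise.
\<close>

lemma continuous_at_origin:
  fixes h :: "('v::finite \<Rightarrow> real) \<Rightarrow> ('v \<Rightarrow> real) \<Rightarrow> complex"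
  assumes h: "continuous_super h" and "\<epsilon> > 0"
  obtains \<eta> where "\<eta> > 0" "\<And>x y. x \<in> space (coord_factor \<delta>) \<Longrightarrow> y \<in> space (coord_factor \<delta>) \<Longrightarrow>
    total_radius2 \<delta> x y < \<eta> \<Longrightarrow> norm (h x y - h (origin \<delta>) (origin \<delta>)) \<le> \<epsilon>"
proof (rule ccontr)
  assume contra: "\<not> thesis"
  have "\<exists>p. fst p \<in> space (coord_factor \<delta>) \<and> snd p \<in> space (coord_factor \<delta>) \<and>
      total_radius2 \<delta> (fst p) (snd p) < inverse (Suc m) \<and>
      norm (h (fst p) (snd p) - h (origin \<delta>) (origin \<delta>)) > \<epsilon>" for m
  proof (rule ccontr)
    assume no: "\<not> ?thesis"
    have thesis
    proof (rule that)
      show "inverse (real (Suc m)) > 0" by simp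
      fix x y :: "'v \<Rightarrow> real"
      assume "x \<in> space (coord_factor \<delta>)" "y \<in> space (coord_factor \<delta>)"
        "total_radius2 \<delta> x y < inverse (real (Suc m))"
      then show "norm (h x y - h (origin \<delta>) (origin \<delta>)) \<le> \<epsilon>"
        using no not_le by (metis fst_conv snd_conv)
    qed
    then show False using contra by contradiction
  qed
  then obtain p where p: "\<And>m. fst (p m) \<in> space (coord_factor \<delta>)" "\<And>m. snd (p m) \<in> space (coord_factor \<delta>)"
      "\<And>m. total_radius2 \<delta> (fst (p m)) (snd (p m)) < inverse (Suc m)"
      "\<And>m. norm (h (fst (p m)) (snd (p m)) - h (origin \<delta>) (origin \<delta>)) > \<epsilon>"
    by metis
  have coordinate: "(\<lambda>m. fst (p m) i) \<longlonglongrightarrow> origin \<delta> i" "(\<lambda>m. snd (p m) i) \<longlonglongrightarrow> origin \<delta> i" for i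
  proof -
    have "(\<lambda>m. fst (p m) i) \<longlonglongrightarrow> origin \<delta> i \<and> (\<lambda>m. snd (p m) i) \<longlonglongrightarrow> origin \<delta> i"
    proof (cases "i = \<delta>")
      case True
      then show ?thesis using p(1,2) by (simp add: coord_factor_at origin_def)
    next
      case False
      have "(fst (p m) i)\<^sup>2 + (snd (p m) i)\<^sup>2 \<le> total_radius2 \<delta> (fst (p m)) (snd (p m))" for m
        unfolding total_radius2_def using False by (intro member_le_sum) auto
      then have "(fst (p m) i)\<^sup>2 + (snd (p m) i)\<^sup>2 \<le> inverse (Suc m)" for m
        using p(3) order.trans less_imp_le by blast
      then have sum_le: "(fst (p m) i)\<^sup>2 + (snd (p m) i)\<^sup>2 \<le> inverse (real (Suc m))" for m
        by simp
      have le: "(fst (p m) i)\<^sup>2 \<le> inverse (real (Suc m))" "(snd (p m) i)\<^sup>2 \<le> inverse (real (Suc m))" for m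
        using sum_le[of m] zero_le_power2[of "fst (p m) i"] zero_le_power2[of "snd (p m) i"] by linarith+
      have "(\<lambda>m. (fst (p m) i)\<^sup>2) \<longlonglongrightarrow> 0" "(\<lambda>m. (snd (p m) i)\<^sup>2) \<longlonglongrightarrow> 0"
        by (rule tendsto_sandwich[OF _ _ tendsto_const LIMSEQ_inverse_real_of_nat];
          simp only: le zero_le_power2 eventually_True)+
      then show ?thesis using False by (simp add: origin_def)
    qed
    then show "(\<lambda>m. fst (p m) i) \<longlonglongrightarrow> origin \<delta> i" "(\<lambda>m. snd (p m) i) \<longlonglongrightarrow> origin \<delta> i" by auto
  qed
  have pointwise: "q \<longlonglongrightarrow> l" if "\<And>i. (\<lambda>m. q m i) \<longlonglongrightarrow> l i" for q and l :: "'v \<Rightarrow> real"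
  proof -
    have "limitin (product_topology (\<lambda>_. euclidean) UNIV) q l sequentially"
      using that by (simp add: limitin_componentwise)
    then show ?thesis by (simp add: euclidean_product_topology)
  qed
  have "(\<lambda>m. fst (p m)) \<longlonglongrightarrow> origin \<delta>" "(\<lambda>m. snd (p m)) \<longlonglongrightarrow> origin \<delta>"
    by (rule pointwise, rule coordinate)+
  from tendsto_Pair[OF this] have "(\<lambda>m. p m) \<longlonglongrightarrow> (origin \<delta>, origin \<delta>)" by simp
  moreover have "isCont (\<lambda>p. h (fst p) (snd p)) (origin \<delta>, origin \<delta>)"
    using h unfolding continuous_super_def by (simp add: continuous_on_eq_continuous_at)
  ultimately have "(\<lambda>m. h (fst (p m)) (snd (p m))) \<longlonglongrightarrow> h (origin \<delta>) (origin \<delta>)"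
    using isCont_tendsto_compose[of "(origin \<delta>, origin \<delta>)" "\<lambda>p. h (fst p) (snd p)" p] by simp
  then have "eventually (\<lambda>m. norm (h (fst (p m)) (snd (p m)) - h (origin \<delta>) (origin \<delta>)) < \<epsilon>) sequentially"
    using \<open>\<epsilon> > 0\<close> by (simp add: tendsto_iff dist_norm)
  then obtain m where "norm (h (fst (p m)) (snd (p m)) - h (origin \<delta>) (origin \<delta>)) < \<epsilon>"
    by (auto simp: eventually_sequentially)
  then show False using p(4)[of m] by linarith
qed

text \<open>
  One half of the exponent provides a factor that is small away from the origin, the other half remains
  integrable.
\<close>

lemma gaussian_tail:
  assumes "t > 0" "total_radius2 \<delta> x y \<ge> \<eta>"
  shows "heat_kernel \<delta> t x y \<le> 2 ^ card (UNIV - {\<delta>}) * exp (- (t * \<eta> / 2)) * heat_kernel \<delta> (t / 2) x y"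
proof -
  let ?n = "card (UNIV - {\<delta>})" and ?r = "total_radius2 \<delta> x y"
  have "heat_kernel \<delta> t x y = (2 * (t / 2 / pi)) ^ ?n * (exp (- (t / 2 * ?r)) * exp (- (t / 2 * ?r)))"
    by (simp add: heat_kernel_def flip: exp_add)
  also have "\<dots> = 2 ^ ?n * exp (- (t / 2 * ?r)) * heat_kernel \<delta> (t / 2) x y"
    by (simp only: heat_kernel_def power_mult_distrib) simp
  also have "\<dots> \<le> 2 ^ ?n * exp (- (t * \<eta> / 2)) * heat_kernel \<delta> (t / 2) x y"
    using assms by (intro mult_right_mono mult_left_mono heat_kernel_nonneg) auto
  finally show ?thesis .
qed

lemma norm_integral_le:
  fixes f :: "'a \<Rightarrow> 'b::{banach, second_countable_topology}"
  assumes f: "integrable M f" and g: "integrable M g" and le: "\<And>x. x \<in> space M \<Longrightarrow> norm (f x) \<le> g x"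
  shows "norm (\<integral>x. f x \<partial>M) \<le> (\<integral>x. g x \<partial>M)"
  using integral_norm_bound[of M f] integral_mono[OF integrable_norm[OF f] g le] by linarith

lemma heat_kernel_limit:
  fixes h :: "('v::finite \<Rightarrow> real) \<Rightarrow> ('v \<Rightarrow> real) \<Rightarrow> complex"
  assumes h: "continuous_super h" and supp: "supported_in \<delta> L h"
  shows "(\<lambda>m. \<integral>p. of_real (heat_kernel \<delta> (real (Suc m)) (fst p) (snd p)) * h (fst p) (snd p) \<partial>coord_measure \<delta>)
    \<longlonglongrightarrow> h (origin \<delta>) (origin \<delta>)"
proof -
  let ?o = "origin \<delta>" and ?n = "card (UNIV - {\<delta>})" and ?M = "coord_measure \<delta>"
  obtain C where C: "C \<ge> 0" "\<And>x y. x \<in> space (coord_factor \<delta>) \<Longrightarrow> y \<in> space (coord_factor \<delta>) \<Longrightarrow>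
      norm (h x y) \<le> C"
    using bounded_supported[OF h supp] by blast
  have origin: "?o \<in> space (coord_factor \<delta>)" by (simp add: origin_def space_coord_factor)
  have cont_kernel: "continuous_super (heat_kernel \<delta> t)" for t
  proof -
    have "continuous_on UNIV (\<lambda>p :: ('v \<Rightarrow> real) \<times> ('v \<Rightarrow> real). fst p i)"
      "continuous_on UNIV (\<lambda>p :: ('v \<Rightarrow> real) \<times> ('v \<Rightarrow> real). snd p i)"
      for i :: 'v
      by (rule continuous_super_coordinate[of i, unfolded continuous_super_def])+
    then show ?thesis
      unfolding continuous_super_def heat_kernel_def total_radius2_def
      by (intro continuous_intros)
  qed
  have int: "integrable ?M (\<lambda>p. of_real (heat_kernel \<delta> t (fst p) (snd p)) * h (fst p) (snd p))" for t
    by (rule integrable_supported[of "\<lambda>x y. of_real (heat_kernel \<delta> t x y) * h x y" _ L])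
      (use supp h in \<open>auto simp: supported_in_def intro!: continuous_super_mult
        continuous_super_bounded_linear[OF bounded_linear_of_real cont_kernel]\<close>)
  have estimate: "norm ((\<integral>p. of_real (heat_kernel \<delta> t (fst p) (snd p)) * h (fst p) (snd p) \<partial>?M) - h ?o ?o) \<le>
      \<epsilon> + 2 * C * 2 ^ ?n * exp (- (t * \<eta> / 2))"
    if t: "t > 0" and \<epsilon>: "\<epsilon> > 0" and \<eta>: "\<And>x y. x \<in> space (coord_factor \<delta>) \<Longrightarrow> y \<in> space (coord_factor \<delta>) \<Longrightarrow>
      total_radius2 \<delta> x y < \<eta> \<Longrightarrow> norm (h x y - h ?o ?o) \<le> \<epsilon>" for t \<epsilon> \<eta>
  proof -
    let ?K = "\<lambda>t p. heat_kernel \<delta> t (fst p) (snd p)"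
    have half: "t / 2 > 0" using t by simp
    note K = heat_kernel_integral[OF t, of \<delta>] heat_kernel_integral[OF half, of \<delta>]
    have "(\<integral>p. of_real (?K t p) * h ?o ?o \<partial>?M) = h ?o ?o"
      using K(2) by (simp add: integral_of_real)
    then have difference: "(\<integral>p. of_real (?K t p) * h (fst p) (snd p) \<partial>?M) - h ?o ?o =
        (\<integral>p. of_real (?K t p) * h (fst p) (snd p) - of_real (?K t p) * h ?o ?o \<partial>?M)"
      using int K(1) by (subst Bochner_Integration.integral_diff) auto
    have bound: "norm (\<integral>p. of_real (?K t p) * h (fst p) (snd p) - of_real (?K t p) * h ?o ?o \<partial>?M) \<le>
        (\<integral>p. \<epsilon> * ?K t p + 2 * C * 2 ^ ?n * exp (- (t * \<eta> / 2)) * ?K (t / 2) p \<partial>?M)"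
    proof (rule norm_integral_le)
      show "integrable ?M (\<lambda>p. \<epsilon> * ?K t p + 2 * C * 2 ^ ?n * exp (- (t * \<eta> / 2)) * ?K (t / 2) p)"
        by (intro Bochner_Integration.integrable_add integrable_mult_right K(1) K(3))
      show "integrable ?M (\<lambda>p. of_real (?K t p) * h (fst p) (snd p) - of_real (?K t p) * h ?o ?o)"
        using int K(1) by (intro Bochner_Integration.integrable_diff) auto
      fix p assume "p \<in> space ?M"
      then obtain x y where xy: "p = (x, y)" "x \<in> space (coord_factor \<delta>)" "y \<in> space (coord_factor \<delta>)"
        by (cases p) (auto simp: space_coord_measure)
      have K0: "heat_kernel \<delta> t x y \<ge> 0" "heat_kernel \<delta> (t / 2) x y \<ge> 0"
        using t by (simp_all add: heat_kernel_nonneg)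
      have "norm (of_real (heat_kernel \<delta> t x y) * h x y - of_real (heat_kernel \<delta> t x y) * h ?o ?o) =
          heat_kernel \<delta> t x y * norm (h x y - h ?o ?o)"
        using K0 by (simp flip: right_diff_distrib add: norm_mult)
      also have "\<dots> \<le> \<epsilon> * heat_kernel \<delta> t x y +
          2 * C * 2 ^ ?n * exp (- (t * \<eta> / 2)) * heat_kernel \<delta> (t / 2) x y"
      proof (cases "total_radius2 \<delta> x y < \<eta>")
        case True
        then have "heat_kernel \<delta> t x y * norm (h x y - h ?o ?o) \<le> heat_kernel \<delta> t x y * \<epsilon>"
          using \<eta> xy K0 by (intro mult_left_mono) auto
        moreover have "2 * C * 2 ^ ?n * exp (- (t * \<eta> / 2)) * heat_kernel \<delta> (t / 2) x y \<ge> 0"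
          using C(1) K0 by (intro mult_nonneg_nonneg) auto
        ultimately show ?thesis using mult.commute[of \<epsilon> "heat_kernel \<delta> t x y"] by linarith
      next
        case False
        have "norm (h x y - h ?o ?o) \<le> 2 * C"
          using norm_triangle_ineq4[of "h x y" "h ?o ?o"] C(2)[OF xy(2,3)] C(2)[OF origin origin] by simp
        then have "heat_kernel \<delta> t x y * norm (h x y - h ?o ?o) \<le>
            2 ^ ?n * exp (- (t * \<eta> / 2)) * heat_kernel \<delta> (t / 2) x y * (2 * C)"
          using False C(1) K0 by (intro mult_mono gaussian_tail[OF t]) auto
        moreover have "\<epsilon> * heat_kernel \<delta> t x y \<ge> 0" using \<epsilon> K0 by simp
        moreover have "2 ^ ?n * exp (- (t * \<eta> / 2)) * heat_kernel \<delta> (t / 2) x y * (2 * C) =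
            2 * C * 2 ^ ?n * exp (- (t * \<eta> / 2)) * heat_kernel \<delta> (t / 2) x y"
          by (simp only: ac_simps)
        ultimately show ?thesis by linarith
      qed
      finally show "norm (of_real (?K t p) * h (fst p) (snd p) - of_real (?K t p) * h ?o ?o) \<le>
          \<epsilon> * ?K t p + 2 * C * 2 ^ ?n * exp (- (t * \<eta> / 2)) * ?K (t / 2) p"
        by (simp add: xy)
    qed
    have "(\<integral>p. \<epsilon> * ?K t p + 2 * C * 2 ^ ?n * exp (- (t * \<eta> / 2)) * ?K (t / 2) p \<partial>?M) =
        (\<integral>p. \<epsilon> * ?K t p \<partial>?M) + (\<integral>p. 2 * C * 2 ^ ?n * exp (- (t * \<eta> / 2)) * ?K (t / 2) p \<partial>?M)"
      by (rule Bochner_Integration.integral_add[OF integrable_mult_right[OF K(1)] integrable_mult_right[OF K(3)]])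
    moreover have "(\<integral>p. \<epsilon> * ?K t p \<partial>?M) = \<epsilon>"
      using K(2) by simp
    moreover have "(\<integral>p. 2 * C * 2 ^ ?n * exp (- (t * \<eta> / 2)) * ?K (t / 2) p \<partial>?M) =
        2 * C * 2 ^ ?n * exp (- (t * \<eta> / 2))"
      using K(4) by simp
    ultimately show ?thesis using bound unfolding difference by linarith
  qed
  show ?thesis
  proof (rule LIMSEQ_I)
    fix r :: real assume "r > 0"
    then have half: "r / 2 > 0" by simp
    obtain \<eta> where \<eta>: "\<eta> > 0" "\<And>x y. x \<in> space (coord_factor \<delta>) \<Longrightarrow> y \<in> space (coord_factor \<delta>) \<Longrightarrow>
        total_radius2 \<delta> x y < \<eta> \<Longrightarrow> norm (h x y - h ?o ?o) \<le> r / 2"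
      using continuous_at_origin[OF h half, of \<delta>] by blast
    have "(\<lambda>m. 2 * C * 2 ^ ?n * exp (- (real (Suc m) * \<eta> / 2))) \<longlonglongrightarrow> 0"
      using \<eta>(1) by real_asymp
    then have "eventually (\<lambda>m. 2 * C * 2 ^ ?n * exp (- (real (Suc m) * \<eta> / 2)) < r / 2) sequentially"
      using \<open>r > 0\<close> by (intro order_tendstoD) auto
    then obtain m0 where m0: "2 * C * 2 ^ ?n * exp (- (real (Suc m) * \<eta> / 2)) < r / 2" if "m \<ge> m0" for m
      by (auto simp: eventually_sequentially)
    have "norm ((\<integral>p. of_real (heat_kernel \<delta> (real (Suc m)) (fst p) (snd p)) * h (fst p) (snd p) \<partial>?M) - h ?o ?o) < r"
      if "m \<ge> m0" for m
      using estimate[of "real (Suc m)" "r / 2" \<eta>] \<eta>(2) m0[OF that] \<open>r > 0\<close> by simp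
    then show "\<exists>m0. \<forall>m\<ge>m0. norm ((\<integral>p. of_real (heat_kernel \<delta> (real (Suc m)) (fst p) (snd p)) *
        h (fst p) (snd p) \<partial>?M) - h ?o ?o) < r"
      by blast
  qed
qed

lemma prod_list_const_times:
  "prod_list (map (\<lambda>i. const (c i) * F i) is) = const (prod_list (map c is)) * prod_list (map F is)"
proof (induction "is")
  case (Cons i "is")
  have "F i * (const (prod_list (map c is)) * prod_list (map F is)) =
      const (prod_list (map c is)) * (F i * prod_list (map F is))"
    by (simp only: mult.assoc[symmetric] const_times_commute[of "F i"])
  then show ?case by (simp add: Cons const_mult mult.assoc)
qed (simp add: const_1)

text \<open>
  As \<open>exp (- t N\<^sub>i) = t exp (- t (x\<^sub>i\<^sup>2 + y\<^sub>i\<^sup>2)) (1 / t - 2 \<xi>\<^sub>i \<eta>\<^sub>i)\<close>, taking \<open>\<epsilon> = 1 / t\<close> leaves a Grassmann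
  factor that converges for \<open>t \<rightarrow> \<infinity>\<close>, while the powers of \<open>t\<close> normalize the heat kernel.
\<close>

definition fermion_weight :: "'v::finite \<Rightarrow> real \<Rightarrow> ('v + 'v, complex) grassmann" where
  "fermion_weight \<delta> \<epsilon> = prod_list (map (\<lambda>i. const (of_real \<epsilon>) - const 2 * fermions \<delta> i) (others \<delta>))"

lemma gaussians_eq:
  assumes "t > 0"
  shows "prod_list (map (\<lambda>i. gaussian_super \<delta> t i x y) (others \<delta>)) =
    const (of_real (pi ^ card (UNIV - {\<delta>}) * heat_kernel \<delta> t x y)) * fermion_weight \<delta> (1 / t)"
proof -
  have "gaussian_super \<delta> t i x y = const (of_real (t * exp (- t * radius2 \<delta> i x y))) *
      (const (of_real (1 / t)) - const 2 * fermions \<delta> i)" for i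
    using assms by (intro grassmann_eqI) (simp add: radial_super_def coeff_const algebra_simps)
  then have "prod_list (map (\<lambda>i. gaussian_super \<delta> t i x y) (others \<delta>)) =
      const (prod_list (map (\<lambda>i. of_real (t * exp (- t * radius2 \<delta> i x y))) (others \<delta>))) *
        fermion_weight \<delta> (1 / t)"
    by (simp only: prod_list_const_times fermion_weight_def)
  moreover have "prod_list (map (\<lambda>i. of_real (t * exp (- t * radius2 \<delta> i x y))) (others \<delta>)) =
      (\<Prod>i\<in>UNIV - {\<delta>}. complex_of_real (t * exp (- t * radius2 \<delta> i x y)))"
    using prod.distinct_set_conv_list[OF distinct_others[of \<delta>],
        of "\<lambda>i. complex_of_real (t * exp (- t * radius2 \<delta> i x y))"]
    by (simp only: set_others)
  moreover have "(\<Prod>i\<in>UNIV - {\<delta>}. t * exp (- t * radius2 \<delta> i x y)) =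
      pi ^ card (UNIV - {\<delta>}) * heat_kernel \<delta> t x y"
  proof -
    have "(\<Prod>i\<in>UNIV - {\<delta>}. t * exp (- t * radius2 \<delta> i x y)) =
        (\<Prod>i\<in>UNIV - {\<delta>}. t * exp (- t * ((x i)\<^sup>2 + (y i)\<^sup>2)))"
      by (intro prod.cong) (auto simp: radius2_def)
    also have "\<dots> = t ^ card (UNIV - {\<delta>}) * exp (- t * total_radius2 \<delta> x y)"
      by (simp only: prod.distrib prod_constant exp_sum[OF finite, symmetric] total_radius2_def
          sum_distrib_left)
    finally show ?thesis by (simp add: heat_kernel_def power_divide)
  qed
  ultimately show ?thesis by (simp only: of_real_prod[symmetric])
qed

lemma berezin_fermion_weight_0:
  "berezin \<delta> (B * fermion_weight \<delta> 0) = 2 ^ card (UNIV - {\<delta>}) * body B"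
proof -
  let ?n = "card (UNIV - {\<delta>})"
  have "fermion_weight \<delta> 0 = prod_list (map (\<lambda>i. const (- 2) * (gen (Inl i) * gen (Inr i))) (others \<delta>))"
    unfolding fermion_weight_def
    by (intro arg_cong[of _ _ prod_list] map_cong refl) (simp add: fermions_def const_minus const_0)
  also have "\<dots> = const ((- 2) ^ ?n) * prod_list (map (\<lambda>i. gen (Inl i) * gen (Inr i)) (others \<delta>))"
    by (simp add: prod_list_const_times map_replicate_const length_others prod_list_replicate)
  finally have "B * fermion_weight \<delta> 0 =
      const ((- 2) ^ ?n) * (B * prod_list (map (\<lambda>i. gen (Inl i) * gen (Inr i)) (others \<delta>)))"
    by (simp only: mult.assoc[symmetric] const_times_commute[of B])
  then show ?thesis
    by (simp add: berezin_const_times berezin_top flip: power_mult_distrib mult.assoc)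
qed

lemma continuous_prod_list:
  fixes F :: "'i \<Rightarrow> 'a::topological_space \<Rightarrow> 'b::real_normed_algebra_1"
  shows "(\<And>i. i \<in> set is \<Longrightarrow> continuous_on S (F i)) \<Longrightarrow> continuous_on S (\<lambda>p. prod_list (map (\<lambda>i. F i p) is))"
  by (induction "is") (auto intro!: continuous_intros)

text \<open>
  Multiplication by all the Gaussians \<open>exp (- t N\<^sub>i)\<close> leaves the integral unchanged for every \<open>t\<close>. For
  \<open>t \<rightarrow> \<infinity>\<close> the heat kernel concentrates at the origin, and the limit of the Grassmann weight is
  the top monomial times \<open>(- 2)\<^sup>n\<close>, which reduces \<open>B\<close> to its body.
\<close>

lemma localization:
  assumes J: "J * J = - 1" and B: "susy \<delta> J B (\<lambda>x y. 0)" "\<And>x y. even_elt (B x y)" "supported_in \<delta> L B"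
  shows "(\<integral>p. berezin \<delta> (B (fst p) (snd p)) \<partial>coord_measure \<delta>) =
    of_real ((2 * pi) ^ card (UNIV - {\<delta>})) * body (B (origin \<delta>) (origin \<delta>))"
proof -
  let ?n = "card (UNIV - {\<delta>})" and ?M = "coord_measure \<delta>" and ?t = "\<lambda>m. real (Suc m)"
  let ?I = "\<integral>p. berezin \<delta> (B (fst p) (snd p)) \<partial>?M"
  let ?K = "\<lambda>m p. complex_of_real (heat_kernel \<delta> (?t m) (fst p) (snd p))"
  let ?W = "\<lambda>m. fermion_weight \<delta> (1 / ?t m)" and ?b = "\<lambda>p. body (B (fst p) (snd p))"
  note contB = susy_continuous[OF B(1)]
  obtain C where C: "C \<ge> 0" "\<And>x y. x \<in> space (coord_factor \<delta>) \<Longrightarrow> y \<in> space (coord_factor \<delta>) \<Longrightarrow>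
      norm (B x y) \<le> C"
    using bounded_supported[OF contB B(3)] by blast
  have bound: "norm (berezin \<delta> (B (fst p) (snd p) * F)) \<le> C * norm F" if "p \<in> space ?M" for p F
  proof -
    have "norm (berezin \<delta> (B (fst p) (snd p) * F)) \<le> norm (B (fst p) (snd p)) * norm F"
      using norm_berezin_le norm_mult_ineq order.trans by blast
    also have "\<dots> \<le> C * norm F"
      using that C(2) by (intro mult_right_mono) (auto simp: space_coord_measure)
    finally show ?thesis .
  qed
  have int: "integrable ?M (\<lambda>p. ?K m p * berezin \<delta> (B (fst p) (snd p) * F))" for m F
  proof (rule Bochner_Integration.integrable_bound[OF integrable_mult_right[OF heat_kernel_integral(1)[of "?t m" \<delta>], of "C * norm F"]])
    show "(\<lambda>p. ?K m p * berezin \<delta> (B (fst p) (snd p) * F)) \<in> borel_measurable ?M"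
    proof -
      have "continuous_super (\<lambda>x y. B x y * F)"
        by (intro continuous_super_mult contB continuous_super_const)
      from measurable_super[OF continuous_berezin[OF this], of \<delta>]
      have [measurable]: "(\<lambda>p. berezin \<delta> (B (fst p) (snd p) * F)) \<in> borel_measurable ?M" .
      have [measurable]: "(\<lambda>p. heat_kernel \<delta> (?t m) (fst p) (snd p)) \<in> borel_measurable ?M"
        using heat_kernel_integral(1)[of "?t m" \<delta>] by auto
      show ?thesis by measurable
    qed
    show "AE p in ?M. norm (?K m p * berezin \<delta> (B (fst p) (snd p) * F)) \<le>
        norm (C * norm F * heat_kernel \<delta> (?t m) (fst p) (snd p))"
    proof (rule AE_I2)
      fix p assume "p \<in> space ?M"
      then have "\<bar>heat_kernel \<delta> (?t m) (fst p) (snd p)\<bar> * norm (berezin \<delta> (B (fst p) (snd p) * F)) \<le>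
          \<bar>heat_kernel \<delta> (?t m) (fst p) (snd p)\<bar> * (C * norm F)"
        by (intro mult_left_mono bound) auto
      then show "norm (?K m p * berezin \<delta> (B (fst p) (snd p) * F)) \<le>
          norm (C * norm F * heat_kernel \<delta> (?t m) (fst p) (snd p))"
        using C(1) by (simp add: norm_mult abs_mult mult_ac)
    qed
  qed simp
  have I: "?I = of_real (pi ^ ?n) * (\<integral>p. ?K m p * berezin \<delta> (B (fst p) (snd p) * ?W m) \<partial>?M)" for m
  proof -
    have "?I = (\<integral>p. berezin \<delta> (B (fst p) (snd p) *
        prod_list (map (\<lambda>i. gaussian_super \<delta> (?t m) i (fst p) (snd p)) (others \<delta>))) \<partial>?M)"
      by (rule integral_times_gaussians[OF J B, symmetric])
    also have "\<dots> = (\<integral>p. of_real (pi ^ ?n) * (?K m p * berezin \<delta> (B (fst p) (snd p) * ?W m)) \<partial>?M)"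
    proof (rule Bochner_Integration.integral_cong[OF refl])
      fix p
      have "B (fst p) (snd p) * (const c * F) = const c * (B (fst p) (snd p) * F)" for c F
        by (simp only: mult.assoc[symmetric] const_times_commute[of "B (fst p) (snd p)"])
      then show "berezin \<delta> (B (fst p) (snd p) *
          prod_list (map (\<lambda>i. gaussian_super \<delta> (?t m) i (fst p) (snd p)) (others \<delta>))) =
        of_real (pi ^ ?n) * (?K m p * berezin \<delta> (B (fst p) (snd p) * ?W m))"
        by (subst gaussians_eq) (simp_all add: berezin_const_times mult.assoc)
    qed
    finally show ?thesis by simp
  qed
  have cont_b: "continuous_super (\<lambda>x y. body (B x y))"
    by (rule continuous_super_bounded_linear[OF bounded_linear_body contB])
  have supp_b: "supported_in \<delta> L (\<lambda>x y. body (B x y))"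
    using B(3) by (auto simp: supported_in_def)
  have W: "(\<lambda>m. C * norm (?W m - fermion_weight \<delta> 0)) \<longlonglongrightarrow> 0"
  proof -
    have "continuous_on UNIV (fermion_weight \<delta>)"
      unfolding fermion_weight_def[abs_def]
      by (intro continuous_prod_list continuous_intros)
    then have "isCont (fermion_weight \<delta>) 0" by (simp add: continuous_on_eq_continuous_at)
    moreover have "(\<lambda>m. 1 / ?t m) \<longlonglongrightarrow> 0" using LIMSEQ_inverse_real_of_nat by (simp add: inverse_eq_divide)
    ultimately have "?W \<longlonglongrightarrow> fermion_weight \<delta> 0" by (rule isCont_tendsto_compose)
    then show ?thesis
      using tendsto_mult_right_zero[OF tendsto_norm_zero[OF LIM_zero]] by blast
  qed
  have "(\<lambda>m. (\<integral>p. ?K m p * berezin \<delta> (B (fst p) (snd p) * (?W m - fermion_weight \<delta> 0)) \<partial>?M)) \<longlonglongrightarrow> 0"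
  proof (rule Lim_null_comparison[OF _ W], rule always_eventually, rule allI)
    fix m
    note K = heat_kernel_integral[of "?t m" \<delta>]
    have "norm (\<integral>p. ?K m p * berezin \<delta> (B (fst p) (snd p) * (?W m - fermion_weight \<delta> 0)) \<partial>?M) \<le>
        (\<integral>p. C * norm (?W m - fermion_weight \<delta> 0) * heat_kernel \<delta> (?t m) (fst p) (snd p) \<partial>?M)"
    proof (rule norm_integral_le[OF int])
      show "integrable ?M (\<lambda>p. C * norm (?W m - fermion_weight \<delta> 0) * heat_kernel \<delta> (?t m) (fst p) (snd p))"
        using K(1) by (intro integrable_mult_right) simp
      fix p assume "p \<in> space ?M"
      then have "heat_kernel \<delta> (?t m) (fst p) (snd p) *
          norm (berezin \<delta> (B (fst p) (snd p) * (?W m - fermion_weight \<delta> 0))) \<le>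
          heat_kernel \<delta> (?t m) (fst p) (snd p) * (C * norm (?W m - fermion_weight \<delta> 0))"
        by (intro mult_left_mono bound heat_kernel_nonneg) auto
      then show "norm (?K m p * berezin \<delta> (B (fst p) (snd p) * (?W m - fermion_weight \<delta> 0))) \<le>
          C * norm (?W m - fermion_weight \<delta> 0) * heat_kernel \<delta> (?t m) (fst p) (snd p)"
        using heat_kernel_nonneg[of "?t m" \<delta> "fst p" "snd p"] by (simp add: norm_mult mult_ac)
    qed
    then show "norm (\<integral>p. ?K m p * berezin \<delta> (B (fst p) (snd p) * (?W m - fermion_weight \<delta> 0)) \<partial>?M) \<le>
        C * norm (?W m - fermion_weight \<delta> 0)"
      using K by simp
  qed
  moreover have "(\<lambda>m. 2 ^ ?n * (\<integral>p. ?K m p * ?b p \<partial>?M)) \<longlonglongrightarrow> 2 ^ ?n * body (B (origin \<delta>) (origin \<delta>))"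
    by (intro tendsto_mult_left heat_kernel_limit[OF cont_b supp_b])
  ultimately have "(\<lambda>m. (\<integral>p. ?K m p * berezin \<delta> (B (fst p) (snd p) * (?W m - fermion_weight \<delta> 0)) \<partial>?M) +
      2 ^ ?n * (\<integral>p. ?K m p * ?b p \<partial>?M)) \<longlonglongrightarrow> 0 + 2 ^ ?n * body (B (origin \<delta>) (origin \<delta>))"
    by (rule tendsto_add)
  moreover have "(\<integral>p. ?K m p * berezin \<delta> (B (fst p) (snd p) * (?W m - fermion_weight \<delta> 0)) \<partial>?M) +
      2 ^ ?n * (\<integral>p. ?K m p * ?b p \<partial>?M) = ?I / of_real (pi ^ ?n)" for m
  proof -
    have "2 ^ ?n * (\<integral>p. ?K m p * ?b p \<partial>?M) =
        (\<integral>p. ?K m p * berezin \<delta> (B (fst p) (snd p) * fermion_weight \<delta> 0) \<partial>?M)"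
      by (simp add: berezin_fermion_weight_0 mult.left_commute)
    moreover have "(\<integral>p. ?K m p * berezin \<delta> (B (fst p) (snd p) * (?W m - fermion_weight \<delta> 0)) \<partial>?M) +
        (\<integral>p. ?K m p * berezin \<delta> (B (fst p) (snd p) * fermion_weight \<delta> 0) \<partial>?M) =
        (\<integral>p. ?K m p * berezin \<delta> (B (fst p) (snd p) * ?W m) \<partial>?M)"
      using int by (subst Bochner_Integration.integral_add[symmetric])
        (simp_all flip: distrib_left berezin_add)
    ultimately show ?thesis using I[of m] by simp
  qed
  ultimately have "(\<lambda>m::nat. ?I / of_real (pi ^ ?n)) \<longlonglongrightarrow> 2 ^ ?n * body (B (origin \<delta>) (origin \<delta>))"
    by simp
  then have "?I / of_real (pi ^ ?n) = 2 ^ ?n * body (B (origin \<delta>) (origin \<delta>))"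
    by (rule LIMSEQ_unique[OF tendsto_const])
  then show ?thesis by (simp add: field_simps power_mult_distrib)
qed

section \<open>Harmonic functions in the plane\<close>

lemma has_derivative_partials:
  fixes f :: "real \<times> real \<Rightarrow> complex"
  assumes "f differentiable (at p)"
  shows "(f has_derivative (\<lambda>h. fst h *\<^sub>R partial1 f p + snd h *\<^sub>R partial2 f p)) (at p)"
    and "((\<lambda>t. f (t, snd p)) has_vector_derivative partial1 f p) (at (fst p))"
    and "((\<lambda>t. f (fst p, t)) has_vector_derivative partial2 f p) (at (snd p))"
proof -
  obtain f' where f': "(f has_derivative f') (at p)" using assms unfolding differentiable_def by blast
  interpret f': bounded_linear f' using f' by (rule has_derivative_bounded_linear)
  have "((\<lambda>t. f (t, snd p)) has_derivative (\<lambda>s. f' (s, 0))) (at (fst p))"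
    by (rule has_derivative_compose[where f = "\<lambda>t. (t, snd p)" and g = f])
      (auto intro!: derivative_eq_intros simp: f')
  moreover have s1: "(\<lambda>s. f' (s, 0)) = (\<lambda>s. s *\<^sub>R f' (1, 0))"
  proof
    show "f' (s, 0) = s *\<^sub>R f' (1, 0)" for s using f'.scaleR[of s "(1, 0)"] by simp
  qed
  ultimately have 1: "((\<lambda>t. f (t, snd p)) has_vector_derivative f' (1, 0)) (at (fst p))"
    unfolding has_vector_derivative_def by argo
  have "((\<lambda>t. f (fst p, t)) has_derivative (\<lambda>s. f' (0, s))) (at (snd p))"
    by (rule has_derivative_compose[where f = "\<lambda>t. (fst p, t)" and g = f])
      (auto intro!: derivative_eq_intros simp: f')
  moreover have s2: "(\<lambda>s. f' (0, s)) = (\<lambda>s. s *\<^sub>R f' (0, 1))"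
  proof
    show "f' (0, s) = s *\<^sub>R f' (0, 1)" for s using f'.scaleR[of s "(0, 1)"] by simp
  qed
  ultimately have 2: "((\<lambda>t. f (fst p, t)) has_vector_derivative f' (0, 1)) (at (snd p))"
    unfolding has_vector_derivative_def by argo
  have partials: "partial1 f p = f' (1, 0)" "partial2 f p = f' (0, 1)"
    unfolding partial1_def partial2_def by (rule vector_derivative_at[OF 1], rule vector_derivative_at[OF 2])
  show "((\<lambda>t. f (t, snd p)) has_vector_derivative partial1 f p) (at (fst p))"
    "((\<lambda>t. f (fst p, t)) has_vector_derivative partial2 f p) (at (snd p))"
    using 1 2 by (simp_all add: partials)
  have decomposition: "f' h = fst h *\<^sub>R f' (1, 0) + snd h *\<^sub>R f' (0, 1)" for h
  proof -
    have "f' h = f' (fst h, 0) + f' (0, snd h)"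
      using f'.add[of "(fst h, 0)" "(0, snd h)"] by simp
    then show ?thesis using fun_cong[OF s1, of "fst h"] fun_cong[OF s2, of "snd h"] by argo
  qed
  have "f' = (\<lambda>h. fst h *\<^sub>R partial1 f p + snd h *\<^sub>R partial2 f p)"
    unfolding partials by (rule ext) (rule decomposition)
  then show "(f has_derivative (\<lambda>h. fst h *\<^sub>R partial1 f p + snd h *\<^sub>R partial2 f p)) (at p)"
    using f' by argo
qed

text \<open>
  Differentiate \<open>f(x, y) - f(x, y\<^sub>0) = \<integral> \<partial>\<^sub>2 f(x, t) dt\<close>, first in \<open>x\<close> under the integral sign and then in \<open>y\<close>.
\<close>

lemma mixed_partials_eq:
  assumes f: "C1_plane f" and f1: "C1_plane (partial1 f)" and f2: "C1_plane (partial2 f)"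
  shows "partial2 (partial1 f) (a, b) = partial1 (partial2 f) (a, b)"
proof -
  let ?P = "partial1 f" and ?Q = "partial2 f"
  define y0 where "y0 = b - 1"
  have df: "f differentiable (at p)" "?P differentiable (at p)" "?Q differentiable (at p)" for p
    using assms unfolding C1_plane_def by blast+
  have cont: "continuous_on UNIV ?Q" "continuous_on UNIV (partial1 ?Q)"
    using f f2 by (simp_all add: C1_plane_def)
  have cont_line: "continuous_on S (\<lambda>t. ?Q (x, t))" "continuous_on S (\<lambda>t. partial1 ?Q (x, t))" for x S
    by (auto intro!: continuous_on_compose2[OF cont(1)] continuous_on_compose2[OF cont(2)] continuous_intros)
  have ftc: "integral {y0..y} (\<lambda>t. ?Q (x, t)) = f (x, y) - f (x, y0)" if "y0 \<le> y" for x y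
  proof (rule integral_unique, rule fundamental_theorem_of_calculus[OF that])
    fix t show "((\<lambda>t. f (x, t)) has_vector_derivative ?Q (x, t)) (at t within {y0..y})"
      using has_derivative_partials(3)[OF df(1), of "(x, t)"] by (simp add: has_vector_derivative_at_within)
  qed
  have P: "?P (a, y) - ?P (a, y0) = integral {y0..y} (\<lambda>t. partial1 ?Q (a, t))" if "y0 \<le> y" for y
  proof -
    have "((\<lambda>x. integral (cbox y0 y) (\<lambda>t. ?Q (x, t))) has_vector_derivative
        integral (cbox y0 y) (\<lambda>t. partial1 ?Q (a, t))) (at a within UNIV)"
    proof (rule leibniz_rule_vector_derivative)
      show "((\<lambda>x. ?Q (x, t)) has_vector_derivative partial1 ?Q (x, t)) (at x within UNIV)" for x t
        using has_derivative_partials(2)[OF df(3), of "(x, t)"] by simp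
      show "(\<lambda>t. ?Q (x, t)) integrable_on cbox y0 y" for x
        by (intro integrable_continuous cont_line)
      show "continuous_on (UNIV \<times> cbox y0 y) (\<lambda>(x, t). partial1 ?Q (x, t))"
        using cont(2) by (auto intro: continuous_on_subset simp: case_prod_unfold)
    qed auto
    moreover have "((\<lambda>x. f (x, y) - f (x, y0)) has_vector_derivative ?P (a, y) - ?P (a, y0)) (at a)"
      using has_derivative_partials(2)[OF df(1), of "(a, y)"] has_derivative_partials(2)[OF df(1), of "(a, y0)"]
      by (intro has_vector_derivative_diff) simp_all
    ultimately show ?thesis
      using ftc[OF that] vector_derivative_unique_at by simp
  qed
  have "((\<lambda>y. integral {y0..y} (\<lambda>t. partial1 ?Q (a, t))) has_vector_derivative partial1 ?Q (a, b))
      (at b within {y0..b + 1})"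
    by (rule integral_has_vector_derivative[OF cont_line(2)]) (simp add: y0_def)
  then have "((\<lambda>y. ?P (a, y) - ?P (a, y0)) has_vector_derivative partial1 ?Q (a, b)) (at b within {y0..b + 1})"
    by (rule has_vector_derivative_transform[rotated 2]) (use P in \<open>auto simp: y0_def\<close>)
  moreover have "at b within {y0..b + 1} = at b"
    by (rule at_within_interior) (simp add: y0_def)
  moreover have "((\<lambda>y. ?P (a, y) - ?P (a, y0)) has_vector_derivative partial2 ?P (a, b) - 0) (at b)"
    using has_derivative_partials(3)[OF df(2), of "(a, b)"] by (intro has_vector_derivative_diff) simp_all
  ultimately show ?thesis using vector_derivative_unique_at by fastforce
qed

text \<open>
  For harmonic \<open>f\<close>, both \<open>\<partial>\<^sub>1 f - \<i> \<partial>\<^sub>2 f\<close> and the composition of \<open>\<partial>\<^sub>1 f + \<i> \<partial>\<^sub>2 f\<close> with complex conjugation are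
  entire. Half of their primitives, the first taken at \<open>a + \<i> b\<close> and the second at \<open>a - \<i> b\<close>, add up
  to \<open>f\<close> up to a constant.
\<close>

lemma harmonic_decomposition:
  assumes f: "harmonic_plane f"
  obtains H K where "H holomorphic_on UNIV" "K holomorphic_on UNIV"
    "\<And>k a b. (partial1 ^^ k) f (a, b) =
      (deriv ^^ k) H (of_real a + \<i> * of_real b) + (deriv ^^ k) K (of_real a + - \<i> * of_real b)"
proof -
  let ?P = "partial1 f" and ?Q = "partial2 f"
  have C1: "C1_plane f" "C1_plane ?P" "C1_plane ?Q" using f by (simp_all add: harmonic_plane_def)
  then have df: "f differentiable (at p)" "?P differentiable (at p)" "?Q differentiable (at p)" for p
    unfolding C1_plane_def by blast+
  have mixed: "partial2 ?P p = partial1 ?Q p" for p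
    using mixed_partials_eq[OF C1] by (cases p) simp
  have laplace: "partial2 ?Q p = - partial1 ?P p" for p
  proof -
    have "partial1 ?P p + partial2 ?Q p = 0" using f unfolding harmonic_plane_def by blast
    then show ?thesis by (simp only: add_eq_0_iff)
  qed
  let ?z = "\<lambda>z. (Re z, Im z)" and ?c = "\<lambda>z. (Re z, - Im z)"
  define g where "g z = ?P (?z z) - \<i> * ?Q (?z z)" for z
  define k where "k z = ?P (?c z) + \<i> * ?Q (?c z)" for z
  have z: "(?z has_derivative ?z) (at z)" and c: "(?c has_derivative ?c) (at z)" for z
    by (auto intro!: derivative_eq_intros)
  have "g field_differentiable (at z)" for z
    unfolding field_differentiable_def has_field_derivative_def
  proof
    have "(g has_derivative (\<lambda>h. (Re h *\<^sub>R partial1 ?P (?z z) + Im h *\<^sub>R partial2 ?P (?z z)) -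
        \<i> * (Re h *\<^sub>R partial1 ?Q (?z z) + Im h *\<^sub>R partial2 ?Q (?z z)))) (at z)"
      unfolding g_def
      using has_derivative_compose[OF z has_derivative_partials(1)[OF df(2)]]
        has_derivative_compose[OF z has_derivative_partials(1)[OF df(3)]]
      by (intro has_derivative_diff has_derivative_mult_right) simp_all
    also have "(\<lambda>h. (Re h *\<^sub>R partial1 ?P (?z z) + Im h *\<^sub>R partial2 ?P (?z z)) -
        \<i> * (Re h *\<^sub>R partial1 ?Q (?z z) + Im h *\<^sub>R partial2 ?Q (?z z))) =
        (*) (partial1 ?P (?z z) - \<i> * partial1 ?Q (?z z))"
      unfolding mixed laplace by (auto simp: fun_eq_iff complex_eq_iff algebra_simps)
    finally show "(g has_derivative (*) (partial1 ?P (?z z) - \<i> * partial1 ?Q (?z z))) (at z)" .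
  qed
  then have "g holomorphic_on UNIV" by (simp add: holomorphic_on_def)
  then obtain G where G: "\<And>z. (G has_field_derivative g z) (at z)"
    using holomorphic_convex_primitive'[of UNIV g] by auto
  have "k field_differentiable (at z)" for z
    unfolding field_differentiable_def has_field_derivative_def
  proof
    have "(k has_derivative (\<lambda>h. (Re h *\<^sub>R partial1 ?P (?c z) + (- Im h) *\<^sub>R partial2 ?P (?c z)) +
        \<i> * (Re h *\<^sub>R partial1 ?Q (?c z) + (- Im h) *\<^sub>R partial2 ?Q (?c z)))) (at z)"
      unfolding k_def
      using has_derivative_compose[OF c has_derivative_partials(1)[OF df(2)]]
        has_derivative_compose[OF c has_derivative_partials(1)[OF df(3)]]
      by (intro has_derivative_add has_derivative_mult_right) simp_all
    also have "(\<lambda>h. (Re h *\<^sub>R partial1 ?P (?c z) + (- Im h) *\<^sub>R partial2 ?P (?c z)) +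
        \<i> * (Re h *\<^sub>R partial1 ?Q (?c z) + (- Im h) *\<^sub>R partial2 ?Q (?c z))) =
        (*) (partial1 ?P (?c z) + \<i> * partial1 ?Q (?c z))"
      unfolding mixed laplace by (auto simp: fun_eq_iff complex_eq_iff algebra_simps)
    finally show "(k has_derivative (*) (partial1 ?P (?c z) + \<i> * partial1 ?Q (?c z))) (at z)" .
  qed
  then have "k holomorphic_on UNIV" by (simp add: holomorphic_on_def)
  then obtain K where K: "\<And>z. (K has_field_derivative k z) (at z)"
    using holomorphic_convex_primitive'[of UNIV k] by auto
  let ?w = "\<lambda>p. of_real (fst p) + \<i> * of_real (snd p)" and ?v = "\<lambda>p. of_real (fst p) + - \<i> * of_real (snd p)"
  define D where "D p = f p - 1 / 2 * (G (?w p) + K (?v p))" for p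
  have "(D has_derivative (\<lambda>h. 0)) (at p)" for p
  proof -
    have w: "(?w has_derivative ?w) (at p)" and v: "(?v has_derivative ?v) (at p)"
      by (auto intro!: derivative_eq_intros)
    have "(D has_derivative (\<lambda>h. (fst h *\<^sub>R ?P p + snd h *\<^sub>R ?Q p) -
        1 / 2 * (g (?w p) * ?w h + k (?v p) * ?v h))) (at p)"
      unfolding D_def
      using has_derivative_compose[OF w has_field_derivative_imp_has_derivative[OF G]]
        has_derivative_compose[OF v has_field_derivative_imp_has_derivative[OF K]]
      by (intro has_derivative_diff has_derivative_add has_derivative_mult_right
          has_derivative_partials(1) df) simp_all
    also have "(\<lambda>h. (fst h *\<^sub>R ?P p + snd h *\<^sub>R ?Q p) -
        1 / 2 * (g (?w p) * ?w h + k (?v p) * ?v h)) = (\<lambda>h. 0)"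
      by (auto simp: fun_eq_iff g_def k_def complex_eq_iff algebra_simps)
    finally show ?thesis .
  qed
  then obtain c where D: "\<And>p. D p = c"
    using has_derivative_zero_constant[of UNIV D] by auto
  then have f_eq: "f p = (G (?w p) / 2 + c) + K (?v p) / 2" for p
  proof -
    have "f p = c + 1 / 2 * (G (?w p) + K (?v p))" using D[of p] unfolding D_def by (simp only: diff_eq_eq)
    then show ?thesis by (simp add: distrib_left)
  qed
  define H1 where "H1 z = G z / 2 + c" for z
  define K1 where "K1 z = K z / 2" for z
  have "(H1 has_field_derivative g z / 2) (at z)" "(K1 has_field_derivative k z / 2) (at z)" for z
    unfolding H1_def K1_def by (auto intro!: derivative_eq_intros G K)
  then have hol: "H1 holomorphic_on UNIV" "K1 holomorphic_on UNIV"
    using holomorphic_on_open open_UNIV by blast+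
  have higher: "((deriv ^^ n) F has_field_derivative (deriv ^^ Suc n) F z) (at z)"
    if "F holomorphic_on UNIV" for F n and z :: complex
    using holomorphic_derivI[OF holomorphic_higher_deriv[OF that open_UNIV, of n] open_UNIV] by simp
  have "(partial1 ^^ n) f = (\<lambda>p. (deriv ^^ n) H1 (?w p) + (deriv ^^ n) K1 (?v p))" for n
  proof (induction n)
    case 0
    show ?case by (simp add: fun_eq_iff f_eq H1_def K1_def)
  next
    case (Suc n)
    have step: "partial1 (\<lambda>p. (deriv ^^ n) H1 (?w p) + (deriv ^^ n) K1 (?v p)) p =
        (deriv ^^ Suc n) H1 (?w p) + (deriv ^^ Suc n) K1 (?v p)" for p
      unfolding partial1_def
    proof (rule vector_derivative_at, rule has_vector_derivative_add)
      have line: "((\<lambda>t. of_real t + d) has_vector_derivative 1) (at s)" for d :: complex and s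
        by (auto intro!: derivative_eq_intros)
      show "((\<lambda>t. (deriv ^^ n) H1 (?w (t, snd p))) has_vector_derivative (deriv ^^ Suc n) H1 (?w p)) (at (fst p))"
        using field_vector_diff_chain_at[OF line higher[OF hol(1)]] by (simp add: comp_def)
      show "((\<lambda>t. (deriv ^^ n) K1 (?v (t, snd p))) has_vector_derivative (deriv ^^ Suc n) K1 (?v p)) (at (fst p))"
        using field_vector_diff_chain_at[OF line[of "- \<i> * of_real (snd p)" "fst p"] higher[OF hol(2)]]
        by (simp add: comp_def)
    qed
    have "(partial1 ^^ Suc n) f p = (deriv ^^ Suc n) H1 (?w p) + (deriv ^^ Suc n) K1 (?v p)" for p
      using step[of p] by (simp only: funpow.simps comp_apply Suc)
    then show ?case by (rule ext)
  qed
  then show ?thesis by (intro that[OF hol]) simp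
qed

section \<open>Removing the cutoff\<close>

text \<open>
  The powers of the positive part of \<open>1 - s\<close> from the second on are continuously differentiable across
  \<open>s = 1\<close>, so the third power is an elementary compactly supported cutoff of class \<open>C\<^sup>2\<close>.
\<close>

lemma cut_power_deriv:
  "((\<lambda>s. (max 0 (1 - s)) ^ Suc (Suc k)) has_real_derivative - (real (Suc (Suc k)) * (max 0 (1 - s)) ^ Suc k)) (at s)"
proof -
  consider "s < 1" | "s > 1" | "s = 1" by linarith
  then show ?thesis
  proof cases
    case 1
    have "((\<lambda>s. (1 - s) ^ Suc (Suc k)) has_real_derivative - (real (Suc (Suc k)) * (1 - s) ^ Suc k)) (at s)"
      by (rule derivative_eq_intros refl)+ simp
    then have "((\<lambda>s. (max 0 (1 - s)) ^ Suc (Suc k)) has_real_derivative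
        - (real (Suc (Suc k)) * (1 - s) ^ Suc k)) (at s)"
      by (rule has_field_derivative_transform_within_open[where S = "{..<1}"]) (use 1 in auto)
    then show ?thesis using 1 by simp
  next
    case 2
    have "((\<lambda>s. 0) has_real_derivative 0) (at s)" by simp
    then have "((\<lambda>s. (max 0 (1 - s)) ^ Suc (Suc k)) has_real_derivative 0) (at s)"
      by (rule has_field_derivative_transform_within_open[where S = "{1<..}"]) (use 2 in auto)
    then show ?thesis using 2 by simp
  next
    case 3
    have "((\<lambda>h. (max 0 (1 - (1 + h))) ^ Suc (Suc k) / h) \<longlongrightarrow> 0) (at (0 :: real))"
    proof (rule Lim_null_comparison)
      show "((\<lambda>h. \<bar>h\<bar> ^ Suc k) \<longlongrightarrow> 0) (at (0 :: real))"
        by (auto intro!: tendsto_eq_intros)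
      show "\<forall>\<^sub>F h in at (0 :: real). norm ((max 0 (1 - (1 + h))) ^ Suc (Suc k) / h) \<le> \<bar>h\<bar> ^ Suc k"
        unfolding eventually_at_filter
      proof (rule always_eventually, intro allI impI)
        fix h :: real assume "h \<noteq> 0"
        have "max 0 (1 - (1 + h)) ^ Suc (Suc k) \<le> \<bar>h\<bar> ^ Suc (Suc k)"
          by (rule power_mono) auto
        then show "norm ((max 0 (1 - (1 + h))) ^ Suc (Suc k) / h) \<le> \<bar>h\<bar> ^ Suc k"
          using \<open>h \<noteq> 0\<close> by (simp add: abs_mult power_abs divide_le_eq mult_ac)
      qed
    qed
    then show ?thesis using 3 by (simp add: DERIV_def)
  qed
qed

definition cutoff :: "real \<Rightarrow> 'v::finite \<Rightarrow> 'v \<Rightarrow> ('v, complex) superfunction" where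
  "cutoff R \<delta> = radial_super \<delta> (\<lambda>s. (max 0 (1 - s / R)) ^ 3) (\<lambda>s. - (3 / R * (max 0 (1 - s / R))\<^sup>2))"

lemma susy_closed_cutoff:
  assumes "R > 0" shows "susy \<delta> J (cutoff R \<delta> i) (\<lambda>x y. 0)"
  unfolding cutoff_def
proof (rule susy_closed_radial[where g'' = "\<lambda>s. 6 / (R * R) * max 0 (1 - s / R)"])
  have scaled: "((\<lambda>s. (max 0 (1 - s / R)) ^ Suc (Suc k)) has_real_derivative
      - (real (Suc (Suc k)) * (max 0 (1 - s / R)) ^ Suc k) * (1 / R)) (at s)" for k s
    by (rule DERIV_chain2[OF cut_power_deriv]) (use assms in \<open>auto intro!: derivative_eq_intros\<close>)
  show "((\<lambda>s. (max 0 (1 - s / R)) ^ 3) has_real_derivative - (3 / R * (max 0 (1 - s / R))\<^sup>2)) (at s)" for s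
    using scaled[of 1 s] by (simp add: eval_nat_numeral)
  show "((\<lambda>s. - (3 / R * (max 0 (1 - s / R))\<^sup>2)) has_real_derivative 6 / (R * R) * max 0 (1 - s / R)) (at s)" for s
    using DERIV_cmult[OF scaled[of 0 s], of "- (3 / R)"] by (simp add: eval_nat_numeral)
  show "continuous_on {0..} (\<lambda>s. 6 / (R * R) * max 0 (1 - s / R))"
    using assms by (intro continuous_intros) auto
qed

lemma even_cutoff: "even_elt (cutoff R \<delta> i x y)"
  by (simp add: cutoff_def)

lemma cutoff_eq_0: "R > 0 \<Longrightarrow> radius2 \<delta> i x y \<ge> R \<Longrightarrow> cutoff R \<delta> i x y = 0"
  by (simp add: cutoff_def radial_super_def max_def const_0)

lemma norm_cutoff_le:
  assumes "R \<ge> 1" shows "norm (cutoff R \<delta> i x y) \<le> 7"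
proof -
  define c where "c = max 0 (1 - radius2 \<delta> i x y / R)"
  have c: "0 \<le> c" "c \<le> 1" using assms by (simp_all add: c_def)
  then have "c ^ 3 \<le> 1" "c\<^sup>2 \<le> 1" by (simp_all add: power_le_one)
  moreover have "3 / R * c\<^sup>2 \<le> 3 * 1"
    using assms \<open>c\<^sup>2 \<le> 1\<close> by (intro mult_mono) (simp_all add: divide_le_eq)
  moreover have "norm (cutoff R \<delta> i x y) \<le> \<bar>c ^ 3\<bar> + 2 * \<bar>- (3 / R * c\<^sup>2)\<bar>"
    unfolding cutoff_def c_def by (rule norm_radial_super_le)
  moreover have "\<bar>c ^ 3\<bar> = c ^ 3" "\<bar>- (3 / R * c\<^sup>2)\<bar> = 3 / R * c\<^sup>2" using c assms by simp_all
  ultimately show ?thesis by linarith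
qed

lemma cutoff_tendsto: "(\<lambda>m. cutoff (real (Suc m)) \<delta> i x y) \<longlonglongrightarrow> 1"
proof -
  let ?s = "radius2 \<delta> i x y"
  have zero: "(\<lambda>m. c / real (Suc m)) \<longlonglongrightarrow> 0" for c
    using tendsto_mult_right_zero[OF LIMSEQ_inverse_real_of_nat, of c] by (simp only: divide_inverse)
  have "(\<lambda>m. cutoff (real (Suc m)) \<delta> i x y) \<longlonglongrightarrow>
      const (of_real ((max 0 (1 - 0)) ^ 3)) + const (of_real (2 * - (0 * (max 0 (1 - 0))\<^sup>2))) * fermions \<delta> i"
    unfolding cutoff_def radial_super_def
    by (intro tendsto_add tendsto_mult tendsto_const bounded_linear.tendsto[OF bounded_linear_const]
        tendsto_of_real tendsto_power tendsto_max tendsto_diff tendsto_minus zero)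
  then show ?thesis by (simp add: const_0 const_1)
qed

definition cutoffs :: "real \<Rightarrow> 'v::finite \<Rightarrow> ('v, complex) superfunction" where
  "cutoffs R \<delta> x y = prod_list (map (\<lambda>i. cutoff R \<delta> i x y) (others \<delta>))"

lemma susy_closed_cutoffs: "R > 0 \<Longrightarrow> susy \<delta> J (cutoffs R \<delta>) (\<lambda>x y. 0)"
  unfolding cutoffs_def[abs_def] by (intro susy_closed_prod_list susy_closed_cutoff)

lemma even_cutoffs: "even_elt (cutoffs R \<delta> x y)"
  unfolding cutoffs_def by (rule even_elt_prod_list) (auto simp: even_cutoff)

lemma norm_cutoffs_le: "R \<ge> 1 \<Longrightarrow> norm (cutoffs R \<delta> x y) \<le> 7 ^ card (UNIV - {\<delta>})"
  unfolding cutoffs_def length_others[symmetric] by (intro norm_prod_list_le norm_cutoff_le)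

lemma supported_in_cutoffs:
  assumes "R > 0" shows "supported_in \<delta> (1 + R) (cutoffs R \<delta>)"
  unfolding supported_in_def
proof (intro allI impI, elim exE conjE)
  fix x y i assume i: "i \<noteq> \<delta>" "1 + R < \<bar>x i\<bar> \<or> 1 + R < \<bar>y i\<bar>"
  have "R \<le> a\<^sup>2" if "1 + R < \<bar>a\<bar>" for a
  proof -
    have "R \<le> (1 + R)\<^sup>2" using assms by (simp add: power2_eq_square algebra_simps)
    also have "\<dots> \<le> \<bar>a\<bar>\<^sup>2" using assms that by (intro power_mono) auto
    finally show ?thesis by simp
  qed
  then have "R \<le> (x i)\<^sup>2 + (y i)\<^sup>2"
    using i(2) by (metis add_increasing2 add_increasing zero_le_power2)
  then have "cutoff R \<delta> i x y = 0" using i(1) assms by (intro cutoff_eq_0) (simp_all add: radius2_def)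
  then have "0 \<in> set (map (\<lambda>i. cutoff R \<delta> i x y) (others \<delta>))" using i(1) by force
  moreover have "prod_list Fs = 0" if "0 \<in> set Fs" for Fs :: "('a + 'a, complex) grassmann list"
    using that by (induction Fs) auto
  ultimately show "cutoffs R \<delta> x y = 0" unfolding cutoffs_def by blast
qed

text \<open>
  For growing \<open>R\<close> the bodies of the cutoffs tend to \<open>1\<close>, and their nilpotent parts carry a factor
  \<open>1 / R\<close>.
\<close>

lemma cutoffs_tendsto: "(\<lambda>m. cutoffs (real (Suc m)) \<delta> x y) \<longlonglongrightarrow> 1"
proof -
  have "(\<lambda>m. prod_list (map (\<lambda>i. cutoff (real (Suc m)) \<delta> i x y) vs)) \<longlonglongrightarrow> 1" for vs
  proof (induction vs)
    case (Cons v vs)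
    from tendsto_mult[OF cutoff_tendsto Cons, of \<delta> v x y] show ?case by simp
  qed simp
  then show ?thesis by (simp add: cutoffs_def)
qed

lemma radius2_origin [simp]: "radius2 \<delta> i (origin \<delta>) (origin \<delta>) = 0"
  by (simp add: radius2_def origin_def)

lemma body_radial_super: "body (radial_super \<delta> g g' i x y) = of_real (g (radius2 \<delta> i x y))"
  by (simp add: radial_super_def)

lemma prod_list_ones: "(\<And>a. a \<in> set as \<Longrightarrow> a = 1) \<Longrightarrow> prod_list as = (1 :: 'b::monoid_mult)"
  by (induction as) auto

lemma body_cutoffs_origin: "R > 0 \<Longrightarrow> body (cutoffs R \<delta> (origin \<delta>) (origin \<delta>)) = 1"
  unfolding cutoffs_def body_prod_list
  by (rule prod_list_ones) (auto simp: cutoff_def body_radial_super)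

lemma body_inverse_z_product_origin: "body (inverse_z_product \<delta> (origin \<delta>) (origin \<delta>)) = 1"
  unfolding inverse_z_product_eq body_prod_list
  by (rule prod_list_ones) (auto simp: complexify_inverse_zcoord body_radial_super)

lemma body_zcoord: "body (zcoord \<delta> i x y) = sqrt (1 + radius2 \<delta> i x y)"
  by (simp add: zcoord_eq)

lemma body_coord_origin: "body (coord \<delta> (origin \<delta>) i) = 0"
  by (simp add: coord_def origin_def)

lemma body_taylor_sum:
  "body n = 0 \<Longrightarrow> body (\<Sum>k\<le>N. const (c k) * n ^ k) = c 0"
  by (simp add: body_sum power_0_left if_distrib cong: if_cong)

lemma body_exp_action_origin: "body (exp_action \<delta> E W (origin \<delta>) (origin \<delta>)) = 1"
proof -
  have "body (action \<delta> E W (origin \<delta>) (origin \<delta>)) = 0"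
    by (auto simp: action_def body_sum case_prod_unfold body_zcoord body_coord_origin xi_def eta_def
        intro!: sum.neutral)
  then show ?thesis by (simp add: exp_action_eq body_taylor_sum)
qed

lemma body_holomorphic_observable_origin:
  "body (holomorphic_observable \<delta> J H \<theta> (origin \<delta>) (origin \<delta>)) = H (of_real (\<Sum>i\<in>UNIV. \<theta> i))"
proof -
  have "body (theta_xz \<delta> \<theta> (origin \<delta>) (origin \<delta>)) = (\<Sum>i\<in>UNIV. \<theta> i)"
    by (simp add: theta_xz_def body_sum body_zcoord body_coord_origin)
  moreover have "theta_y \<delta> \<theta> (origin \<delta>) = 0"
    by (auto simp: theta_y_def origin_def intro!: sum.neutral)
  ultimately show ?thesis by (simp add: holomorphic_observable_def body_taylor_sum)
qed

text \<open>
  The cutoff admits every entire \<open>H\<close>, whatever its growth, and its value \<open>1\<close> at the origin leaves no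
  trace of \<open>R\<close> in the result.
\<close>

lemma localization_holomorphic:
  fixes \<delta> :: "'v::finite" and E W \<theta>
  assumes J: "J * J = - 1" and H: "H holomorphic_on UNIV" and R: "R > 0"
  defines "B \<equiv> \<lambda>x y. inverse_z_product \<delta> x y * exp_action \<delta> E W x y *
    holomorphic_observable \<delta> J H \<theta> x y * cutoffs R \<delta> x y"
  shows "(\<integral>p. berezin \<delta> (B (fst p) (snd p)) \<partial>coord_measure \<delta>) =
      of_real ((2 * pi) ^ card (UNIV - {\<delta>})) * H (of_real (\<Sum>i\<in>UNIV. \<theta> i))"
    and "integrable (coord_measure \<delta>) (\<lambda>p. berezin \<delta> (B (fst p) (snd p)))"
proof -
  have closed: "susy \<delta> J B (\<lambda>x y. 0)"
    unfolding B_def using J H R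
    by (intro susy_closed_mult susy_closed_inverse_z_product susy_closed_exp_action
        susy_closed_holomorphic_observable susy_closed_cutoffs)
  have even: "even_elt (B x y)" for x y
    unfolding B_def by (intro even_elt_times even_inverse_z_product even_exp_action
        even_holomorphic_observable even_cutoffs)
  have supp: "supported_in \<delta> (1 + R) B"
    using supported_in_cutoffs[OF R, of \<delta>] by (auto simp: supported_in_def B_def)
  show "(\<integral>p. berezin \<delta> (B (fst p) (snd p)) \<partial>coord_measure \<delta>) =
      of_real ((2 * pi) ^ card (UNIV - {\<delta>})) * H (of_real (\<Sum>i\<in>UNIV. \<theta> i))"
    unfolding localization[OF J closed even supp]
    by (simp add: B_def body_inverse_z_product_origin body_exp_action_origin
        body_holomorphic_observable_origin body_cutoffs_origin[OF R])
  show "integrable (coord_measure \<delta>) (\<lambda>p. berezin \<delta> (B (fst p) (snd p)))"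
    by (rule integrable_berezin[OF susy_continuous[OF closed] supp])
qed

text \<open>
  Up to the factor \<open>1 / c\<close>, the integrand is dominated by the exponential density and its reflection.
\<close>

lemma integrable_exp_minus_abs:
  assumes "c > 0" shows "integrable lborel (\<lambda>t::real. exp (- c * \<bar>t\<bar>))"
proof -
  let ?d = "exponential_density c"
  interpret prob_space "density lborel ?d" by (rule prob_space_exponential_density[OF assms])
  have "(\<integral>\<^sup>+ t. ennreal (?d t) \<partial>lborel) = 1"
    using emeasure_space_1 by (simp add: emeasure_density cong: nn_integral_cong)
  then have d: "integrable lborel ?d"
    using assms by (intro integrableI_nn_integral_finite[where x = 1])
      (auto simp: exponential_density_def intro!: AE_I2)
  then have "integrable lborel (\<lambda>t. ?d (0 + (- 1) * t))"
    using lborel_integrable_real_affine[OF d, of "- 1" 0] by simp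
  then have "integrable lborel (\<lambda>t. 1 / c * (?d t + ?d (0 + (- 1) * t)))"
    using d by (intro integrable_mult_right Bochner_Integration.integrable_add) auto
  then show ?thesis
  proof (rule Bochner_Integration.integrable_bound)
    show "AE t in lborel. norm (exp (- c * \<bar>t\<bar>)) \<le> norm (1 / c * (?d t + ?d (0 + (- 1) * t)))"
      using assms by (intro AE_I2) (auto simp: exponential_density_def abs_if field_simps)
  qed simp
qed

lemma coord_norm_nonneg: "0 \<le> coord_norm \<delta> x y"
  unfolding coord_norm_def by (intro real_sqrt_ge_zero sum_nonneg) auto

lemma abs_le_coord_norm:
  assumes "i \<noteq> \<delta>" shows "\<bar>x i\<bar> \<le> coord_norm \<delta> x y" "\<bar>y i\<bar> \<le> coord_norm \<delta> x y"
proof -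
  have le: "(x i)\<^sup>2 + (y i)\<^sup>2 \<le> (\<Sum>i\<in>UNIV - {\<delta>}. (x i)\<^sup>2 + (y i)\<^sup>2)"
    using assms by (intro member_le_sum) auto
  have "sqrt ((x i)\<^sup>2) \<le> coord_norm \<delta> x y" "sqrt ((y i)\<^sup>2) \<le> coord_norm \<delta> x y"
    unfolding coord_norm_def using le zero_le_power2[of "x i"] zero_le_power2[of "y i"]
    by (intro real_sqrt_le_mono; linarith)+
  then show "\<bar>x i\<bar> \<le> coord_norm \<delta> x y" "\<bar>y i\<bar> \<le> coord_norm \<delta> x y" by simp_all
qed

text \<open>
  The decay hypothesis bounds every coefficient outside a ball of its own; finitely many coefficients and
  continuity inside the largest ball give one bound for the norm on the whole product space.
\<close>

lemma norm_le_exp_decay: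
  fixes F :: "('v::finite, complex) superfunction"
  assumes F: "continuous_super F" and decay: "exp_decaying \<delta> F"
  obtains c C where "c > 0" "C \<ge> 0" "\<And>x y. x \<in> space (coord_factor \<delta>) \<Longrightarrow> y \<in> space (coord_factor \<delta>) \<Longrightarrow>
    norm (F x y) \<le> C * exp (- c * coord_norm \<delta> x y)"
proof -
  from decay obtain c C R where cCR: "\<And>S. c S > 0" "\<And>S x y. coord_norm \<delta> x y \<ge> R S \<Longrightarrow>
      cmod (coeff (F x y) S) \<le> C S * exp (- c S * coord_norm \<delta> x y)"
    unfolding exp_decaying_def by metis
  define c0 where "c0 = Min (range c)"
  define C0 where "C0 = (\<Sum>S\<in>UNIV. \<bar>C S\<bar>)"
  define R0 where "R0 = max 0 (Max (range R))"
  have c0: "c0 > 0" "\<And>S. c0 \<le> c S" using cCR(1) by (simp_all add: c0_def)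
  have R0: "R S \<le> R0" "0 \<le> R0" for S
    by (simp_all add: R0_def le_max_iff_disj)
  have far: "norm (F x y) \<le> C0 * exp (- c0 * coord_norm \<delta> x y)" if "coord_norm \<delta> x y \<ge> R0" for x y
    unfolding norm_grassmann_def C0_def sum_distrib_right
  proof (rule sum_mono)
    fix S
    have "cmod (coeff (F x y) S) \<le> C S * exp (- c S * coord_norm \<delta> x y)"
      using cCR(2) R0(1) that order.trans by blast
    also have "\<dots> \<le> \<bar>C S\<bar> * exp (- c0 * coord_norm \<delta> x y)"
      using c0(2)[of S] coord_norm_nonneg[of \<delta> x y] by (intro mult_mono) (auto intro: mult_right_mono)
    finally show "cmod (coeff (F x y) S) \<le> \<bar>C S\<bar> * exp (- c0 * coord_norm \<delta> x y)" .
  qed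
  obtain C1 where C1: "C1 \<ge> 0" "\<And>x y. x \<in> space (coord_factor \<delta>) \<Longrightarrow> y \<in> space (coord_factor \<delta>) \<Longrightarrow>
      (\<And>i. i \<noteq> \<delta> \<Longrightarrow> \<bar>x i\<bar> \<le> R0 \<and> \<bar>y i\<bar> \<le> R0) \<Longrightarrow> norm (F x y) \<le> C1"
    using bounded_on_box[OF F, of \<delta> R0] by blast
  have "norm (F x y) \<le> (C0 + C1 * exp (c0 * R0)) * exp (- c0 * coord_norm \<delta> x y)"
    if "x \<in> space (coord_factor \<delta>)" "y \<in> space (coord_factor \<delta>)" for x y
  proof (cases "coord_norm \<delta> x y \<ge> R0")
    case True
    have "norm (F x y) \<le> C0 * exp (- c0 * coord_norm \<delta> x y)" by (rule far[OF True])
    also have "\<dots> \<le> (C0 + C1 * exp (c0 * R0)) * exp (- c0 * coord_norm \<delta> x y)"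
      using C1(1) by (intro mult_right_mono) auto
    finally show ?thesis .
  next
    case False
    have "norm (F x y) \<le> C1"
    proof (rule C1(2)[OF that])
      fix i assume "i \<noteq> \<delta>"
      from abs_le_coord_norm[OF this, where x = x and y = y] False show "\<bar>x i\<bar> \<le> R0 \<and> \<bar>y i\<bar> \<le> R0" by linarith
    qed
    also have "\<dots> \<le> C1 * (exp (c0 * R0) * exp (- c0 * coord_norm \<delta> x y))"
    proof -
      have "0 \<le> c0 * R0 + - c0 * coord_norm \<delta> x y"
        using False c0(1) by (simp add: algebra_simps mult_left_mono)
      then have "1 \<le> exp (c0 * R0) * exp (- c0 * coord_norm \<delta> x y)" by (simp flip: exp_add)
      then show ?thesis using C1(1) mult_left_mono[of 1 _ C1] by simp
    qed
    also have "\<dots> \<le> (C0 + C1 * exp (c0 * R0)) * exp (- c0 * coord_norm \<delta> x y)"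
      using sum_nonneg[of UNIV "\<lambda>S. \<bar>C S\<bar>"] by (simp add: C0_def distrib_right mult_ac)
    finally show ?thesis .
  qed
  moreover have "C0 + C1 * exp (c0 * R0) \<ge> 0"
    using C1(1) by (simp add: C0_def sum_nonneg)
  ultimately show ?thesis using that c0(1) by blast
qed

lemma integrable_exp_coord_norm:
  assumes "c > 0" shows "integrable (coord_measure \<delta>) (\<lambda>p. exp (- c * coord_norm \<delta> (fst p) (snd p)))"
proof -
  let ?n = "card (UNIV - {\<delta>})" and ?I = "UNIV - {\<delta>}"
  \<comment> \<open>The sum of all \<open>\<bar>x\<^sub>i\<bar> + \<bar>y\<^sub>i\<bar>\<close> is at most \<open>2 n\<close> times the norm; \<open>n + 1\<close> avoids division by zero.\<close>
  define d where "d = c / (2 * (real ?n + 1))"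
  have d: "d > 0" using assms by (simp add: d_def)
  have "integrable (coord_measure \<delta>) (\<lambda>p. \<Prod>i\<in>?I. exp (- d * \<bar>fst p i\<bar>) * exp (- d * \<bar>snd p i\<bar>))"
    by (rule coord_product(1)[OF integrable_exp_minus_abs[OF d]])
  then show ?thesis
  proof (rule Bochner_Integration.integrable_bound)
    have cont: "continuous_on UNIV (\<lambda>p :: ('a \<Rightarrow> real) \<times> ('a \<Rightarrow> real). fst p i)"
      "continuous_on UNIV (\<lambda>p :: ('a \<Rightarrow> real) \<times> ('a \<Rightarrow> real). snd p i)"
      for i :: 'a
      by (rule continuous_super_coordinate[of i, unfolded continuous_super_def])+
    have "continuous_super (\<lambda>x y. exp (- c * coord_norm \<delta> x y))"
      unfolding continuous_super_def coord_norm_def by (intro continuous_intros cont)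
    from measurable_super[OF this]
    show "(\<lambda>p. exp (- c * coord_norm \<delta> (fst p) (snd p))) \<in> borel_measurable (coord_measure \<delta>)" .
    show "AE p in coord_measure \<delta>. norm (exp (- c * coord_norm \<delta> (fst p) (snd p))) \<le>
        norm (\<Prod>i\<in>?I. exp (- d * \<bar>fst p i\<bar>) * exp (- d * \<bar>snd p i\<bar>))"
    proof (rule AE_I2)
      fix p :: "('a \<Rightarrow> real) \<times> ('a \<Rightarrow> real)"
      obtain x y where p: "p = (x, y)" by (cases p)
      let ?N = "coord_norm \<delta> x y"
      have "\<bar>x i\<bar> + \<bar>y i\<bar> \<le> 2 * ?N" if "i \<in> ?I" for i
        using that abs_le_coord_norm[of i \<delta> x y] abs_le_coord_norm(2)[of i \<delta> y x] by simp
      then have "(\<Sum>i\<in>?I. \<bar>x i\<bar> + \<bar>y i\<bar>) \<le> real ?n * (2 * ?N)"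
        by (rule sum_bounded_above)
      also have "\<dots> \<le> (real ?n + 1) * (2 * ?N)" using coord_norm_nonneg[of \<delta> x y] by (intro mult_right_mono) auto
      finally have "d * (\<Sum>i\<in>?I. \<bar>x i\<bar> + \<bar>y i\<bar>) \<le> d * ((real ?n + 1) * (2 * ?N))"
        using d by (intro mult_left_mono) auto
      also have "\<dots> = c * ?N" by (simp add: d_def)
      finally have le: "d * (\<Sum>i\<in>?I. \<bar>x i\<bar> + \<bar>y i\<bar>) \<le> c * ?N" .
      have "(\<Sum>i\<in>?I. - d * \<bar>x i\<bar> + - d * \<bar>y i\<bar>) = (\<Sum>i\<in>?I. - (d * (\<bar>x i\<bar> + \<bar>y i\<bar>)))"
        by (intro sum.cong) (auto simp: distrib_left)
      also have "\<dots> = - (d * (\<Sum>i\<in>?I. \<bar>x i\<bar> + \<bar>y i\<bar>))"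
        by (simp only: sum_negf sum_distrib_left)
      finally have "exp (- c * ?N) \<le> exp (\<Sum>i\<in>?I. - d * \<bar>x i\<bar> + - d * \<bar>y i\<bar>)"
        using le by simp
      also have "\<dots> = (\<Prod>i\<in>?I. exp (- d * \<bar>x i\<bar>) * exp (- d * \<bar>y i\<bar>))"
        by (simp only: exp_sum[OF finite] exp_add)
      finally show "norm (exp (- c * coord_norm \<delta> (fst p) (snd p))) \<le>
          norm (\<Prod>i\<in>?I. exp (- d * \<bar>fst p i\<bar>) * exp (- d * \<bar>snd p i\<bar>))"
        by (simp add: p abs_prod)
    qed
  qed
qed

theorem lemma5p1:
  fixes \<delta> :: "'v::finite"
    and E :: "('v \<times> 'v) set"
    and W :: "'v \<Rightarrow> 'v \<Rightarrow> real"
    and f :: "real \<times> real \<Rightarrow> complex"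
    and \<theta> :: "'v \<Rightarrow> real"
  assumes undirected: "sym E"
    and no_self_loops: "irrefl E"
    and connected_graph: "\<And>i j. (i, j) \<in> E\<^sup>*"
    and W_symmetric: "\<And>i j. W i j = W j i"
    and W_positive: "\<And>i j. (i, j) \<in> E \<Longrightarrow> W i j > 0"
    and W_zero: "\<And>i j. (i, j) \<notin> E \<Longrightarrow> W i j = 0"
    and harmonic: "harmonic_plane f"
    and decay: "exp_decaying \<delta> (\<lambda>x y. theta_observable \<delta> f \<theta> x y * exp_action \<delta> E W x y)"
  shows "super_integrable \<delta> E W (theta_observable \<delta> f \<theta>) \<and>
    super_expectation \<delta> E W (theta_observable \<delta> f \<theta>) = f (\<Sum>i\<in>UNIV. \<theta> i, 0)"
proof -
  let ?n = "card (UNIV - {\<delta>})" and ?M = "coord_measure \<delta>" and ?s = "\<Sum>i\<in>UNIV. \<theta> i"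
  let ?P = "inverse_z_product \<delta>" and ?e = "exp_action \<delta> E W" and ?F = "theta_observable \<delta> f \<theta>"
  obtain H K where H: "H holomorphic_on UNIV" and K: "K holomorphic_on UNIV"
    and HK: "\<And>k a b. (partial1 ^^ k) f (a, b) =
      (deriv ^^ k) H (of_real a + \<i> * of_real b) + (deriv ^^ k) K (of_real a + - \<i> * of_real b)"
    using harmonic_decomposition[OF harmonic] by metis
  let ?H = "holomorphic_observable \<delta> \<i> H \<theta>" and ?K = "holomorphic_observable \<delta> (- \<i>) K \<theta>"
  have F: "?F x y = ?H x y + ?K x y" for x y
    by (rule theta_observable_eq[OF HK])
  have cont: "continuous_super ?P" "continuous_super ?e" "continuous_super ?F"
  proof -
    have "continuous_super ?H" "continuous_super ?K"
      using susy_closed_holomorphic_observable[of \<i> H \<delta> \<theta>] susy_closed_holomorphic_observable[of "- \<i>" K \<delta> \<theta>] H K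
      by (auto intro: susy_continuous)
    then show "continuous_super ?F"
      unfolding theta_observable_eq[OF HK, abs_def] by (rule continuous_super_add)
  qed (auto intro: susy_continuous[OF susy_closed_inverse_z_product[of \<delta> \<i>]]
      susy_continuous[OF susy_closed_exp_action[of \<delta> \<i>]])
  define A where "A = (\<lambda>x y. ?P x y * ?e x y * ?F x y)"
  have cont_A: "continuous_super A"
    unfolding A_def by (intro continuous_super_mult cont)
  obtain c C where c: "c > 0" "C \<ge> 0" and decays: "\<And>x y. x \<in> space (coord_factor \<delta>) \<Longrightarrow>
      y \<in> space (coord_factor \<delta>) \<Longrightarrow> norm (?F x y * ?e x y) \<le> C * exp (- c * coord_norm \<delta> x y)"
    using norm_le_exp_decay[OF continuous_super_mult[OF cont(3,2)] decay] by blast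
  \<comment> \<open>The factors \<open>1 / z\<^sub>i\<close> have norm at most \<open>2\<close>, and the cutoffs with \<open>R \<ge> 1\<close> norm at most \<open>7\<close>.\<close>
  define g where "g p = 7 ^ ?n * (2 ^ ?n * C) * exp (- c * coord_norm \<delta> (fst p) (snd p))" for p
  have g: "integrable ?M g"
    unfolding g_def by (intro integrable_mult_right integrable_exp_coord_norm c(1))
  have bound: "norm (berezin \<delta> (A (fst p) (snd p) * G)) \<le> g p"
    if "p \<in> space ?M" "norm G \<le> 7 ^ ?n" for p G
  proof -
    have "A (fst p) (snd p) = ?P (fst p) (snd p) * (?F (fst p) (snd p) * ?e (fst p) (snd p))"
      using even_elt_commute[where F = "?e (fst p) (snd p)" and G = "?F (fst p) (snd p)", OF even_exp_action]
      by (simp only: A_def mult.assoc)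
    then have "norm (A (fst p) (snd p)) \<le>
        norm (?P (fst p) (snd p)) * norm (?F (fst p) (snd p) * ?e (fst p) (snd p))"
      by (simp add: norm_mult_ineq)
    also have "\<dots> \<le> 2 ^ ?n * (C * exp (- c * coord_norm \<delta> (fst p) (snd p)))"
      using that(1) by (intro mult_mono norm_inverse_z_product_le decays) (auto simp: space_coord_measure)
    finally have "norm (A (fst p) (snd p)) * norm G \<le>
        2 ^ ?n * (C * exp (- c * coord_norm \<delta> (fst p) (snd p))) * 7 ^ ?n"
      using that(2) c(2) by (intro mult_mono) auto
    moreover have "norm (berezin \<delta> (A (fst p) (snd p) * G)) \<le> norm (A (fst p) (snd p)) * norm G"
      using norm_berezin_le norm_mult_ineq order.trans by blast
    ultimately show ?thesis by (simp add: g_def mult_ac)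
  qed
  have meas: "(\<lambda>p. berezin \<delta> (A (fst p) (snd p))) \<in> borel_measurable ?M"
    by (rule measurable_super[OF continuous_berezin[OF cont_A]])
  have int: "integrable ?M (\<lambda>p. berezin \<delta> (A (fst p) (snd p)))"
    using g meas
  proof (rule Bochner_Integration.integrable_bound)
    show "AE p in ?M. norm (berezin \<delta> (A (fst p) (snd p))) \<le> norm (g p)"
    proof (rule AE_I2)
      fix p assume "p \<in> space ?M"
      from bound[OF this, of 1] show "norm (berezin \<delta> (A (fst p) (snd p))) \<le> norm (g p)" by simp
    qed
  qed
  have f_value: "f (?s, 0) = H (of_real ?s) + K (of_real ?s)"
    using HK[of 0 ?s 0] by simp
  \<comment> \<open>The two parts of \<open>f\<close> are closed for different supercharges, the common factors for both.\<close>
  have cut: "(\<integral>p. berezin \<delta> (A (fst p) (snd p) * cutoffs R \<delta> (fst p) (snd p)) \<partial>?M) =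
      of_real ((2 * pi) ^ ?n) * f (?s, 0)" if "R > 0" for R
  proof -
    have i: "\<i> * \<i> = - 1" "- \<i> * - \<i> = - 1" by simp_all
    have "berezin \<delta> (A x y * cutoffs R \<delta> x y) = berezin \<delta> (?P x y * ?e x y * ?H x y * cutoffs R \<delta> x y) +
        berezin \<delta> (?P x y * ?e x y * ?K x y * cutoffs R \<delta> x y)" for x y
      by (simp add: A_def F distrib_left distrib_right berezin_add)
    then show ?thesis
      using localization_holomorphic[OF i(1) H that, of \<delta> E W \<theta>]
        localization_holomorphic[OF i(2) K that, of \<delta> E W \<theta>]
      by (simp add: f_value distrib_left)
  qed
  have "(\<lambda>m. \<integral>p. berezin \<delta> (A (fst p) (snd p) * cutoffs (real (Suc m)) \<delta> (fst p) (snd p)) \<partial>?M)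
      \<longlonglongrightarrow> (\<integral>p. berezin \<delta> (A (fst p) (snd p)) \<partial>?M)"
  proof (rule integral_dominated_convergence[OF meas _ g])
    fix m
    have "continuous_super (\<lambda>x y. A x y * cutoffs (real (Suc m)) \<delta> x y)"
      using susy_continuous[OF susy_closed_cutoffs[of "real (Suc m)" \<delta> \<i>]]
      by (intro continuous_super_mult cont_A) simp
    from measurable_super[OF continuous_berezin[OF this], of \<delta>]
    show "(\<lambda>p. berezin \<delta> (A (fst p) (snd p) * cutoffs (real (Suc m)) \<delta> (fst p) (snd p))) \<in> borel_measurable ?M" .
    show "AE p in ?M. norm (berezin \<delta> (A (fst p) (snd p) * cutoffs (real (Suc m)) \<delta> (fst p) (snd p))) \<le> g p"
      by (intro AE_I2 bound norm_cutoffs_le) simp_all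
  next
    show "AE p in ?M. (\<lambda>m. berezin \<delta> (A (fst p) (snd p) * cutoffs (real (Suc m)) \<delta> (fst p) (snd p)))
        \<longlonglongrightarrow> berezin \<delta> (A (fst p) (snd p))"
    proof (rule AE_I2)
      fix p :: "('v \<Rightarrow> real) \<times> ('v \<Rightarrow> real)"
      have "(\<lambda>m. A (fst p) (snd p) * cutoffs (real (Suc m)) \<delta> (fst p) (snd p)) \<longlonglongrightarrow> A (fst p) (snd p) * 1"
        by (intro tendsto_mult tendsto_const cutoffs_tendsto)
      from bounded_linear.tendsto[OF bounded_linear_berezin this]
      show "(\<lambda>m. berezin \<delta> (A (fst p) (snd p) * cutoffs (real (Suc m)) \<delta> (fst p) (snd p)))
        \<longlonglongrightarrow> berezin \<delta> (A (fst p) (snd p))" by simp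
    qed
  qed
  moreover have "(\<lambda>m. \<integral>p. berezin \<delta> (A (fst p) (snd p) * cutoffs (real (Suc m)) \<delta> (fst p) (snd p)) \<partial>?M) =
      (\<lambda>m. of_real ((2 * pi) ^ ?n) * f (?s, 0))"
    using cut by (intro ext) simp
  ultimately have "(\<lambda>m::nat. of_real ((2 * pi) ^ ?n) * f (?s, 0)) \<longlonglongrightarrow>
      (\<integral>p. berezin \<delta> (A (fst p) (snd p)) \<partial>?M)"
    by (simp only:)
  then have total: "(\<integral>p. berezin \<delta> (A (fst p) (snd p)) \<partial>?M) = of_real ((2 * pi) ^ ?n) * f (?s, 0)"
    by (rule LIMSEQ_unique[OF _ tendsto_const])
  have integrand: "super_integrand \<delta> E W ?F =
      (\<lambda>p. berezin \<delta> (A (fst p) (snd p)) / of_real ((2 * pi) ^ ?n))"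
    by (rule ext) (simp only: super_integrand_def berezin_def A_def case_prod_beta)
  show ?thesis
    unfolding super_integrable_def super_expectation_def integrand
    using int total by simp
qed

end
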